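(* Let $\Bbbk$ be a commutative ring, let $t\in\Bbbk$, and let $k,l$ be nonnegative integers. The morphism space $\mathrm{Hom}_{\mathcal{RB}(t)}(k,l)$ of the rook-Brauer category $\mathcal{RB}(t)$ has a linear basis (over $\Bbbk$) given by all rook-Brauer diagrams of type $\binom{l}{k}$.
   Context: Partition diagrams. A partition of type $\binom{l}{k}$, written $D\colon k\to l$, is a set partition of $\{1,\dots,k,1',\dots,l'\}$; its elements are called blocks. It is drawn as a partition diagram with $k$ vertices $1,\dots,k$ (left to right) in the bottom row and $l$ vertices $1',\dots,l'$ (left to right) in the top row, with edges chosen so that the connected components are the blocks; diagrams giving the same set partition are identified. $D$ is a rook-Brauer diagram if all blocks have size at most 2. Partition category. $\mathcal{P}ar(t)$ is the strict $\Bbbk$-linear monoidal category with objects the nonnegative integers, $\mathrm{Hom}(k,l)$ the $\Bbbk$-module of all formal $\Bbbk$-linear combinations of partitions of type $\binom{l}{k}$, composition $D\circ D'=t^{\alpha(D,D')}D\star D'$ extended bilinearly, where, stacking $D\colon k\to l$ on top of $D'\colon m\to k$, $\alpha(D,D')$ is the number of connected components all of whose vertices are in the middle row, and $D\star D'\colon m\to l$ is the partition in which vertices lie in the same block iff the corresponding top/bottom vertices are connected in the stacked diagram; tensor product is $k\otimes l=k+l$ on objects (unit object $0$) and horizontal juxtaposition ($D$ on the left, $D'$ on the right) for $D\otimes D'$. Rook-Brauer category. $\mathcal{RB}(t)$ is the strict $\Bbbk$-linear monoidal category generated by one object $1$ and morphisms $s\colon2\to2$, $d\colon2\to0$, $c\colon0\to2$,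 $\eta\colon0\to1$, $\varepsilon\colon1\to0$ (where $0$ is the unit object, $k$ is the $k$-fold tensor power of $1$, and $\mathrm{id}=\mathrm{id}_1$), subject to the following relations (listed together with their reflections in horizontal and vertical lines): $s\circ s=\mathrm{id}_2$; $(s\otimes\mathrm{id})\circ(\mathrm{id}\otimes s)\circ(s\otimes\mathrm{id})=(\mathrm{id}\otimes s)\circ(s\otimes\mathrm{id})\circ(\mathrm{id}\otimes s)$; $(d\otimes\mathrm{id})\circ(\mathrm{id}\otimes c)=\mathrm{id}=(\mathrm{id}\otimes d)\circ(c\otimes\mathrm{id})$; $(\mathrm{id}\otimes d)\circ(s\otimes\mathrm{id})=(d\otimes\mathrm{id})\circ(\mathrm{id}\otimes s)$; $(s\otimes\mathrm{id})\circ(\mathrm{id}\otimes c)=(\mathrm{id}\otimes s)\circ(c\otimes\mathrm{id})$; $d\circ s=d$; $s\circ c=c$; $s\circ(\eta\otimes\mathrm{id})=\mathrm{id}\otimes\eta$; $s\circ(\mathrm{id}\otimes\eta)=\eta\otimes\mathrm{id}$; $(\varepsilon\otimes\mathrm{id})\circ s=\mathrm{id}\otimes\varepsilon$; $(\mathrm{id}\otimes\varepsilon)\circ s=\varepsilon\otimes\mathrm{id}$; $d\circ c=d\circ(\eta\otimes\eta)=(\varepsilon\otimes\varepsilon)\circ c=\varepsilon\circ\eta=t\,\mathrm{id}_0$. Diagrams as morphisms. There is a strict $\Bbbk$-linear monoidal functor $H\colon\mathcal{RB}(t)\to\mathcal{P}ar(t)$ with $1\mapsto1$, $s\mapsto\{\{1,2'\},\{2,1'\}\}$,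 $d\mapsto\{\{1,2\}\}$, $c\mapsto\{\{1',2'\}\}$, and $\eta,\varepsilon$ sent to the unique partitions of type $\binom10$, $\binom01$. A rook-Brauer diagram $D$ is regarded as a morphism of $\mathcal{RB}(t)$ by building it from the generators and identity morphisms by finitely many compositions and tensor products, so that its image under $H$ is $D$.
   Formalization: The relation d∘(η⊗id)=ε is added to the defining relations of RB(t); without it the claim fails, e.g. for t=0 and 1≠0, where d∘(η⊗id) and ε are different nonzero morphisms 1→0 with the same diagram. *)

theory Defs
  imports "HOL-Algebra.Module" "HOL-Library.Disjoint_Sets" "HOL-Library.Poly_Mapping"
begin

text \<open>
  Scalars have sort \<open>{comm_ring, comm_monoid_mult}\<close>: commutative rings with unit, the zero ring
  included (which \<open>comm_ring_1\<close> would rule out).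
\<close>

section \<open>Partition diagrams\<close>

text \<open>\<open>Bot i\<close> is the vertex \<open>i\<close> of the bottom row, \<open>Top j\<close> the vertex \<open>j'\<close> of the top row.\<close>

datatype vertex = Bot nat | Top nat

type_synonym diagram = "vertex set set"

definition partitions :: "nat \<Rightarrow> nat \<Rightarrow> diagram set" where
  "partitions k l = {D. partition_on (Bot ` {1..k} \<union> Top ` {1..l}) D}"

definition rook_brauer_diagrams :: "nat \<Rightarrow> nat \<Rightarrow> diagram set" where
  "rook_brauer_diagrams k l = {D \<in> partitions k l. \<forall>B\<in>D. card B \<le> 2}"

text \<open>Vertices of two stacked diagrams: lower, middle and upper row.\<close>

datatype stacked_vertex = Low nat | Mid nat | High nat

primrec in_upper :: "vertex \<Rightarrow> stacked_vertex" where
  "in_upper (Bot i) = Mid i"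
| "in_upper (Top j) = High j"

primrec in_lower :: "vertex \<Rightarrow> stacked_vertex" where
  "in_lower (Bot i) = Low i"
| "in_lower (Top j) = Mid j"

primrec in_outer :: "vertex \<Rightarrow> stacked_vertex" where
  "in_outer (Bot i) = Low i"
| "in_outer (Top j) = High j"

text \<open>In the following three definitions \<open>D\<close> is stacked on top of \<open>D'\<close>.\<close>

definition stack :: "diagram \<Rightarrow> diagram \<Rightarrow> stacked_vertex set set" where
  "stack D D' = image in_upper ` D \<union> image in_lower ` D'"

definition stack_components :: "diagram \<Rightarrow> diagram \<Rightarrow> stacked_vertex set set" where
  "stack_components D D' =
     \<Union>(stack D D') // {(x, y). \<exists>B\<in>stack D D'. x \<in> B \<and> y \<in> B}\<^sup>+"

definition inner_components :: "diagram \<Rightarrow> diagram \<Rightarrow> nat" where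
  "inner_components D D' = card {C \<in> stack_components D D'. C \<subseteq> range Mid}"

definition diagram_star :: "diagram \<Rightarrow> diagram \<Rightarrow> diagram" where
  "diagram_star D D' = (\<lambda>C. in_outer -` C) ` stack_components D D' - {{}}"

primrec shift_vertex :: "nat \<Rightarrow> nat \<Rightarrow> vertex \<Rightarrow> vertex" where
  "shift_vertex k l (Bot i) = Bot (k + i)"
| "shift_vertex k l (Top j) = Top (l + j)"

text \<open>Juxtaposition of \<open>D : k \<rightarrow> l\<close> (on the left) with \<open>D'\<close>.\<close>

definition diagram_tensor :: "nat \<Rightarrow> nat \<Rightarrow> diagram \<Rightarrow> diagram \<Rightarrow> diagram" where
  "diagram_tensor k l D D' = D \<union> image (shift_vertex k l) ` D'"

section \<open>Morphisms of the partition category\<close>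

text \<open>A morphism \<open>k \<rightarrow> l\<close> of the partition category is a formal linear combination of elements
  of \<open>partitions k l\<close>; a diagram \<open>D\<close> is the morphism \<open>Poly_Mapping.single D 1\<close>.\<close>

type_synonym 'a par_morphism = "diagram \<Rightarrow>\<^sub>0 'a"

definition par_comp ::
    "'a::{comm_ring,comm_monoid_mult} \<Rightarrow> 'a par_morphism \<Rightarrow> 'a par_morphism \<Rightarrow> 'a par_morphism" where
  "par_comp t f g = (\<Sum>D\<in>Poly_Mapping.keys f. \<Sum>D'\<in>Poly_Mapping.keys g.
     Poly_Mapping.single (diagram_star D D')
       (Poly_Mapping.lookup f D * Poly_Mapping.lookup g D' * t ^ inner_components D D'))"

definition par_tensor ::
    "nat \<Rightarrow> nat \<Rightarrow> 'a::{comm_ring,comm_monoid_mult} par_morphism \<Rightarrow> 'a par_morphism \<Rightarrow> 'a par_morphism" where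
  "par_tensor k l f g = (\<Sum>D\<in>Poly_Mapping.keys f. \<Sum>D'\<in>Poly_Mapping.keys g.
     Poly_Mapping.single (diagram_tensor k l D D')
       (Poly_Mapping.lookup f D * Poly_Mapping.lookup g D'))"

section \<open>The rook-Brauer category by generators and relations\<close>

text \<open>
  The objects of a strict monoidal category generated by one object are the natural numbers.
  Its morphisms are classes of the following formal expressions modulo the congruence \<open>rb_eq\<close>.
  \<open>Id k\<close> is the identity of \<open>k\<close>; \<open>Swap\<close>, \<open>Cap\<close>, \<open>Cup\<close>, \<open>Eta\<close>, \<open>Eps\<close> are \<open>s\<close>, \<open>d\<close>, \<open>c\<close>,
  \<open>\<eta>\<close>, \<open>\<epsilon>\<close>.
\<close>

datatype 'a rb_term =
    Id nat
  | Swap | Cap | Cup | Eta | Eps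
  | Comp "'a rb_term" "'a rb_term"  (infixr \<open>\<bullet>\<close> 70)
  | Tens "'a rb_term" "'a rb_term"  (infixr \<open>\<otimes>\<^sub>t\<close> 75)
  | Zero nat nat
  | Plus "'a rb_term" "'a rb_term"  (infixr \<open>\<oplus>\<^sub>t\<close> 65)
  | Scale 'a "'a rb_term"           (infixr \<open>\<odot>\<^sub>t\<close> 68)

primrec src :: "'a rb_term \<Rightarrow> nat" where
  "src (Id k) = k"
| "src Swap = 2"
| "src Cap = 2"
| "src Cup = 0"
| "src Eta = 0"
| "src Eps = 1"
| "src (f \<bullet> g) = src g"
| "src (f \<otimes>\<^sub>t g) = src f + src g"
| "src (Zero k l) = k"
| "src (f \<oplus>\<^sub>t g) = src f"
| "src (a \<odot>\<^sub>t f) = src f"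

primrec tgt :: "'a rb_term \<Rightarrow> nat" where
  "tgt (Id k) = k"
| "tgt Swap = 2"
| "tgt Cap = 0"
| "tgt Cup = 2"
| "tgt Eta = 1"
| "tgt Eps = 0"
| "tgt (f \<bullet> g) = tgt f"
| "tgt (f \<otimes>\<^sub>t g) = tgt f + tgt g"
| "tgt (Zero k l) = l"
| "tgt (f \<oplus>\<^sub>t g) = tgt f"
| "tgt (a \<odot>\<^sub>t f) = tgt f"

primrec well_typed :: "'a rb_term \<Rightarrow> bool" where
  "well_typed (Id k) = True"
| "well_typed Swap = True"
| "well_typed Cap = True"
| "well_typed Cup = True"
| "well_typed Eta = True"
| "well_typed Eps = True"
| "well_typed (f \<bullet> g) = (well_typed f \<and> well_typed g \<and> src f = tgt g)"
| "well_typed (f \<otimes>\<^sub>t g) = (well_typed f \<and> well_typed g)"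
| "well_typed (Zero k l) = True"
| "well_typed (f \<oplus>\<^sub>t g) = (well_typed f \<and> well_typed g \<and> src f = src g \<and> tgt f = tgt g)"
| "well_typed (a \<odot>\<^sub>t f) = well_typed f"

definition rb_terms :: "nat \<Rightarrow> nat \<Rightarrow> 'a rb_term set" where
  "rb_terms k l = {f. well_typed f \<and> src f = k \<and> tgt f = l}"

text \<open>
  The rules before \<open>swap_swap\<close> make up the theory of strict linear monoidal categories; additive
  inverses are \<open>(- 1) \<odot>\<^sub>t f\<close>. The defining relations start at \<open>swap_swap\<close>; up to \<open>eps_eta\<close> they
  are the published ones, a list closed under reflection in horizontal and vertical lines.

  The last relation, \<open>cap_eta\<close>, is an addition to the published list: it is not a consequence of the
  other relations, and without it the diagrams do not give a basis. Indeed, for \<open>t = 0\<close> all other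
  relations are homogeneous in the number of \<open>\<eta>\<close>'s and in the number of \<open>\<epsilon>\<close>'s, while
  \<open>d \<circ> (\<eta> \<otimes> id)\<close> and \<open>\<epsilon>\<close> have bidegrees \<open>(1, 0)\<close> and \<open>(0, 1)\<close>. If \<open>1 \<noteq> 0\<close> both are nonzero, since
  both are mapped to the unique partition diagram \<open>1 \<rightarrow> 0\<close> in the partition category; so the
  morphism that this diagram is regarded as would depend on how it is built from the generators,
  and neither choice would span \<open>Hom(1, 0)\<close>. The reflections \<open>d \<circ> (id \<otimes> \<eta>) = \<epsilon>\<close> and
  \<open>(\<epsilon> \<otimes> id) \<circ> c = \<eta> = (id \<otimes> \<epsilon>) \<circ> c\<close> of \<open>cap_eta\<close> follow from it.
\<close>

inductive rb_eq :: "'a::{comm_ring,comm_monoid_mult} \<Rightarrow> 'a rb_term \<Rightarrow> 'a rb_term \<Rightarrow> bool" for t where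
  refl: "well_typed f \<Longrightarrow> rb_eq t f f"
| sym: "rb_eq t f g \<Longrightarrow> rb_eq t g f"
| trans: "rb_eq t f g \<Longrightarrow> rb_eq t g h \<Longrightarrow> rb_eq t f h"
| comp_cong: "rb_eq t f f' \<Longrightarrow> rb_eq t g g' \<Longrightarrow> src f = tgt g \<Longrightarrow> rb_eq t (f \<bullet> g) (f' \<bullet> g')"
| tens_cong: "rb_eq t f f' \<Longrightarrow> rb_eq t g g' \<Longrightarrow> rb_eq t (f \<otimes>\<^sub>t g) (f' \<otimes>\<^sub>t g')"
| plus_cong: "rb_eq t f f' \<Longrightarrow> rb_eq t g g' \<Longrightarrow> src f = src g \<Longrightarrow> tgt f = tgt g \<Longrightarrow>
    rb_eq t (f \<oplus>\<^sub>t g) (f' \<oplus>\<^sub>t g')"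
| scale_cong: "rb_eq t f f' \<Longrightarrow> rb_eq t (a \<odot>\<^sub>t f) (a \<odot>\<^sub>t f')"
| comp_assoc: "well_typed ((f \<bullet> g) \<bullet> h) \<Longrightarrow> rb_eq t ((f \<bullet> g) \<bullet> h) (f \<bullet> (g \<bullet> h))"
| comp_id_left: "well_typed f \<Longrightarrow> rb_eq t (Id (tgt f) \<bullet> f) f"
| comp_id_right: "well_typed f \<Longrightarrow> rb_eq t (f \<bullet> Id (src f)) f"
| plus_assoc: "well_typed ((f \<oplus>\<^sub>t g) \<oplus>\<^sub>t h) \<Longrightarrow> rb_eq t ((f \<oplus>\<^sub>t g) \<oplus>\<^sub>t h) (f \<oplus>\<^sub>t (g \<oplus>\<^sub>t h))"
| plus_commute: "well_typed (f \<oplus>\<^sub>t g) \<Longrightarrow> rb_eq t (f \<oplus>\<^sub>t g) (g \<oplus>\<^sub>t f)"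
| plus_zero: "well_typed f \<Longrightarrow> rb_eq t (f \<oplus>\<^sub>t Zero (src f) (tgt f)) f"
| plus_neg: "well_typed f \<Longrightarrow> rb_eq t (f \<oplus>\<^sub>t (- 1) \<odot>\<^sub>t f) (Zero (src f) (tgt f))"
| scale_plus: "well_typed (f \<oplus>\<^sub>t g) \<Longrightarrow> rb_eq t (a \<odot>\<^sub>t (f \<oplus>\<^sub>t g)) (a \<odot>\<^sub>t f \<oplus>\<^sub>t a \<odot>\<^sub>t g)"
| scale_add: "well_typed f \<Longrightarrow> rb_eq t ((a + b) \<odot>\<^sub>t f) (a \<odot>\<^sub>t f \<oplus>\<^sub>t b \<odot>\<^sub>t f)"
| scale_scale: "well_typed f \<Longrightarrow> rb_eq t ((a * b) \<odot>\<^sub>t f) (a \<odot>\<^sub>t b \<odot>\<^sub>t f)"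
| scale_one: "well_typed f \<Longrightarrow> rb_eq t (1 \<odot>\<^sub>t f) f"
| comp_plus_left: "well_typed ((f \<oplus>\<^sub>t g) \<bullet> h) \<Longrightarrow> rb_eq t ((f \<oplus>\<^sub>t g) \<bullet> h) (f \<bullet> h \<oplus>\<^sub>t g \<bullet> h)"
| comp_plus_right: "well_typed (f \<bullet> (g \<oplus>\<^sub>t h)) \<Longrightarrow> rb_eq t (f \<bullet> (g \<oplus>\<^sub>t h)) (f \<bullet> g \<oplus>\<^sub>t f \<bullet> h)"
| comp_scale_left: "well_typed (f \<bullet> g) \<Longrightarrow> rb_eq t ((a \<odot>\<^sub>t f) \<bullet> g) (a \<odot>\<^sub>t (f \<bullet> g))"
| comp_scale_right: "well_typed (f \<bullet> g) \<Longrightarrow> rb_eq t (f \<bullet> (a \<odot>\<^sub>t g)) (a \<odot>\<^sub>t (f \<bullet> g))"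
| tens_plus_left: "well_typed ((f \<oplus>\<^sub>t g) \<otimes>\<^sub>t h) \<Longrightarrow>
    rb_eq t ((f \<oplus>\<^sub>t g) \<otimes>\<^sub>t h) (f \<otimes>\<^sub>t h \<oplus>\<^sub>t g \<otimes>\<^sub>t h)"
| tens_plus_right: "well_typed (f \<otimes>\<^sub>t (g \<oplus>\<^sub>t h)) \<Longrightarrow>
    rb_eq t (f \<otimes>\<^sub>t (g \<oplus>\<^sub>t h)) (f \<otimes>\<^sub>t g \<oplus>\<^sub>t f \<otimes>\<^sub>t h)"
| tens_scale_left: "well_typed (f \<otimes>\<^sub>t g) \<Longrightarrow> rb_eq t ((a \<odot>\<^sub>t f) \<otimes>\<^sub>t g) (a \<odot>\<^sub>t (f \<otimes>\<^sub>t g))"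
| tens_scale_right: "well_typed (f \<otimes>\<^sub>t g) \<Longrightarrow> rb_eq t (f \<otimes>\<^sub>t (a \<odot>\<^sub>t g)) (a \<odot>\<^sub>t (f \<otimes>\<^sub>t g))"
| tens_assoc: "well_typed ((f \<otimes>\<^sub>t g) \<otimes>\<^sub>t h) \<Longrightarrow> rb_eq t ((f \<otimes>\<^sub>t g) \<otimes>\<^sub>t h) (f \<otimes>\<^sub>t (g \<otimes>\<^sub>t h))"
| tens_unit_left: "well_typed f \<Longrightarrow> rb_eq t (Id 0 \<otimes>\<^sub>t f) f"
| tens_unit_right: "well_typed f \<Longrightarrow> rb_eq t (f \<otimes>\<^sub>t Id 0) f"
| tens_id: "rb_eq t (Id k \<otimes>\<^sub>t Id l) (Id (k + l))"
| interchange: "well_typed ((f \<bullet> g) \<otimes>\<^sub>t (f' \<bullet> g')) \<Longrightarrow>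
    rb_eq t ((f \<bullet> g) \<otimes>\<^sub>t (f' \<bullet> g')) ((f \<otimes>\<^sub>t f') \<bullet> (g \<otimes>\<^sub>t g'))"
| swap_swap: "rb_eq t (Swap \<bullet> Swap) (Id 2)"
| braid: "rb_eq t ((Swap \<otimes>\<^sub>t Id 1) \<bullet> (Id 1 \<otimes>\<^sub>t Swap) \<bullet> (Swap \<otimes>\<^sub>t Id 1))
                  ((Id 1 \<otimes>\<^sub>t Swap) \<bullet> (Swap \<otimes>\<^sub>t Id 1) \<bullet> (Id 1 \<otimes>\<^sub>t Swap))"
| zigzag: "rb_eq t ((Cap \<otimes>\<^sub>t Id 1) \<bullet> (Id 1 \<otimes>\<^sub>t Cup)) (Id 1)"
| zigzag': "rb_eq t ((Id 1 \<otimes>\<^sub>t Cap) \<bullet> (Cup \<otimes>\<^sub>t Id 1)) (Id 1)"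
| cap_slide: "rb_eq t ((Id 1 \<otimes>\<^sub>t Cap) \<bullet> (Swap \<otimes>\<^sub>t Id 1)) ((Cap \<otimes>\<^sub>t Id 1) \<bullet> (Id 1 \<otimes>\<^sub>t Swap))"
| cup_slide: "rb_eq t ((Swap \<otimes>\<^sub>t Id 1) \<bullet> (Id 1 \<otimes>\<^sub>t Cup)) ((Id 1 \<otimes>\<^sub>t Swap) \<bullet> (Cup \<otimes>\<^sub>t Id 1))"
| cap_swap: "rb_eq t (Cap \<bullet> Swap) Cap"
| swap_cup: "rb_eq t (Swap \<bullet> Cup) Cup"
| swap_eta_left: "rb_eq t (Swap \<bullet> (Eta \<otimes>\<^sub>t Id 1)) (Id 1 \<otimes>\<^sub>t Eta)"
| swap_eta_right: "rb_eq t (Swap \<bullet> (Id 1 \<otimes>\<^sub>t Eta)) (Eta \<otimes>\<^sub>t Id 1)"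
| eps_left_swap: "rb_eq t ((Eps \<otimes>\<^sub>t Id 1) \<bullet> Swap) (Id 1 \<otimes>\<^sub>t Eps)"
| eps_right_swap: "rb_eq t ((Id 1 \<otimes>\<^sub>t Eps) \<bullet> Swap) (Eps \<otimes>\<^sub>t Id 1)"
| cap_cup: "rb_eq t (Cap \<bullet> Cup) (t \<odot>\<^sub>t Id 0)"
| cap_eta_eta: "rb_eq t (Cap \<bullet> (Eta \<otimes>\<^sub>t Eta)) (t \<odot>\<^sub>t Id 0)"
| eps_eps_cup: "rb_eq t ((Eps \<otimes>\<^sub>t Eps) \<bullet> Cup) (t \<odot>\<^sub>t Id 0)"
| eps_eta: "rb_eq t (Eps \<bullet> Eta) (t \<odot>\<^sub>t Id 0)"
| cap_eta: "rb_eq t (Cap \<bullet> (Eta \<otimes>\<^sub>t Id 1)) Eps"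

definition rb_class :: "'a::{comm_ring,comm_monoid_mult} \<Rightarrow> 'a rb_term \<Rightarrow> 'a rb_term set" where
  "rb_class t f = {g. rb_eq t f g}"

text \<open>The multiplicative fields that HOL-Algebra's \<open>module\<close> records inherit from \<open>ring\<close> play no role
  for modules.\<close>

definition rb_Hom ::
    "'a::{comm_ring,comm_monoid_mult} \<Rightarrow> nat \<Rightarrow> nat \<Rightarrow> ('a, 'a rb_term set) module" where
  "rb_Hom t k l =
    \<lparr> carrier = rb_class t ` rb_terms k l,
      monoid.mult = undefined,
      one = undefined,
      ring.zero = rb_class t (Zero k l),
      add = (\<lambda>X Y. {h. \<exists>f\<in>X. \<exists>g\<in>Y. rb_eq t (f \<oplus>\<^sub>t g) h}),
      smult = (\<lambda>a X. {h. \<exists>f\<in>X. rb_eq t (a \<odot>\<^sub>t f) h}) \<rparr>"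

section \<open>Diagrams as morphisms\<close>

text \<open>The functor \<open>H\<close> from the rook-Brauer category to the partition category, on representatives.\<close>

primrec par_functor :: "'a::{comm_ring,comm_monoid_mult} \<Rightarrow> 'a rb_term \<Rightarrow> 'a par_morphism" where
  "par_functor t (Id k) = Poly_Mapping.single ((\<lambda>i. {Bot i, Top i}) ` {1..k}) 1"
| "par_functor t Swap = Poly_Mapping.single {{Bot 1, Top 2}, {Bot 2, Top 1}} 1"
| "par_functor t Cap = Poly_Mapping.single {{Bot 1, Bot 2}} 1"
| "par_functor t Cup = Poly_Mapping.single {{Top 1, Top 2}} 1"
| "par_functor t Eta = Poly_Mapping.single {{Top 1}} 1"
| "par_functor t Eps = Poly_Mapping.single {{Bot 1}} 1"
| "par_functor t (f \<bullet> g) = par_comp t (par_functor t f) (par_functor t g)"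
| "par_functor t (f \<otimes>\<^sub>t g) = par_tensor (src f) (tgt f) (par_functor t f) (par_functor t g)"
| "par_functor t (Zero k l) = 0"
| "par_functor t (f \<oplus>\<^sub>t g) = par_functor t f + par_functor t g"
| "par_functor t (a \<odot>\<^sub>t f) = Poly_Mapping.map (\<lambda>x. a * x) (par_functor t f)"

text \<open>Expressions built from generators and identities by composition and tensor product alone.\<close>

primrec monomial :: "'a rb_term \<Rightarrow> bool" where
  "monomial (Id k) = True"
| "monomial Swap = True"
| "monomial Cap = True"
| "monomial Cup = True"
| "monomial Eta = True"
| "monomial Eps = True"
| "monomial (f \<bullet> g) = (monomial f \<and> monomial g)"
| "monomial (f \<otimes>\<^sub>t g) = (monomial f \<and> monomial g)"
| "monomial (Zero k l) = False"
| "monomial (f \<oplus>\<^sub>t g) = False"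
| "monomial (a \<odot>\<^sub>t f) = False"

text \<open>\<open>X\<close> is a morphism \<open>k \<rightarrow> l\<close> as which the diagram \<open>D\<close> may be regarded.\<close>

definition diagram_morphism ::
    "'a::{comm_ring,comm_monoid_mult} \<Rightarrow> nat \<Rightarrow> nat \<Rightarrow> diagram \<Rightarrow> 'a rb_term set \<Rightarrow> bool" where
  "diagram_morphism t k l D X \<longleftrightarrow>
     (\<exists>w\<in>rb_terms k l. monomial w \<and> par_functor t w = Poly_Mapping.single D 1 \<and> X = rb_class t w)"

section \<open>Bases of modules\<close>

definition scalars :: "'a::{comm_ring,comm_monoid_mult} ring" where
  "scalars = \<lparr> carrier = UNIV, monoid.mult = (*), one = 1, ring.zero = 0, add = (+) \<rparr>"

definition finite_basis ::
    "('r, 'x) ring_scheme \<Rightarrow> ('r, 'm, 'y) module_scheme \<Rightarrow> 'i set \<Rightarrow> ('i \<Rightarrow> 'm) \<Rightarrow> bool" where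
  "finite_basis R M I b \<longleftrightarrow>
     module R M \<and> finite I \<and> b \<in> I \<rightarrow> carrier M \<and>
     (\<forall>x\<in>carrier M. \<exists>c\<in>I \<rightarrow> carrier R. x = (\<Oplus>\<^bsub>M\<^esub>i\<in>I. c i \<odot>\<^bsub>M\<^esub> b i)) \<and>
     (\<forall>c\<in>I \<rightarrow> carrier R. (\<Oplus>\<^bsub>M\<^esub>i\<in>I. c i \<odot>\<^bsub>M\<^esub> b i) = \<zero>\<^bsub>M\<^esub> \<longrightarrow> (\<forall>i\<in>I. c i = \<zero>\<^bsub>R\<^esub>))"

end

theory Submission
  imports Defs
begin

text \<open>
  Bending with nested cups and caps turns morphisms \<open>k \<rightarrow> l\<close> into states, that is, morphisms
  \<open>0 \<rightarrow> k + l\<close>. Every monomial state is a power of \<open>t\<close> times one built from cups, \<open>\<eta>\<close>'s and crossings.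
  Pulling an arbitrary strand of the latter to the far left exhibits it either as \<open>\<eta>\<close> beside a
  smaller state or as a cup beside a smaller state whose right leg has been pushed to the right;
  this property survives a crossing, which can be moved past the pull. Repeating this for the
  leftmost strand yields a normal form, and normal forms correspond bijectively to rook-Brauer
  diagrams, which are linearly independent in the partition category.

  The functor to the partition category is well defined because a diagram \<open>D\<close> has a 0-1 matrix,
  whose entry at two rows of bits says whether they are constant on the blocks of \<open>D\<close>. Products of
  such matrices are \<open>2\<^sup>a\<close> times the matrix of the composite diagram, where \<open>a\<close> is the number of
  inner components, and \<open>a\<close> and the diagram can be recovered from the product. So the identities
  between diagrams and between exponents of \<open>t\<close> are identities between matrices.
\<close>

section \<open>The calculus of slices\<close>

text \<open>A crossing at the far left exchanges the two leftmost strands, so a claim about the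
  leftmost strand alone does not survive an induction over crossings; hence the claim about an
  arbitrary pulled strand. States have no inputs: in normal form each strand comes from a cup or an
  \<eta>, so a cap or \<epsilon> applied to it always finds something to cancel against, and only
  powers of \<open>t\<close> are left over. Rebracketing tensor products and composites would
  obscure every step. It is hidden by letting terms act on sets of terms at a position counted from
  the left: idle strands on the right become invisible, and relations become equations between
  operators. For the functor, associativity and interchange would require comparing the connected
  components of several stacked diagrams. Two labels already separate the blocks of a diagram, and
  each inner component then contributes a factor 2. Exponents can be recovered from powers of 2 in
  the natural numbers, whereas powers of \<open>t\<close> in the ring may coincide.\<close>

lemma rb_eq_typed:
  "rb_eq t f g \<Longrightarrow> well_typed f \<and> well_typed g \<and> src f = src g \<and> tgt f = tgt g"
  by (induction rule: rb_eq.induct) auto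

declare rb_eq.trans [trans]

lemma rb_eq_sliding_left:
  assumes "well_typed f" "well_typed g"
  shows "rb_eq t ((f \<otimes>\<^sub>t Id (tgt g)) \<bullet> (Id (src f) \<otimes>\<^sub>t g)) (f \<otimes>\<^sub>t g)"
proof -
  have "rb_eq t ((f \<otimes>\<^sub>t Id (tgt g)) \<bullet> (Id (src f) \<otimes>\<^sub>t g)) ((f \<bullet> Id (src f)) \<otimes>\<^sub>t (Id (tgt g) \<bullet> g))"
    by (rule rb_eq.sym, rule rb_eq.interchange) (use assms in auto)
  also have "rb_eq t \<dots> (f \<otimes>\<^sub>t g)"
    by (intro rb_eq.tens_cong rb_eq.comp_id_left rb_eq.comp_id_right assms)
  finally show ?thesis .
qed

lemma rb_eq_sliding_right:
  assumes "well_typed f" "well_typed g"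
  shows "rb_eq t ((Id (tgt f) \<otimes>\<^sub>t g) \<bullet> (f \<otimes>\<^sub>t Id (src g))) (f \<otimes>\<^sub>t g)"
proof -
  have "rb_eq t ((Id (tgt f) \<otimes>\<^sub>t g) \<bullet> (f \<otimes>\<^sub>t Id (src g))) ((Id (tgt f) \<bullet> f) \<otimes>\<^sub>t (g \<bullet> Id (src g)))"
    by (rule rb_eq.sym, rule rb_eq.interchange) (use assms in auto)
  also have "rb_eq t \<dots> (f \<otimes>\<^sub>t g)"
    by (intro rb_eq.tens_cong rb_eq.comp_id_left rb_eq.comp_id_right assms)
  finally show ?thesis .
qed

definition slice :: "nat \<Rightarrow> 'a rb_term \<Rightarrow> nat \<Rightarrow> 'a rb_term" where
  "slice a f b = Id a \<otimes>\<^sub>t f \<otimes>\<^sub>t Id b"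

lemma slice_simps [simp]:
  "src (slice a f b) = a + (src f + b)"
  "tgt (slice a f b) = a + (tgt f + b)"
  "well_typed (slice a f b) \<longleftrightarrow> well_typed f"
  "monomial (slice a f b) \<longleftrightarrow> monomial f"
  by (auto simp: slice_def)

lemma slice_cong: "rb_eq t f g \<Longrightarrow> rb_eq t (slice a f b) (slice a g b)"
  by (auto simp: slice_def intro!: rb_eq.tens_cong rb_eq.refl)

lemma slice_comp:
  assumes "well_typed (f \<bullet> g)"
  shows "rb_eq t (slice a (f \<bullet> g) b) (slice a f b \<bullet> slice a g b)"
proof -
  have id: "rb_eq t (Id n) (Id n \<bullet> Id n)" for n
    by (rule rb_eq.sym) (use rb_eq.comp_id_left[of "Id n"] in simp)
  have "rb_eq t (slice a (f \<bullet> g) b) (Id a \<otimes>\<^sub>t (f \<bullet> g) \<otimes>\<^sub>t (Id b \<bullet> Id b))"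
    unfolding slice_def by (intro rb_eq.tens_cong id rb_eq.refl assms) simp
  also have "rb_eq t \<dots> ((Id a \<bullet> Id a) \<otimes>\<^sub>t ((f \<otimes>\<^sub>t Id b) \<bullet> (g \<otimes>\<^sub>t Id b)))"
    by (intro rb_eq.tens_cong id rb_eq.interchange) (use assms in auto)
  also have "rb_eq t \<dots> (slice a f b \<bullet> slice a g b)"
    unfolding slice_def by (intro rb_eq.interchange) (use assms in auto)
  finally show ?thesis .
qed

lemma slice_assoc_left: "well_typed f \<Longrightarrow> rb_eq t (slice a f b) ((Id a \<otimes>\<^sub>t f) \<otimes>\<^sub>t Id b)"
  unfolding slice_def by (rule rb_eq.sym, rule rb_eq.tens_assoc) auto

lemma slice_Id_left:
  assumes "well_typed g"
  shows "rb_eq t (slice (a + c) g b) (Id a \<otimes>\<^sub>t (Id c \<otimes>\<^sub>t g) \<otimes>\<^sub>t Id b)"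
proof -
  have "rb_eq t (slice (a + c) g b) ((Id a \<otimes>\<^sub>t Id c) \<otimes>\<^sub>t (g \<otimes>\<^sub>t Id b))"
    unfolding slice_def
    by (intro rb_eq.tens_cong rb_eq.refl rb_eq.sym[OF rb_eq.tens_id]) (use assms in auto)
  also have "rb_eq t \<dots> (Id a \<otimes>\<^sub>t (Id c \<otimes>\<^sub>t (g \<otimes>\<^sub>t Id b)))"
    by (rule rb_eq.tens_assoc) (use assms in auto)
  also have "rb_eq t \<dots> (Id a \<otimes>\<^sub>t ((Id c \<otimes>\<^sub>t g) \<otimes>\<^sub>t Id b))"
    by (intro rb_eq.tens_cong rb_eq.refl rb_eq.sym[OF rb_eq.tens_assoc]) (use assms in auto)
  finally show ?thesis .
qed

text \<open>Together with \<open>slice_tens_right\<close> this factors a tensor product in both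
  orders; comparing the two orders is how distant generators come to commute.\<close>

lemma slice_tens_left:
  assumes "well_typed f" "well_typed g"
  shows "rb_eq t (slice a f (tgt g + b) \<bullet> slice (a + src f) g b) (slice a (f \<otimes>\<^sub>t g) b)"
proof -
  have 1: "rb_eq t (slice a f (tgt g + b)) ((Id a \<otimes>\<^sub>t f) \<otimes>\<^sub>t Id (tgt (g \<otimes>\<^sub>t Id b)))"
    using slice_assoc_left[of f t a "tgt g + b"] assms by simp
  have 2: "rb_eq t (slice (a + src f) g b) (Id (src (Id a \<otimes>\<^sub>t f)) \<otimes>\<^sub>t (g \<otimes>\<^sub>t Id b))"
    by (auto simp: slice_def assms intro: rb_eq.refl)
  have "rb_eq t (slice a f (tgt g + b) \<bullet> slice (a + src f) g b) ((Id a \<otimes>\<^sub>t f) \<otimes>\<^sub>t (g \<otimes>\<^sub>t Id b))"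
    by (rule rb_eq.trans[OF rb_eq.comp_cong[OF 1 2] rb_eq_sliding_left]) (use assms in auto)
  also have "rb_eq t \<dots> (Id a \<otimes>\<^sub>t (f \<otimes>\<^sub>t (g \<otimes>\<^sub>t Id b)))"
    by (rule rb_eq.tens_assoc) (use assms in auto)
  also have "rb_eq t \<dots> (slice a (f \<otimes>\<^sub>t g) b)"
    unfolding slice_def
    by (intro rb_eq.tens_cong rb_eq.refl rb_eq.sym[OF rb_eq.tens_assoc]) (use assms in auto)
  finally show ?thesis .
qed

lemma slice_tens_right:
  assumes "well_typed f" "well_typed g"
  shows "rb_eq t (slice (a + tgt f) g b \<bullet> slice a f (src g + b)) (slice a (f \<otimes>\<^sub>t g) b)"
proof -
  have 1: "rb_eq t (slice a f (src g + b)) ((Id a \<otimes>\<^sub>t f) \<otimes>\<^sub>t Id (src (g \<otimes>\<^sub>t Id b)))"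
    using slice_assoc_left[of f t a "src g + b"] assms by simp
  have 2: "rb_eq t (slice (a + tgt f) g b) (Id (tgt (Id a \<otimes>\<^sub>t f)) \<otimes>\<^sub>t (g \<otimes>\<^sub>t Id b))"
    by (auto simp: slice_def assms intro: rb_eq.refl)
  have "rb_eq t (slice (a + tgt f) g b \<bullet> slice a f (src g + b)) ((Id a \<otimes>\<^sub>t f) \<otimes>\<^sub>t (g \<otimes>\<^sub>t Id b))"
    by (rule rb_eq.trans[OF rb_eq.comp_cong[OF 2 1] rb_eq_sliding_right]) (use assms in auto)
  also have "rb_eq t \<dots> (Id a \<otimes>\<^sub>t (f \<otimes>\<^sub>t (g \<otimes>\<^sub>t Id b)))"
    by (rule rb_eq.tens_assoc) (use assms in auto)
  also have "rb_eq t \<dots> (slice a (f \<otimes>\<^sub>t g) b)"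
    unfolding slice_def
    by (intro rb_eq.tens_cong rb_eq.refl rb_eq.sym[OF rb_eq.tens_assoc]) (use assms in auto)
  finally show ?thesis .
qed

lemma slice_Id: "rb_eq t (slice a (Id n) b) (Id (a + (n + b)))"
proof -
  have "rb_eq t (slice a (Id n) b) (Id a \<otimes>\<^sub>t Id (n + b))"
    unfolding slice_def by (intro rb_eq.tens_cong rb_eq.refl rb_eq.tens_id) simp
  also have "rb_eq t \<dots> (Id (a + (n + b)))"
    by (rule rb_eq.tens_id)
  finally show ?thesis .
qed

lemma rb_eq_scale_Id: "rb_eq t (slice a (c \<odot>\<^sub>t f) b) (c \<odot>\<^sub>t slice a f b)" if "well_typed f"
proof -
  have "rb_eq t (slice a (c \<odot>\<^sub>t f) b) (Id a \<otimes>\<^sub>t (c \<odot>\<^sub>t (f \<otimes>\<^sub>t Id b)))"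
    unfolding slice_def
    by (intro rb_eq.tens_cong rb_eq.refl rb_eq.tens_scale_left) (use that in auto)
  also have "rb_eq t \<dots> (c \<odot>\<^sub>t slice a f b)"
    unfolding slice_def by (rule rb_eq.tens_scale_right) (use that in auto)
  finally show ?thesis .
qed

section \<open>Generators acting at a position\<close>

text \<open>The width \<open>b\<close> on the right is existentially quantified because the target
  of \<open>w\<close> determines it; operators are thus indexed by the left position alone.
  \<open>X\<close> may be any set of terms, so many identities hold without typing assumptions on
  it. If no member of \<open>X\<close> is wide enough, the result is empty.\<close>

definition act ::
    "'a::{comm_ring,comm_monoid_mult} \<Rightarrow> nat \<Rightarrow> 'a rb_term \<Rightarrow> 'a rb_term set \<Rightarrow> 'a rb_term set" where
  "act t a f X =
     {h. \<exists>w b. w \<in> X \<and> tgt w = a + (src f + b) \<and> rb_eq t (slice a f b \<bullet> w) h}"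

text \<open>This is the scalar multiplication of \<open>rb_Hom\<close>, available before the module
  structure.\<close>

definition class_scale ::
    "'a::{comm_ring,comm_monoid_mult} \<Rightarrow> 'a \<Rightarrow> 'a rb_term set \<Rightarrow> 'a rb_term set" where
  "class_scale t c X = {h. \<exists>w\<in>X. rb_eq t (c \<odot>\<^sub>t w) h}"

lemma act_mono: "rb_eq t f g \<Longrightarrow> act t a f X \<subseteq> act t a g X"
proof
  fix h assume fg: "rb_eq t f g" and "h \<in> act t a f X"
  then obtain w b where w: "w \<in> X" "tgt w = a + (src f + b)" "rb_eq t (slice a f b \<bullet> w) h"
    by (auto simp: act_def)
  have "rb_eq t (slice a g b \<bullet> w) (slice a f b \<bullet> w)"
    by (intro rb_eq.comp_cong slice_cong rb_eq.sym[OF fg] rb_eq.refl)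
      (use rb_eq_typed[OF w(3)] rb_eq_typed[OF fg] in auto)
  with w show "h \<in> act t a g X"
    using rb_eq_typed[OF fg] by (auto simp: act_def intro!: exI[of _ w] exI[of _ b] intro: rb_eq.trans)
qed

lemma act_cong: "rb_eq t f g \<Longrightarrow> act t a f X = act t a g X"
  by (meson act_mono rb_eq.sym subset_antisym)

text \<open>Reassociation merges two successive operators into one composite of slices, so that
  equations between such composites become equations between operators.\<close>

lemma act_act:
  assumes "well_typed g"
  shows "act t a f (act t b g X) =
    {h. \<exists>w c d. w \<in> X \<and> tgt w = b + (src g + c) \<and> b + (tgt g + c) = a + (src f + d) \<and>
      rb_eq t ((slice a f d \<bullet> slice b g c) \<bullet> w) h}" (is "?L = ?R")
proof (intro subset_antisym subsetI)
  fix h assume "h \<in> ?L"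
  then obtain w' d where w': "w' \<in> act t b g X" "tgt w' = a + (src f + d)" "rb_eq t (slice a f d \<bullet> w') h"
    by (auto simp: act_def)
  then obtain w c where w: "w \<in> X" "tgt w = b + (src g + c)" "rb_eq t (slice b g c \<bullet> w) w'"
    by (auto simp: act_def)
  note ty = rb_eq_typed[OF w'(3)] rb_eq_typed[OF w(3)]
  have "rb_eq t ((slice a f d \<bullet> slice b g c) \<bullet> w) (slice a f d \<bullet> (slice b g c \<bullet> w))"
    by (rule rb_eq.comp_assoc) (use w' w ty in auto)
  also have "rb_eq t \<dots> (slice a f d \<bullet> w')"
    by (intro rb_eq.comp_cong rb_eq.refl w) (use w' ty in auto)
  also note w'(3)
  finally show "h \<in> ?R"
    using w w' ty by auto
next
  fix h assume "h \<in> ?R"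
  then obtain w c d where w: "w \<in> X" "tgt w = b + (src g + c)" "b + (tgt g + c) = a + (src f + d)"
      "rb_eq t ((slice a f d \<bullet> slice b g c) \<bullet> w) h"
    by auto
  note ty = rb_eq_typed[OF w(4)]
  have "slice b g c \<bullet> w \<in> act t b g X"
    using w ty by (auto simp: act_def intro!: exI[of _ w] exI[of _ c] rb_eq.refl)
  moreover have "rb_eq t (slice a f d \<bullet> (slice b g c \<bullet> w)) h"
    by (rule rb_eq.trans[OF rb_eq.sym[OF rb_eq.comp_assoc] w(4)]) (use ty in auto)
  ultimately show "h \<in> ?L"
    using w unfolding act_def[of t a] by force
qed

lemma rb_eq_comp_left:
  "rb_eq t f g \<Longrightarrow> rb_eq t (f \<bullet> w) h \<longleftrightarrow> rb_eq t (g \<bullet> w) h"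
proof -
  have "rb_eq t (g \<bullet> w) h" if "rb_eq t f g" "rb_eq t (f \<bullet> w) h" for f g
    by (rule rb_eq.trans[OF rb_eq.comp_cong[OF rb_eq.sym[OF that(1)] rb_eq.refl] that(2)])
      (use rb_eq_typed[OF that(1)] rb_eq_typed[OF that(2)] in auto)
  then show "rb_eq t f g \<Longrightarrow> rb_eq t (f \<bullet> w) h \<longleftrightarrow> rb_eq t (g \<bullet> w) h"
    using rb_eq.sym by blast
qed

lemma act_comp:
  assumes "well_typed (f \<bullet> g)"
  shows "act t a (f \<bullet> g) X = act t a f (act t a g X)"
proof -
  from assms have 1: "well_typed f" "well_typed g" "src f = tgt g" by auto
  show ?thesis
    unfolding act_act[OF 1(2)] unfolding act_def
    using rb_eq_comp_left[OF slice_comp[OF assms, of t a]] 1(3) by auto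
qed

text \<open>Here \<open>g\<close> acts first, behind the \<open>src f\<close> inputs of
  \<open>f\<close>; in \<open>act_tens'\<close> it acts second, behind the \<open>tgt f\<close>
  outputs.\<close>

lemma act_tens:
  assumes "well_typed f" "well_typed g"
  shows "act t a (f \<otimes>\<^sub>t g) X = act t a f (act t (a + src f) g X)"
proof -
  have *: "(tgt w = a + src f + (src g + c) \<and> a + src f + (tgt g + c) = a + (src f + d) \<and>
        rb_eq t ((slice a f d \<bullet> slice (a + src f) g c) \<bullet> w) h) \<longleftrightarrow>
      tgt w = a + src f + (src g + c) \<and> d = tgt g + c \<and> rb_eq t (slice a (f \<otimes>\<^sub>t g) c \<bullet> w) h" for w c d h
    using rb_eq_comp_left[OF slice_tens_left[OF assms, of t a c]] by auto
  show ?thesis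
    unfolding act_act[OF assms(2)] * unfolding act_def by (auto simp: ac_simps)
qed

lemma act_tens':
  assumes "well_typed f" "well_typed g"
  shows "act t a (f \<otimes>\<^sub>t g) X = act t (a + tgt f) g (act t a f X)"
proof -
  have *: "(tgt w = a + (src f + c) \<and> a + (tgt f + c) = a + tgt f + (src g + d) \<and>
        rb_eq t ((slice (a + tgt f) g d \<bullet> slice a f c) \<bullet> w) h) \<longleftrightarrow>
      tgt w = a + (src f + c) \<and> c = src g + d \<and> rb_eq t (slice a (f \<otimes>\<^sub>t g) d \<bullet> w) h" for w c d h
    using rb_eq_comp_left[OF slice_tens_right[OF assms, of t a d]] by auto
  show ?thesis
    unfolding act_act[OF assms(1)] * unfolding act_def by (auto simp: ac_simps)
qed

lemma act_Id_tens: "well_typed g \<Longrightarrow> act t (a + c) g X = act t a (Id c \<otimes>\<^sub>t g) X"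
  unfolding act_def slice_def[of a] 
  using rb_eq_comp_left[OF slice_Id_left[of g t a c]] by (auto simp: ac_simps)

text \<open>The two splittings of \<open>f \<otimes>\<^sub>t Id c \<otimes>\<^sub>t g\<close>. All
  commutations of distant generators below are instances.\<close>

lemma act_commute:
  assumes "well_typed f" "well_typed g"
  shows "act t a f (act t (a + src f + c) g X) = act t (a + tgt f + c) g (act t a f X)"
  using act_tens[of f "Id c \<otimes>\<^sub>t g" t a X] act_tens'[of f "Id c \<otimes>\<^sub>t g" t a X] assms
  by (simp add: act_Id_tens)

text \<open>The source \<open>k\<close> stays general although normal forms concern
  \<open>k = 0\<close>: for bending, the same operators act on the identity of \<open>k\<close>, and
  later these sets are the carriers of the modules.\<close>

definition states :: "'a::{comm_ring,comm_monoid_mult} \<Rightarrow> nat \<Rightarrow> nat \<Rightarrow> 'a rb_term set set" where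
  "states t k n = rb_class t ` rb_terms k n"

text \<open>Ill-typed terms all have the empty class, which is why \<open>f\<close> is assumed well
  typed.\<close>

lemma rb_class_eq_iff:
  assumes "well_typed f"
  shows "rb_class t f = rb_class t g \<longleftrightarrow> rb_eq t f g"
  using assms unfolding rb_class_def set_eq_iff mem_Collect_eq
  by (meson rb_eq.refl rb_eq.sym rb_eq.trans)

lemma act_class:
  assumes "well_typed f" "well_typed w" "tgt w = a + (src f + b)"
  shows "act t a f (rb_class t w) = rb_class t (slice a f b \<bullet> w)"
proof -
  have cong: "rb_eq t (slice a f b \<bullet> w) (slice a f b \<bullet> w')" if "rb_eq t w w'" for w'
    by (intro rb_eq.comp_cong rb_eq.refl) (use that assms in auto)
  show ?thesis
  proof (intro subset_antisym subsetI)
    fix h assume "h \<in> act t a f (rb_class t w)"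
    then obtain w' b' where w': "rb_eq t w w'" "tgt w' = a + (src f + b')" "rb_eq t (slice a f b' \<bullet> w') h"
      by (auto simp: act_def rb_class_def)
    then have "b' = b" using rb_eq_typed[OF w'(1)] assms by simp
    then show "h \<in> rb_class t (slice a f b \<bullet> w)"
      using rb_eq.trans[OF cong[OF w'(1)]] w' by (simp add: rb_class_def)
  next
    fix h assume "h \<in> rb_class t (slice a f b \<bullet> w)"
    then show "h \<in> act t a f (rb_class t w)"
      using assms rb_eq.refl[of w t] by (auto simp: act_def rb_class_def)
  qed
qed

lemma act_states:
  assumes "X \<in> states t k n" "well_typed f" "a + src f \<le> n"
  shows "act t a f X \<in> states t k (n - src f + tgt f)"
proof -
  from assms obtain w where w: "X = rb_class t w" "well_typed w" "src w = k" "tgt w = n"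
    by (auto simp: states_def rb_terms_def)
  obtain b where b: "n = a + (src f + b)" using assms(3) by (metis le_Suc_ex add.assoc)
  have "act t a f X = rb_class t (slice a f b \<bullet> w)"
    unfolding w by (rule act_class) (use w b assms in auto)
  then show ?thesis
    using w b assms by (auto simp: states_def rb_terms_def intro!: image_eqI[of _ _ "slice a f b \<bullet> w"])
qed

lemma act_Id:
  assumes "X \<in> states t k n" "a + m \<le> n"
  shows "act t a (Id m) X = X"
proof -
  from assms obtain w where w: "X = rb_class t w" "well_typed w" "src w = k" "tgt w = n"
    by (auto simp: states_def rb_terms_def)
  obtain b where b: "n = a + (m + b)" using assms(2) by (metis le_Suc_ex add.assoc)
  have "act t a (Id m) X = rb_class t (slice a (Id m) b \<bullet> w)"
    unfolding w by (rule act_class) (use w b assms in auto)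
  also have "rb_eq t (slice a (Id m) b \<bullet> w) (Id (tgt w) \<bullet> w)"
    by (intro rb_eq.comp_cong) (use slice_Id[of t a m b] w b in \<open>auto intro: rb_eq.refl\<close>)
  then have "rb_eq t (slice a (Id m) b \<bullet> w) w"
    using rb_eq.comp_id_left[OF w(2)] rb_eq.trans by blast
  then have "rb_class t (slice a (Id m) b \<bullet> w) = X"
    using w rb_class_eq_iff rb_eq_typed by blast
  finally show ?thesis .
qed

lemma class_scale_class:
  assumes "well_typed w"
  shows "class_scale t c (rb_class t w) = rb_class t (c \<odot>\<^sub>t w)"
proof -
  have "rb_eq t (c \<odot>\<^sub>t w) h" if "rb_eq t w w'" "rb_eq t (c \<odot>\<^sub>t w') h" for w' h
    using rb_eq.trans[OF rb_eq.scale_cong[OF that(1)] that(2)] .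
  then show ?thesis
    using rb_eq.refl[OF assms, of t] by (auto simp: class_scale_def rb_class_def)
qed

lemma statesE:
  assumes "X \<in> states t k n"
  obtains w where "X = rb_class t w" "well_typed w" "src w = k" "tgt w = n"
  using assms by (auto simp: states_def rb_terms_def)

lemma class_scale_states: "X \<in> states t k n \<Longrightarrow> class_scale t c X \<in> states t k n"
  by (auto simp: states_def rb_terms_def class_scale_class intro!: imageI)

lemma class_scale_scale:
  assumes "X \<in> states t k n"
  shows "class_scale t c (class_scale t d X) = class_scale t (c * d) X"
  using assms
  by (rule statesE) (simp add: class_scale_class rb_class_eq_iff rb_eq.sym[OF rb_eq.scale_scale])

lemma class_scale_one:
  assumes "X \<in> states t k n"
  shows "class_scale t 1 X = X"
  using assms
  by (rule statesE) (simp add: class_scale_class rb_class_eq_iff rb_eq.scale_one)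

lemma act_class_scale:
  assumes "X \<in> states t k n" "well_typed f" "a + src f \<le> n"
  shows "act t a f (class_scale t c X) = class_scale t c (act t a f X)"
proof -
  from assms obtain w where w: "X = rb_class t w" "well_typed w" "src w = k" "tgt w = n"
    by (auto simp: states_def rb_terms_def)
  obtain b where b: "n = a + (src f + b)" using assms(3) by (metis le_Suc_ex add.assoc)
  show ?thesis
    using w b assms
    by (auto simp: class_scale_class act_class[where b = b] rb_class_eq_iff intro!: rb_eq.comp_scale_right)
qed

lemma act_scale_term:
  assumes "X \<in> states t k n" "well_typed f" "a + src f \<le> n"
  shows "act t a (c \<odot>\<^sub>t f) X = class_scale t c (act t a f X)"
proof -
  from assms obtain w where w: "X = rb_class t w" "well_typed w" "src w = k" "tgt w = n"
    by (auto simp: states_def rb_terms_def)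
  obtain b where b: "n = a + (src f + b)" using assms(3) by (metis le_Suc_ex add.assoc)
  have "rb_eq t (slice a (c \<odot>\<^sub>t f) b \<bullet> w) ((c \<odot>\<^sub>t slice a f b) \<bullet> w)"
    by (intro rb_eq.comp_cong rb_eq_scale_Id rb_eq.refl) (use w b assms in auto)
  also have "rb_eq t \<dots> (c \<odot>\<^sub>t (slice a f b \<bullet> w))"
    by (rule rb_eq.comp_scale_left) (use w b assms in auto)
  finally show ?thesis
    using w b assms
    by (auto simp: class_scale_class act_class[where b = b] rb_class_eq_iff)
qed

section \<open>Relations between the operators\<close>

abbreviation swap_at where "swap_at t i \<equiv> act t i Swap"
abbreviation eta_at where "eta_at t i \<equiv> act t i Eta"
abbreviation cup_at where "cup_at t i \<equiv> act t i Cup"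
abbreviation eps_at where "eps_at t i \<equiv> act t i Eps"
abbreviation cap_at where "cap_at t i \<equiv> act t i Cap"

lemma swap_at_states [intro]: "X \<in> states t k n \<Longrightarrow> i + 2 \<le> n \<Longrightarrow> swap_at t i X \<in> states t k n"
  using act_states[of X t k n Swap i] by (simp del: add_2_eq_Suc')

lemma eta_at_states [intro]: "X \<in> states t k n \<Longrightarrow> i \<le> n \<Longrightarrow> eta_at t i X \<in> states t k (Suc n)"
  using act_states[of X t k n Eta i] by simp

lemma cup_at_states [intro]: "X \<in> states t k n \<Longrightarrow> i \<le> n \<Longrightarrow> cup_at t i X \<in> states t k (Suc (Suc n))"
  using act_states[of X t k n Cup i] by simp

text \<open>Operators count positions from the left only, so padding on the right does not show; the
  bound says that the padding strands exist.\<close>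

lemma act_pad:
  assumes "X \<in> states t k n" "well_typed f" "a + src f + m \<le> n"
  shows "act t a (f \<otimes>\<^sub>t Id m) X = act t a f X"
  using assms by (simp add: act_tens act_Id[OF assms(1)])

lemma act_pad_left: "well_typed g \<Longrightarrow> act t a (Id c \<otimes>\<^sub>t g) X = act t (a + c) g X"
  by (simp add: act_Id_tens)

lemma swap_at_swap_at:
  assumes "X \<in> states t k n" "i + 2 \<le> n"
  shows "swap_at t i (swap_at t i X) = X"
  using act_cong[OF rb_eq.swap_swap, of t i X] by (simp add: act_comp act_Id[OF assms])

lemma swap_at_braid:
  assumes "X \<in> states t k n" "i + 3 \<le> n"
  shows "swap_at t i (swap_at t (Suc i) (swap_at t i X)) =
    swap_at t (Suc i) (swap_at t i (swap_at t (Suc i) X))"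
proof -
  have *: "act t i (Swap \<otimes>\<^sub>t Id (Suc 0)) Y = swap_at t i Y" if "Y \<in> states t k n" for Y
    by (rule act_pad[OF that]) (use assms in auto)
  have "swap_at t i X \<in> states t k n" "swap_at t (Suc i) X \<in> states t k n"
    "swap_at t (Suc i) (swap_at t i X) \<in> states t k n"
    using assms by (auto intro!: swap_at_states)
  with act_cong[OF rb_eq.braid, of t i X] assms(1) show ?thesis
    by (simp add: act_comp act_pad_left *)
qed

lemma cap_at_cup_at_Suc:
  assumes "X \<in> states t k n" "i + 1 \<le> n"
  shows "cap_at t i (cup_at t (Suc i) X) = X"
proof -
  have "cup_at t (Suc i) X \<in> states t k (Suc (Suc n))" using assms by auto
  from act_pad[OF this, of Cap i 1] act_cong[OF rb_eq.zigzag, of t i X] assms show ?thesis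
    by (simp add: act_comp act_pad_left act_Id[OF assms] flip: One_nat_def) (simp add: act_Id[OF assms(1)])
qed

lemma cap_at_swap_at_Suc:
  assumes "X \<in> states t k n" "i + 3 \<le> n"
  shows "cap_at t i (swap_at t (Suc i) X) = cap_at t (Suc i) (swap_at t i X)"
proof -
  have "swap_at t (Suc i) X \<in> states t k n" using assms by auto
  from act_pad[OF this, of Cap i 1] act_cong[OF rb_eq.cap_slide, of t i X]
    act_pad[OF assms(1), of Swap i 1] assms show ?thesis
    by (simp add: act_comp act_pad_left)
qed

lemma swap_at_cup_at_Suc:
  assumes "X \<in> states t k n" "i + 1 \<le> n"
  shows "swap_at t i (cup_at t (Suc i) X) = swap_at t (Suc i) (cup_at t i X)"
proof -
  have "cup_at t (Suc i) X \<in> states t k (Suc (Suc n))" using assms by auto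
  from act_pad[OF this, of Swap i 1] act_cong[OF rb_eq.cup_slide, of t i X]
    act_pad[OF assms(1), of Cup i 1] assms show ?thesis
    by (simp add: act_comp act_pad_left)
qed

lemma cap_at_swap_at: "cap_at t i (swap_at t i X) = cap_at t i X"
  using act_cong[OF rb_eq.cap_swap, of t i X] by (simp add: act_comp)

lemma swap_at_cup_at: "swap_at t i (cup_at t i X) = cup_at t i X"
  using act_cong[OF rb_eq.swap_cup, of t i X] by (simp add: act_comp)

lemma swap_at_eta_at:
  assumes "X \<in> states t k n" "i + 1 \<le> n"
  shows "swap_at t i (eta_at t i X) = eta_at t (Suc i) X"
  using act_cong[OF rb_eq.swap_eta_left, of t i X] act_pad[OF assms(1), of Eta i 1] assms
  by (simp add: act_comp act_pad_left)

lemma eps_at_swap_at: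
  assumes "X \<in> states t k n" "i + 2 \<le> n"
  shows "eps_at t i (swap_at t i X) = eps_at t (Suc i) X"
proof -
  have "swap_at t i X \<in> states t k n" using assms by auto
  from act_pad[OF this, of Eps i 1] act_cong[OF rb_eq.eps_left_swap, of t i X] assms
  show ?thesis
    by (simp add: act_comp act_pad_left)
qed

lemma cap_at_cup_at:
  assumes "X \<in> states t k n" "i \<le> n"
  shows "cap_at t i (cup_at t i X) = class_scale t t X"
  using act_cong[OF rb_eq.cap_cup, of t i X] assms
  by (simp add: act_comp act_scale_term[OF assms(1)] act_Id[OF assms(1)])

lemma eps_at_eta_at:
  assumes "X \<in> states t k n" "i \<le> n"
  shows "eps_at t i (eta_at t i X) = class_scale t t X"
  using act_cong[OF rb_eq.eps_eta, of t i X] assms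
  by (simp add: act_comp act_scale_term[OF assms(1)] act_Id[OF assms(1)])

text \<open>The relation \<open>cap_eta\<close> enters the normal form argument only here. It says
  what happens when a cap meets a free end and, through \<open>eps_at_cup_at\<close>, when
  \<epsilon> meets a cup.\<close>

lemma cap_at_eta_at:
  assumes "X \<in> states t k n" "i + 1 \<le> n"
  shows "cap_at t i (eta_at t i X) = eps_at t i X"
  using act_cong[OF rb_eq.cap_eta, of t i X] act_pad[OF assms(1), of Eta i 1] assms
  by (simp add: act_comp)

section \<open>Commutation of distant generators\<close>

lemma swap_at_commute: "swap_at t i (swap_at t (i + 2 + j) X) = swap_at t (i + 2 + j) (swap_at t i X)"
  using act_commute[of Swap Swap t i j X] by (simp add: ac_simps)

lemma swap_at_commute':
  "i + 2 \<le> j \<Longrightarrow> swap_at t i (swap_at t j X) = swap_at t j (swap_at t i X)"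
  using swap_at_commute[of t i "j - (i + 2)" X] le_add_diff_inverse[of "i + 2" j] by metis

lemma swap_at_Suc_eta_at_0: "swap_at t (Suc i) (eta_at t 0 X) = eta_at t 0 (swap_at t i X)"
  using act_commute[of Eta Swap t 0 i X] by simp

lemma swap_at_cup_at_0: "swap_at t (Suc (Suc i)) (cup_at t 0 X) = cup_at t 0 (swap_at t i X)"
  using act_commute[of Cup Swap t 0 i X] by simp

lemma eps_at_swap_at_Suc: "eps_at t 0 (swap_at t (Suc i) X) = swap_at t i (eps_at t 0 X)"
  using act_commute[of Eps Swap t 0 i X] by simp

lemma cap_at_swap_at_Suc_Suc: "cap_at t 0 (swap_at t (Suc (Suc i)) X) = swap_at t i (cap_at t 0 X)"
  using act_commute[of Cap Swap t 0 i X] by simp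

lemma eta_at_eta_at: "eta_at t 0 (eta_at t i X) = eta_at t (Suc i) (eta_at t 0 X)"
  using act_commute[of Eta Eta t 0 i X] by simp

lemma eta_at_cup_at: "eta_at t 0 (cup_at t i X) = cup_at t (Suc i) (eta_at t 0 X)"
  using act_commute[of Eta Cup t 0 i X] by simp

lemma cup_at_eta_at: "cup_at t 0 (eta_at t i X) = eta_at t (Suc (Suc i)) (cup_at t 0 X)"
  using act_commute[of Cup Eta t 0 i X] by simp

lemma cup_at_cup_at: "cup_at t 0 (cup_at t i X) = cup_at t (Suc (Suc i)) (cup_at t 0 X)"
  using act_commute[of Cup Cup t 0 i X] by simp

text \<open>Sliding the left free end through the crossing puts it to the right of the other one,
  which gives the same state.\<close>

lemma swap_at_eta_at_eta_at:
  assumes "X \<in> states t k n"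
  shows "swap_at t 0 (eta_at t 0 (eta_at t 0 X)) = eta_at t 0 (eta_at t 0 X)"
proof -
  have "eta_at t 0 X \<in> states t k (Suc n)" using assms by auto
  from swap_at_eta_at[OF this, of 0] show ?thesis by (simp add: eta_at_eta_at)
qed

text \<open>Both sides are a cup with a free end between its legs,
  \<open>eta_at t 1 (cup_at t 0 X)\<close>.\<close>

lemma swap_at_eta_at_cup_at:
  assumes "X \<in> states t k n"
  shows "swap_at t 0 (eta_at t 0 (cup_at t 0 X)) = swap_at t 1 (cup_at t 0 (eta_at t 0 X))"
proof -
  have st: "cup_at t 0 X \<in> states t k (Suc (Suc n))" "eta_at t (Suc 0) (cup_at t 0 X) \<in> states t k (Suc (Suc (Suc n)))"
    using assms by auto
  have "swap_at t 1 (cup_at t 0 (eta_at t 0 X)) = swap_at t 1 (eta_at t 2 (cup_at t 0 X))"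
    by (simp add: cup_at_eta_at numeral_2_eq_2)
  also have "eta_at t 2 (cup_at t 0 X) = swap_at t 1 (eta_at t 1 (cup_at t 0 X))"
    using swap_at_eta_at[OF st(1), of 1] by (simp add: numeral_2_eq_2)
  also have "swap_at t 1 \<dots> = eta_at t 1 (cup_at t 0 X)"
    using swap_at_swap_at[OF st(2), of 1] by simp
  finally show ?thesis using swap_at_eta_at[OF st(1), of 0] by simp
qed

text \<open>A strand passes across both legs of a cup: \<open>swap_at_cup_at_Suc\<close> multiplied
  by a crossing, which is its own inverse.\<close>

lemma swap_at_swap_at_cup_at:
  assumes "X \<in> states t k n" "i + 1 \<le> n"
  shows "swap_at t i (swap_at t (Suc i) (cup_at t i X)) = cup_at t (Suc i) X"
    "swap_at t (Suc i) (swap_at t i (cup_at t (Suc i) X)) = cup_at t i X"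
proof -
  have "cup_at t (Suc i) X \<in> states t k (Suc (Suc n))" "cup_at t i X \<in> states t k (Suc (Suc n))"
    using assms by auto
  with swap_at_swap_at[of _ t k "Suc (Suc n)"] swap_at_cup_at_Suc[OF assms] assms
  show "swap_at t i (swap_at t (Suc i) (cup_at t i X)) = cup_at t (Suc i) X"
    "swap_at t (Suc i) (swap_at t i (cup_at t (Suc i) X)) = cup_at t i X"
    by (metis Suc_eq_plus1 add_2_eq_Suc' add_Suc not_less_eq_eq le_SucI)+
qed

text \<open>Both sides are the nested cups, obtained by sliding one of the two cups through the other.\<close>

lemma swap_at_swap_at_cup_at_cup_at:
  assumes "X \<in> states t k n"
  shows "swap_at t 0 (swap_at t 1 (cup_at t 0 (cup_at t 0 X))) =
    swap_at t 2 (swap_at t 1 (cup_at t 0 (cup_at t 0 X)))"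
proof -
  have st: "cup_at t 0 X \<in> states t k (Suc (Suc n))" using assms by auto
  have "swap_at t 2 (swap_at t 1 (cup_at t 0 (cup_at t 0 X))) =
      swap_at t (Suc 1) (swap_at t 1 (cup_at t (Suc 1) (cup_at t 0 X)))"
    by (simp add: cup_at_cup_at numeral_2_eq_2)
  also have "\<dots> = cup_at t 1 (cup_at t 0 X)"
    by (rule swap_at_swap_at_cup_at(2)[OF st]) simp
  finally show ?thesis
    using swap_at_swap_at_cup_at(1)[OF st, of 0] by simp
qed

text \<open>Writing \<epsilon> as a cap on an \<eta> produces a zigzag, which straightens.\<close>

lemma eps_at_cup_at:
  assumes "X \<in> states t k n"
  shows "eps_at t 0 (cup_at t 0 X) = eta_at t 0 X"
proof -
  have st: "cup_at t 0 X \<in> states t k (Suc (Suc n))" "eta_at t 0 X \<in> states t k (Suc n)" using assms by auto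
  have "eps_at t 0 (cup_at t 0 X) = cap_at t 0 (eta_at t 0 (cup_at t 0 X))"
    using cap_at_eta_at[OF st(1), of 0] by simp
  also have "\<dots> = cap_at t 0 (cup_at t 1 (eta_at t 0 X))"
    by (simp add: eta_at_cup_at)
  also have "\<dots> = eta_at t 0 X"
    using cap_at_cup_at_Suc[OF st(2), of 0] by simp
  finally show ?thesis .
qed

text \<open>A zigzag with a crossing in it: \<open>cup_slide\<close> moves the crossing under the
  cap, which absorbs it.\<close>

lemma cap_at_swap_at_cup_at:
  assumes "X \<in> states t k n" "1 \<le> n"
  shows "cap_at t 0 (swap_at t 1 (cup_at t 0 X)) = X"
  using swap_at_cup_at_Suc[OF assms(1), of 0] cap_at_swap_at[of t 0 "cup_at t 1 X"]
    cap_at_cup_at_Suc[OF assms(1), of 0] assms(2) by simp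

text \<open>This and the next three lemmas reduce generators at any position to position 0 at the
  price of crossings.\<close>

lemma eta_at_Suc:
  "X \<in> states t k n \<Longrightarrow> i + 1 \<le> n \<Longrightarrow> eta_at t (Suc i) X = swap_at t i (eta_at t i X)"
  by (simp add: swap_at_eta_at)

lemma cup_at_Suc:
  "X \<in> states t k n \<Longrightarrow> i + 1 \<le> n \<Longrightarrow>
    cup_at t (Suc i) X = swap_at t i (swap_at t (Suc i) (cup_at t i X))"
  by (simp add: swap_at_swap_at_cup_at)

lemma eps_at_Suc:
  "X \<in> states t k n \<Longrightarrow> i + 2 \<le> n \<Longrightarrow> eps_at t (Suc i) X = eps_at t i (swap_at t i X)"
  by (simp add: eps_at_swap_at)

lemma cap_at_Suc:
  assumes "X \<in> states t k n" "i + 3 \<le> n"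
  shows "cap_at t (Suc i) X = cap_at t i (swap_at t (Suc i) (swap_at t i X))"
proof -
  have "swap_at t i X \<in> states t k n" using assms by auto
  from cap_at_swap_at_Suc[OF this assms(2)] swap_at_swap_at[OF assms(1), of i] assms(2)
  show ?thesis by simp
qed

section \<open>Normal forms of states\<close>

text \<open>States that never close a strand. Inserting at position 0 only keeps inductions short;
  insertion elsewhere is recovered in \<open>eta_at_perfect_state\<close> and
  \<open>cup_at_perfect_state\<close>.\<close>

inductive perfect_state :: "'a::{comm_ring,comm_monoid_mult} \<Rightarrow> nat \<Rightarrow> 'a rb_term set \<Rightarrow> bool" for t where
  empty: "perfect_state t 0 (rb_class t (Id 0))"
| eta: "perfect_state t n X \<Longrightarrow> perfect_state t (Suc n) (eta_at t 0 X)"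
| cup: "perfect_state t n X \<Longrightarrow> perfect_state t (Suc (Suc n)) (cup_at t 0 X)"
| swap: "perfect_state t n X \<Longrightarrow> i + 2 \<le> n \<Longrightarrow> perfect_state t n (swap_at t i X)"

lemma perfect_state_states: "perfect_state t n X \<Longrightarrow> X \<in> states t 0 n"
proof (induction rule: perfect_state.induct)
  case empty
  show ?case by (auto simp: states_def rb_terms_def)
qed auto

text \<open>The cyclic permutation that brings the strand at position \<open>i\<close> to the far
  left and keeps the order of the others.\<close>

primrec pull :: "'a::{comm_ring,comm_monoid_mult} \<Rightarrow> nat \<Rightarrow> 'a rb_term set \<Rightarrow> 'a rb_term set" where
  "pull t 0 X = X"
| "pull t (Suc i) X = pull t i (swap_at t i X)"

text \<open>The strand at position \<open>b\<close> moves \<open>j\<close> places to the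
  right.\<close>

primrec push :: "'a::{comm_ring,comm_monoid_mult} \<Rightarrow> nat \<Rightarrow> nat \<Rightarrow> 'a rb_term set \<Rightarrow> 'a rb_term set" where
  "push t b 0 X = X"
| "push t b (Suc j) X = swap_at t (b + j) (push t b j X)"

section \<open>Commuting crossings and generators with \<open>push\<close> and
  \<open>pull\<close>\<close>

lemma push_states: "X \<in> states t k n \<Longrightarrow> b + j + 1 \<le> n \<Longrightarrow> push t b j X \<in> states t k n"
  by (induction j) auto

lemma perfect_state_push: "perfect_state t n X \<Longrightarrow> b + j + 1 \<le> n \<Longrightarrow> perfect_state t n (push t b j X)"
  by (induction j) (auto intro: perfect_state.swap)

lemma push_Suc_right: "push t b (Suc j) X = push t (Suc b) j (swap_at t b X)"
  by (induction j) auto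

lemma swap_at_push_low: "m + 2 \<le> b \<Longrightarrow> swap_at t m (push t b j X) = push t b j (swap_at t m X)"
proof (induction j)
  case (Suc j)
  then show ?case using swap_at_commute'[of m "b + j" t "push t b j X"] by simp
qed simp

lemma swap_at_push_high: "b + j + 1 \<le> m \<Longrightarrow> swap_at t m (push t b j X) = push t b j (swap_at t m X)"
proof (induction j)
  case (Suc j)
  then show ?case using swap_at_commute'[of "b + j" m t "push t b j X"] by simp
qed simp

text \<open>The strands that the push passes move one place to the left, so a crossing at
  \<open>m\<close> after the push is one at \<open>Suc m\<close> before it.\<close>

lemma swap_at_push_mid:
  assumes "X \<in> states t k n" "b \<le> m" "m + 1 < b + j" "b + j + 1 \<le> n"
  shows "swap_at t m (push t b j X) = push t b j (swap_at t (Suc m) X)"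
  using assms(3,4)
proof (induction j)
  case (Suc j)
  show ?case
  proof (cases "m + 1 = b + j")
    \<comment> \<open>The crossing meets the last two steps of the push, and the three form one side
      of a braid relation.\<close>
    case True
    obtain i where j: "j = Suc i" "m = b + i" using True assms(2) Suc.prems by (cases j) auto
    have st: "push t b i X \<in> states t k n" using assms Suc.prems j by (intro push_states) auto
    have "swap_at t m (push t b (Suc j) X) = swap_at t m (swap_at t (Suc m) (swap_at t m (push t b i X)))"
      using j by simp
    also have "\<dots> = swap_at t (Suc m) (swap_at t m (swap_at t (Suc m) (push t b i X)))"
      by (rule swap_at_braid[OF st]) (use j Suc.prems in auto)
    also have "swap_at t (Suc m) (push t b i X) = push t b i (swap_at t (Suc m) X)"
      by (rule swap_at_push_high) (use j in auto)
    finally show ?thesis using j by simp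
  next
    case False
    then show ?thesis using Suc swap_at_commute'[of m "b + j" t "push t b j X"] by simp
  qed
qed (use assms in simp)

lemma pull_swap_high: "i + 1 \<le> m \<Longrightarrow> pull t i (swap_at t m X) = swap_at t m (pull t i X)"
proof (induction i arbitrary: X)
  case (Suc i)
  then show ?case using swap_at_commute'[of i m t X] by simp
qed simp

text \<open>Strands to the left of the pulled one move one place to the right, hence
  \<open>Suc m\<close>. The braid relation is needed when the crossing meets the pulled strand's
  first two steps.\<close>

lemma pull_swap_low:
  assumes "X \<in> states t k n" "m + 1 < i" "i < n"
  shows "pull t i (swap_at t m X) = swap_at t (Suc m) (pull t i X)"
  using assms
proof (induction i arbitrary: X)
  case (Suc i)
  show ?case
  proof (cases "i = Suc m")
    case True
    have "pull t (Suc i) (swap_at t m X) = pull t m (swap_at t m (swap_at t (Suc m) (swap_at t m X)))"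
      using True by simp
    also have "\<dots> = pull t m (swap_at t (Suc m) (swap_at t m (swap_at t (Suc m) X)))"
      by (subst swap_at_braid[OF Suc.prems(1)]) (use Suc.prems in auto)
    also have "\<dots> = swap_at t (Suc m) (pull t m (swap_at t m (swap_at t (Suc m) X)))"
      by (rule pull_swap_high) auto
    finally show ?thesis using True by simp
  next
    case False
    then show ?thesis
      using Suc.IH[of "swap_at t i X"] Suc.prems swap_at_commute'[of m i t X]
        swap_at_states[of X t k n i] by simp
  qed
qed simp

text \<open>The strand is first pulled to the left end of \<open>X\<close>, right beside the new
  free end, and then crosses it.\<close>

lemma pull_eta: "pull t (Suc i) (eta_at t 0 X) = swap_at t 0 (eta_at t 0 (pull t i X))"
proof (induction i arbitrary: X)
  case (Suc i)
  then show ?case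
    using Suc[of "swap_at t i X"] by (simp add: swap_at_Suc_eta_at_0)
qed simp

text \<open>As for \<eta>, but the pulled strand finally crosses both legs of the cup.\<close>

lemma pull_cup:
  "pull t (Suc (Suc i)) (cup_at t 0 X) = swap_at t 0 (swap_at t 1 (cup_at t 0 (pull t i X)))"
proof (induction i arbitrary: X)
  case (Suc i)
  then show ?case
    using Suc[of "swap_at t i X"] by (simp add: swap_at_cup_at_0)
qed simp

lemma eta_at_push: "eta_at t 0 (push t b j X) = push t (Suc b) j (eta_at t 0 X)"
  by (induction j) (auto simp flip: swap_at_Suc_eta_at_0)

lemma cup_at_push: "cup_at t 0 (push t b j X) = push t (Suc (Suc b)) j (cup_at t 0 X)"
  by (induction j) (auto simp flip: swap_at_cup_at_0)

lemma eps_at_push: "eps_at t 0 (push t (Suc b) j X) = push t b j (eps_at t 0 X)"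
  by (induction j) (auto simp: eps_at_swap_at_Suc)

lemma cap_at_push: "cap_at t 0 (push t (Suc (Suc b)) j X) = push t b j (cap_at t 0 X)"
  by (induction j) (auto simp: cap_at_swap_at_Suc_Suc)

text \<open>The two possible fates of the leftmost strand. In the second, \<open>j\<close> is the
  number of positions between it and its partner, the datum later stored in a code.\<close>

inductive peeled :: "'a::{comm_ring,comm_monoid_mult} \<Rightarrow> nat \<Rightarrow> 'a rb_term set \<Rightarrow> bool" for t where
  eta: "perfect_state t n X \<Longrightarrow> peeled t (Suc n) (eta_at t 0 X)"
| cup: "perfect_state t n X \<Longrightarrow> j \<le> n \<Longrightarrow> peeled t (Suc (Suc n)) (push t (Suc 0) j (cup_at t 0 X))"

text \<open>A crossing that spares position 0 either falls into the smaller state or only moves the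
  right leg of the cup.\<close>

lemma peeled_swap_at:
  assumes "peeled t n X" "Suc m + 2 \<le> n"
  shows "peeled t n (swap_at t (Suc m) X)"
  using assms(1)
proof cases
  case (eta n' X')
  with assms(2) show ?thesis
    by (auto simp: swap_at_Suc_eta_at_0 intro!: peeled.eta perfect_state.swap)
next
  case (cup n' Y j)
  have st: "cup_at t 0 Y \<in> states t 0 n" using cup perfect_state_states by auto
  \<comment> \<open>The right leg is at position \<open>Suc j\<close>. The crossing lies to its
    right, moves it one step on, moves it one step back, or lies to its left.\<close>
  consider "m > j" | "m = j" | "m + 1 = j" | "m + 1 < j" by linarith
  then show ?thesis
  proof cases
    case 1
    then obtain m' where m': "m = Suc m'" by (cases m) auto
    have "swap_at t (Suc m) X = push t (Suc 0) j (cup_at t 0 (swap_at t m' Y))"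
      using 1 swap_at_push_high[of 1 j "Suc m" t "cup_at t 0 Y"] by (simp add: cup m' swap_at_cup_at_0)
    then show ?thesis using cup assms(2) m' by (auto intro!: peeled.cup perfect_state.swap)
  next
    case 2
    then have "swap_at t (Suc m) X = push t (Suc 0) (Suc j) (cup_at t 0 Y)" by (simp add: cup)
    then show ?thesis using cup assms(2) 2 by (auto intro!: peeled.cup simp del: push.simps)
  next
    case 3
    then have j: "j = Suc m" by simp
    have "push t (Suc 0) m (cup_at t 0 Y) \<in> states t 0 n" using cup j by (intro push_states[OF st]) auto
    from swap_at_swap_at[OF this assms(2)]
    have "swap_at t (Suc m) X = push t (Suc 0) m (cup_at t 0 Y)" by (simp add: cup j)
    then show ?thesis using cup j by (auto intro!: peeled.cup)
  next
    case 4
    have "swap_at t (Suc m) X = push t (Suc 0) j (cup_at t 0 (swap_at t m Y))"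
      using 4 swap_at_push_mid[OF st, of 1 "Suc m" j] cup by (simp add: swap_at_cup_at_0)
    then show ?thesis using cup 4 by (auto intro!: peeled.cup perfect_state.swap)
  qed
qed

lemma peeled_pull: "perfect_state t n X \<Longrightarrow> i < n \<Longrightarrow> peeled t n (pull t i X)"
proof (induction arbitrary: i rule: perfect_state.induct)
  case (eta n X)
  show ?case
  proof (cases i)
    case 0
    then show ?thesis using eta by (auto intro: peeled.eta)
  next
    case (Suc i')
    with eta have "peeled t n (pull t i' X)" by simp
    then show ?thesis
    proof cases
      case (eta n' Y)
      then have "pull t i (eta_at t 0 X) = eta_at t 0 (eta_at t 0 Y)"
        using swap_at_eta_at_eta_at[OF perfect_state_states[OF eta(3)]] by (simp only: Suc pull_eta)
      with eta show ?thesis by (auto intro: peeled.eta perfect_state.eta)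
    next
      case (cup n' Y j)
      \<comment> \<open>The pulled strand is a leg of a cup. The free end comes to lie between the
        two legs, so the other leg is pushed one place further.\<close>
      have "pull t i (eta_at t 0 X) = push t 2 j (swap_at t 0 (eta_at t 0 (cup_at t 0 Y)))"
        by (simp only: Suc pull_eta cup eta_at_push) (simp add: swap_at_push_low numeral_2_eq_2)
      also have "\<dots> = push t (Suc 0) (Suc j) (cup_at t 0 (eta_at t 0 Y))"
        unfolding push_Suc_right
        using swap_at_eta_at_cup_at[OF perfect_state_states[OF cup(3)]] by (simp add: numeral_2_eq_2)
      finally show ?thesis using cup by (auto intro!: peeled.cup perfect_state.eta simp del: push.simps)
    qed
  qed
next
  case (cup n X)
  consider "i = 0" | "i = 1" | i' where "i = Suc (Suc i')" by (metis One_nat_def not0_implies_Suc)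
  then show ?case
  proof cases
    case 1
    then show ?thesis using peeled.cup[OF cup(1), of 0] by simp
  next
    case 2
    then show ?thesis using peeled.cup[OF cup(1), of 0] by (simp add: swap_at_cup_at)
  next
    case (3 i')
    with cup have "peeled t n (pull t i' X)" by simp
    then show ?thesis
    proof cases
      case (eta n' Y)
      note st = perfect_state_states[OF eta(3)]
      have "eta_at t 0 (cup_at t 0 Y) \<in> states t 0 (Suc (Suc n))"
        using st eta by auto
      from swap_at_swap_at[OF this, of 0]
      have "pull t i (cup_at t 0 X) = eta_at t 0 (cup_at t 0 Y)"
        using swap_at_eta_at_cup_at[OF st] by (simp add: 3 pull_cup eta del: pull.simps)
      with eta show ?thesis by (auto intro: peeled.eta perfect_state.cup)
    next
      case (cup n' Y j)
      \<comment> \<open>Both strands belong to cups. The cup added last ends up between the legs of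
        the pulled one, and \<open>swap_at_swap_at_cup_at_cup_at\<close> turns the two crossings of
        \<open>pull_cup\<close> into the first two steps of a longer push.\<close>
      have "pull t i (cup_at t 0 X) =
          push t 3 j (swap_at t 0 (swap_at t 1 (cup_at t 0 (cup_at t 0 Y))))"
        by (simp only: 3 pull_cup cup cup_at_push) (simp add: swap_at_push_low numeral_3_eq_3)
      also have "\<dots> = push t (Suc 0) (Suc (Suc j)) (cup_at t 0 (cup_at t 0 Y))"
        unfolding push_Suc_right swap_at_swap_at_cup_at_cup_at[OF perfect_state_states[OF cup(3)]]
        by (simp add: numeral_2_eq_2 numeral_3_eq_3)
      finally show ?thesis using cup by (auto intro!: peeled.cup perfect_state.cup simp del: push.simps)
    qed
  qed
next
  case (swap n X m)
  note st = perfect_state_states[OF swap(1)]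
  \<comment> \<open>The crossing commutes with the pull (first and last case), lengthens it to
    \<open>Suc i\<close>, or cancels its first step. The middle cases need the induction hypothesis
    for a different strand.\<close>
  consider "i + 1 \<le> m" | "m = i" | "i = Suc m" | "m + 1 < i" by linarith
  then show ?case
  proof cases
    case 1
    then obtain m' where "m = Suc m'" by (cases m) auto
    with 1 swap show ?thesis by (auto simp: pull_swap_high intro!: peeled_swap_at)
  next
    case 2
    then show ?thesis using swap.IH[of "Suc i"] swap by simp
  next
    case 3
    then show ?thesis using swap.IH[of m] swap swap_at_swap_at[OF st, of m] by simp
  next
    case 4
    then show ?thesis
      using swap.IH[of i] swap pull_swap_low[OF st, of m i] by (auto intro!: peeled_swap_at)
  qed
qed simp

corollary perfect_state_peeled: "perfect_state t (Suc n) X \<Longrightarrow> peeled t (Suc n) X"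
  using peeled_pull[of t "Suc n" X 0] by simp

text \<open>Closing strands may split off closed components; each contributes a factor
  \<open>t\<close>, and no other scalars arise.\<close>

definition scaled_perfect_state :: "'a::{comm_ring,comm_monoid_mult} \<Rightarrow> nat \<Rightarrow> 'a rb_term set \<Rightarrow> bool" where
  "scaled_perfect_state t n X \<longleftrightarrow> (\<exists>e Y. perfect_state t n Y \<and> X = class_scale t (t ^ e) Y)"

lemma scaled_perfect_stateI: "perfect_state t n X \<Longrightarrow> scaled_perfect_state t n X"
  using class_scale_one[OF perfect_state_states, of t n X]
  by (auto simp: scaled_perfect_state_def intro!: exI[of _ 0])

lemma scaled_perfect_state_scale:
  assumes "scaled_perfect_state t n X"
  shows "scaled_perfect_state t n (class_scale t (t ^ e) X)"
  using assms class_scale_scale[OF perfect_state_states]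
  by (fastforce simp: scaled_perfect_state_def simp flip: power_add)

text \<open>After peeling, \<epsilon> either meets a free end, giving a factor \<open>t\<close>, or
  a cup, leaving a free end at the other leg.\<close>

lemma eps_at_perfect_state:
  assumes "perfect_state t (Suc n) X"
  shows "scaled_perfect_state t n (eps_at t 0 X)"
  using perfect_state_peeled[OF assms]
proof cases
  case (eta Y)
  then have "eps_at t 0 X = class_scale t (t ^ 1) Y"
    using eps_at_eta_at[OF perfect_state_states[OF \<open>perfect_state t n Y\<close>], of 0] by simp
  then show ?thesis using eta unfolding scaled_perfect_state_def by blast
next
  case (cup n' Y j)
  then have "eps_at t 0 X = push t 0 j (eta_at t 0 Y)"
    using eps_at_cup_at[OF perfect_state_states[OF cup(3)]] by (simp add: eps_at_push)
  then show ?thesis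
    using cup by (auto intro!: scaled_perfect_stateI perfect_state_push perfect_state.eta)
qed

text \<open>Peeling the strand at position 0 is enough. A free end turns the cap into \<epsilon>; a
  cup with adjacent legs closes to a loop; any other cup is straightened, leaving the rest of its
  push.\<close>

lemma cap_at_perfect_state:
  assumes "perfect_state t (Suc (Suc n)) X"
  shows "scaled_perfect_state t n (cap_at t 0 X)"
  using perfect_state_peeled[OF assms]
proof cases
  case (eta Y)
  then have "cap_at t 0 X = eps_at t 0 Y"
    using cap_at_eta_at[OF perfect_state_states[OF \<open>perfect_state t (Suc n) Y\<close>], of 0] by simp
  then show ?thesis using eta by (auto intro: eps_at_perfect_state)
next
  case (cup Y j)
  note st = perfect_state_states[OF \<open>perfect_state t n Y\<close>]
  show ?thesis
  proof (cases j)
    case 0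
    then have "cap_at t 0 X = class_scale t (t ^ 1) Y"
      using cap_at_cup_at[OF st, of 0] cup by simp
    then show ?thesis using cup unfolding scaled_perfect_state_def by blast
  next
    case (Suc i)
    have "cap_at t 0 X = push t 0 i (cap_at t 0 (swap_at t 1 (cup_at t 0 Y)))"
      unfolding cup Suc push_Suc_right by (simp add: cap_at_push)
    also have "\<dots> = push t 0 i Y"
      using cap_at_swap_at_cup_at[OF st] cup Suc by simp
    finally show ?thesis
      using cup Suc by (auto intro!: scaled_perfect_stateI perfect_state_push)
  qed
qed

section \<open>Arbitrary positions and arbitrary monomials\<close>

lemma eta_at_perfect_state:
  "perfect_state t n X \<Longrightarrow> a \<le> n \<Longrightarrow> perfect_state t (Suc n) (eta_at t a X)"
proof (induction a)
  case (Suc a)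
  then show ?case
    using eta_at_Suc[OF perfect_state_states[OF Suc.prems(1)], of a]
    by (auto intro: perfect_state.swap)
qed (auto intro: perfect_state.eta)

lemma cup_at_perfect_state:
  "perfect_state t n X \<Longrightarrow> a \<le> n \<Longrightarrow> perfect_state t (Suc (Suc n)) (cup_at t a X)"
proof (induction a)
  case (Suc a)
  then show ?case
    using cup_at_Suc[OF perfect_state_states[OF Suc.prems(1)], of a]
    by (auto intro!: perfect_state.swap)
qed (auto intro: perfect_state.cup)

lemma eps_at_perfect_state':
  "perfect_state t (Suc n) X \<Longrightarrow> a \<le> n \<Longrightarrow> scaled_perfect_state t n (eps_at t a X)"
proof (induction a arbitrary: X)
  case (Suc a)
  then show ?case
    using eps_at_Suc[OF perfect_state_states[OF Suc.prems(1)], of a]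
    by (auto intro!: perfect_state.swap Suc.IH)
qed (auto intro: eps_at_perfect_state)

lemma cap_at_perfect_state':
  "perfect_state t (Suc (Suc n)) X \<Longrightarrow> a \<le> n \<Longrightarrow> scaled_perfect_state t n (cap_at t a X)"
proof (induction a arbitrary: X)
  case (Suc a)
  then show ?case
    using cap_at_Suc[OF perfect_state_states[OF Suc.prems(1)], of a]
    by (auto intro!: perfect_state.swap Suc.IH)
qed (auto intro: cap_at_perfect_state)

lemma scaled_perfect_state_states: "scaled_perfect_state t n X \<Longrightarrow> X \<in> states t 0 n"
  using class_scale_states perfect_state_states unfolding scaled_perfect_state_def by blast

lemma act_scaled_perfect_stateI:
  assumes "scaled_perfect_state t n X" "well_typed f" "a + src f \<le> n"
    and "\<And>Y. perfect_state t n Y \<Longrightarrow> scaled_perfect_state t m (act t a f Y)"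
  shows "scaled_perfect_state t m (act t a f X)"
proof -
  obtain e Y where Y: "perfect_state t n Y" "X = class_scale t (t ^ e) Y"
    using assms(1) by (auto simp: scaled_perfect_state_def)
  then have "act t a f X = class_scale t (t ^ e) (act t a f Y)"
    using act_class_scale[OF perfect_state_states[OF Y(1)] assms(2,3)] by simp
  then show ?thesis using scaled_perfect_state_scale[OF assms(4)[OF Y(1)]] by simp
qed

text \<open>The widths \<open>a\<close> and \<open>b\<close> vary in the induction, because each
  tensor factor acts with the other one among its idle strands.\<close>

lemma act_scaled_perfect_state:
  assumes "monomial f" "well_typed f" "scaled_perfect_state t (a + (src f + b)) X"
  shows "scaled_perfect_state t (a + (tgt f + b)) (act t a f X)"
  using assms
proof (induction f arbitrary: a b X)
  case (Id k)
  then show ?case using act_Id[OF scaled_perfect_state_states[OF Id(3)], of a k] by simp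
next
  case Swap
  then show ?case
    by (rule_tac act_scaled_perfect_stateI[OF Swap(3)])
      (auto intro!: scaled_perfect_stateI perfect_state.swap)
next
  case Cap
  then show ?case
    by (rule_tac act_scaled_perfect_stateI[OF Cap(3)]) (auto intro!: cap_at_perfect_state')
next
  case Cup
  then show ?case
    using cup_at_perfect_state[of t "a + b" _ a]
    by (rule_tac act_scaled_perfect_stateI[OF Cup(3)]) (auto intro!: scaled_perfect_stateI)
next
  case Eta
  then show ?case
    using eta_at_perfect_state[of t "a + b" _ a]
    by (rule_tac act_scaled_perfect_stateI[OF Eta(3)]) (auto intro!: scaled_perfect_stateI)
next
  case Eps
  then show ?case
    by (rule_tac act_scaled_perfect_stateI[OF Eps(3)]) (auto intro!: eps_at_perfect_state')
next
  case (Comp f g)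
  then show ?case by (simp add: act_comp)
next
  case (Tens f g)
  have "scaled_perfect_state t (a + src f + (tgt g + b)) (act t (a + src f) g X)"
    by (rule Tens.IH) (use Tens.prems in \<open>auto simp: ac_simps\<close>)
  then have "scaled_perfect_state t (a + (tgt f + (tgt g + b))) (act t a f (act t (a + src f) g X))"
    by (intro Tens.IH) (use Tens.prems in \<open>auto simp: ac_simps\<close>)
  then show ?case using Tens.prems by (simp add: act_tens ac_simps)
qed auto

section \<open>Codes of normal forms\<close>

text \<open>The counterpart of \<open>act\<close> on terms, with the right width computed. If
  \<open>w\<close> is too narrow, the subtraction truncates and the composite is ill-typed.\<close>

definition act_term :: "nat \<Rightarrow> 'a rb_term \<Rightarrow> 'a rb_term \<Rightarrow> 'a rb_term" where
  "act_term a f w = slice a f (tgt w - (a + src f)) \<bullet> w"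

lemma act_term_typed:
  assumes "a + src f \<le> tgt w"
  shows "well_typed (act_term a f w) \<longleftrightarrow> well_typed f \<and> well_typed w"
    "src (act_term a f w) = src w"
    "tgt (act_term a f w) = tgt w - src f + tgt f"
    "monomial (act_term a f w) \<longleftrightarrow> monomial f \<and> monomial w"
  using assms by (auto simp: act_term_def)

lemma rb_class_act_term:
  assumes "a + src f \<le> tgt w" "well_typed f" "well_typed w"
  shows "rb_class t (act_term a f w) = act t a f (rb_class t w)"
  using assms by (simp add: act_term_def act_class[where b = "tgt w - (a + src f)"])

text \<open>Normal forms push only the right leg of a leftmost cup, so the start is fixed at
  position 1.\<close>

primrec push_term :: "nat \<Rightarrow> 'a rb_term \<Rightarrow> 'a rb_term" where
  "push_term 0 w = w"
| "push_term (Suc j) w = act_term (Suc j) Swap (push_term j w)"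

lemma push_term_typed:
  assumes "j + 2 \<le> tgt w" "well_typed w" "monomial w"
  shows "well_typed (push_term j w)" "src (push_term j w) = src w"
    "tgt (push_term j w) = tgt w" "monomial (push_term j w)"
proof -
  have "well_typed (push_term j w) \<and> src (push_term j w) = src w \<and>
    tgt (push_term j w) = tgt w \<and> monomial (push_term j w)"
    using assms by (induction j) (auto simp: act_term_typed)
  then show "well_typed (push_term j w)" "src (push_term j w) = src w"
    "tgt (push_term j w) = tgt w" "monomial (push_term j w)" by auto
qed

lemma rb_class_push_term:
  assumes "j + 2 \<le> tgt w" "well_typed w" "monomial w"
  shows "rb_class t (push_term j w) = push t (Suc 0) j (rb_class t w)"
  using assms by (induction j) (auto simp: rb_class_act_term push_term_typed)

text \<open>A code lists, from left to right, how the leftmost remaining position of a state is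
  treated: \<open>None\<close> leaves it isolated, \<open>Some j\<close> joins it to the position that has \<open>j\<close>
  remaining positions to its left.\<close>

type_synonym code = "nat option list"

fun code_size :: "code \<Rightarrow> nat" where
  "code_size [] = 0"
| "code_size (None # c) = Suc (code_size c)"
| "code_size (Some j # c) = Suc (Suc (code_size c))"

fun code_valid :: "code \<Rightarrow> bool" where
  "code_valid [] = True"
| "code_valid (None # c) = code_valid c"
| "code_valid (Some j # c) \<longleftrightarrow> j \<le> code_size c \<and> code_valid c"

fun normal_form :: "code \<Rightarrow> 'a rb_term" where
  "normal_form [] = Id 0"
| "normal_form (None # c) = act_term 0 Eta (normal_form c)"
| "normal_form (Some j # c) = push_term j (act_term 0 Cup (normal_form c))"

lemma normal_form_typed:
  assumes "code_valid c"
  shows "well_typed (normal_form c :: 'a rb_term)" "src (normal_form c :: 'a rb_term) = 0"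
    "tgt (normal_form c :: 'a rb_term) = code_size c" "monomial (normal_form c :: 'a rb_term)"
proof -
  have "well_typed (normal_form c :: 'a rb_term) \<and> src (normal_form c :: 'a rb_term) = 0 \<and>
    tgt (normal_form c :: 'a rb_term) = code_size c \<and> monomial (normal_form c :: 'a rb_term)"
    using assms by (induction c rule: normal_form.induct) (auto simp: act_term_typed push_term_typed)
  then show "well_typed (normal_form c :: 'a rb_term)" "src (normal_form c :: 'a rb_term) = 0"
    "tgt (normal_form c :: 'a rb_term) = code_size c" "monomial (normal_form c :: 'a rb_term)"
    by auto
qed

lemma perfect_state_normal_form:
  "perfect_state t n X \<Longrightarrow> \<exists>c. code_valid c \<and> code_size c = n \<and> X = rb_class t (normal_form c)"
proof (induction n arbitrary: X rule: less_induct)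
  case (less n)
  show ?case
  proof (cases n)
    case 0
    with less.prems have "X = rb_class t (Id 0)"
      by (cases rule: perfect_state.cases) auto
    with 0 show ?thesis by (intro exI[of _ "[]"]) simp
  next
    case (Suc n')
    then have "peeled t n X" using less.prems perfect_state_peeled by blast
    then show ?thesis
    proof cases
      case (eta m Y)
      with less.IH obtain c where c: "code_valid c" "code_size c = m" "Y = rb_class t (normal_form c)"
        by blast
      then have "X = rb_class t (normal_form (None # c))"
        by (simp add: eta rb_class_act_term normal_form_typed)
      then show ?thesis using c eta by (intro exI[of _ "None # c"]) simp
    next
      case (cup m Y j)
      with less.IH obtain c where c: "code_valid c" "code_size c = m" "Y = rb_class t (normal_form c)"
        by (metis Suc_lessD lessI)
      then have "X = rb_class t (normal_form (Some j # c))"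
        using cup
        by (simp add: rb_class_act_term rb_class_push_term normal_form_typed act_term_typed)
      then show ?thesis using c cup by (intro exI[of _ "Some j # c"]) simp
    qed
  qed
qed

section \<open>Bending morphisms into states\<close>

text \<open>\<open>cups\<close> is composed with the outermost cup first, \<open>caps\<close> with
  the innermost cap first; the last cup and the last cap can then form a zigzag.\<close>

primrec cups :: "nat \<Rightarrow> 'a rb_term" where
  "cups 0 = Id 0"
| "cups (Suc k) = slice k Cup k \<bullet> cups k"

primrec caps :: "nat \<Rightarrow> 'a rb_term" where
  "caps 0 = Id 0"
| "caps (Suc k) = Cap \<bullet> slice 1 (caps k) 1"

lemma cups_typed [simp]:
  "src (cups k :: 'a rb_term) = 0" "tgt (cups k :: 'a rb_term) = k + k" "well_typed (cups k :: 'a rb_term)" "monomial (cups k :: 'a rb_term)"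
proof -
  have "src (cups k :: 'a rb_term) = 0 \<and> tgt (cups k :: 'a rb_term) = k + k \<and>
      well_typed (cups k :: 'a rb_term) \<and> monomial (cups k :: 'a rb_term)"
    by (induction k) auto
  then show "src (cups k :: 'a rb_term) = 0" "tgt (cups k :: 'a rb_term) = k + k"
    "well_typed (cups k :: 'a rb_term)" "monomial (cups k :: 'a rb_term)" by auto
qed

lemma caps_typed [simp]:
  "src (caps k :: 'a rb_term) = k + k" "tgt (caps k :: 'a rb_term) = 0" "well_typed (caps k :: 'a rb_term)" "monomial (caps k :: 'a rb_term)"
proof -
  have "src (caps k :: 'a rb_term) = k + k \<and> tgt (caps k :: 'a rb_term) = 0 \<and>
      well_typed (caps k :: 'a rb_term) \<and> monomial (caps k :: 'a rb_term)"
    by (induction k) auto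
  then show "src (caps k :: 'a rb_term) = k + k" "tgt (caps k :: 'a rb_term) = 0"
    "well_typed (caps k :: 'a rb_term)" "monomial (caps k :: 'a rb_term)" by auto
qed

text \<open>The zigzag identity for \<open>k\<close> nested strands. The innermost cup slides past
  the inner caps, these cancel the remaining cups by induction, and one zigzag with the outermost
  cap is left.\<close>

lemma caps_cups:
  "X \<in> states t m n \<Longrightarrow> a + k \<le> n \<Longrightarrow> act t a (caps k) (act t (a + k) (cups k) X) = X"
proof (induction k arbitrary: a)
  case 0
  then show ?case by (simp add: act_Id)
next
  case (Suc k)
  define Z where "Z = act t (a + Suc k) (cups k) X"
  have Z: "Z \<in> states t m (n + (k + k))"
    using act_states[OF Suc.prems(1), of "cups k" "a + Suc k"] Suc.prems(2) by (simp add: Z_def)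
  define W where "W = cup_at t (a + Suc k + k) Z"
  have W: "W \<in> states t m (Suc (Suc (n + (k + k))))"
    unfolding W_def by (rule cup_at_states[OF Z]) (use Suc.prems in simp)
  have "act t (a + Suc k) (cups (Suc k)) X = W"
    using act_pad[OF Z, of Cup "a + Suc k + k" k] Suc.prems(2)
    by (simp add: act_comp Z_def W_def slice_def act_pad_left)
  moreover have "act t a (caps (Suc k)) W = cap_at t a (act t (Suc a) (caps k) W)"
    using act_pad[OF W, of "caps k" "Suc a" 1] Suc.prems(2)
    by (simp add: act_comp slice_def act_pad_left)
  moreover have "act t (Suc a) (caps k) W = cup_at t (Suc a) (act t (Suc a) (caps k) Z)"
    using act_commute[of "caps k" Cup t "Suc a" 0 Z] by (simp add: W_def ac_simps)
  moreover have "act t (Suc a) (caps k) Z = X"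
    using Suc.IH[of "Suc a"] Suc.prems by (simp add: Z_def)
  ultimately show ?case
    using cap_at_cup_at_Suc[OF Suc.prems(1), of a] Suc.prems(2) by simp
qed

text \<open>Turns equations between operators back into equations between morphisms.\<close>

lemma act_rb_class_Id:
  assumes "well_typed f"
  shows "act t 0 f (rb_class t (Id (src f))) = rb_class t f"
proof -
  have "rb_eq t (slice 0 f 0) (Id 0 \<otimes>\<^sub>t f)"
    unfolding slice_def using assms by (intro rb_eq.tens_cong rb_eq.refl rb_eq.tens_unit_right) auto
  also have "rb_eq t \<dots> f" using assms by (rule rb_eq.tens_unit_left)
  finally have "rb_eq t (slice 0 f 0 \<bullet> Id (src f)) (f \<bullet> Id (src f))"
    using assms by (intro rb_eq.comp_cong rb_eq.refl) auto
  also have "rb_eq t \<dots> f" using assms by (rule rb_eq.comp_id_right)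
  finally show ?thesis
    using assms by (simp add: act_class[where b = 0] rb_class_eq_iff)
qed

text \<open>Nested caps join the first \<open>k\<close> outputs of the state to \<open>k\<close>
  incoming strands. Nesting reverses their order, which is the origin of \<open>rev x\<close>
  below.\<close>

definition unbend :: "nat \<Rightarrow> 'a rb_term \<Rightarrow> 'a rb_term" where
  "unbend k w = act_term 0 (caps k) (act_term k w (Id k))"

lemma unbend_typed:
  assumes "well_typed w" "src w = 0" "tgt w = k + l" "monomial w"
  shows "well_typed (unbend k w)" "src (unbend k w) = k" "tgt (unbend k w) = l" "monomial (unbend k w)"
  using assms by (auto simp: unbend_def act_term_typed)

lemma monomial_rb_eq_normal_form:
  fixes t :: "'a::{comm_ring,comm_monoid_mult}"
  assumes "monomial f" "f \<in> rb_terms k l"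
  shows "\<exists>e c. code_valid c \<and> code_size c = k + l \<and>
    rb_eq t f (t ^ e \<odot>\<^sub>t unbend k (normal_form c))"
proof -
  have f: "well_typed f" "src f = k" "tgt f = l" using assms(2) by (auto simp: rb_terms_def)
  define I where "I = rb_class t (Id k)"
  have I: "I \<in> states t k k" by (auto simp: I_def states_def rb_terms_def)
  define Z where "Z = act t k (cups k) I"
  have Z: "Z \<in> states t k (k + (k + k))"
    using act_states[OF I, of "cups k" k] by (simp add: Z_def)
  \<comment> \<open>The bent morphism: \<open>f\<close> is fed with the right legs of the nested
    cups.\<close>
  define w where "w = slice k f 0 \<bullet> cups k"
  have w: "well_typed w" "src w = 0" "tgt w = k + l" "monomial w"
    using f assms(1) by (auto simp: w_def)
  have "rb_class t f = act t 0 f I" using act_rb_class_Id[OF f(1)] by (simp add: I_def f)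
  also have "\<dots> = act t 0 f (act t 0 (caps k) Z)"
    using caps_cups[OF I, of 0 k] by (simp add: Z_def)
  \<comment> \<open>Before the caps act, \<open>f\<close> stands behind the \<open>k + k\<close>
    strands that they close; afterwards nothing is left of it.\<close>
  also have "\<dots> = act t 0 (caps k) (act t (k + k) f Z)"
    using act_commute[of "caps k" f t 0 0 Z] f by simp
  also have "act t (k + k) f Z = act t k w I"
    using f act_pad[OF Z f(1), of "k + k" 0] by (simp add: w_def act_comp slice_def act_pad_left Z_def)
  finally have f_eq: "rb_class t f = act t 0 (caps k) (act t k w I)" .
  have "scaled_perfect_state t (0 + (tgt w + 0)) (act t 0 w (rb_class t (Id 0)))"
    by (rule act_scaled_perfect_state)
      (use w in \<open>auto intro: scaled_perfect_stateI perfect_state.empty\<close>)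
  then obtain e Y where Y: "perfect_state t (k + l) Y" "rb_class t w = class_scale t (t ^ e) Y"
    using act_rb_class_Id[OF w(1)] w by (auto simp: scaled_perfect_state_def)
  obtain c where c: "code_valid c" "code_size c = k + l" "Y = rb_class t (normal_form c)"
    using perfect_state_normal_form[OF Y(1)] by blast
  note nf = normal_form_typed[OF c(1), where 'a = 'a]
  have "rb_eq t w (t ^ e \<odot>\<^sub>t normal_form c)"
    using Y(2) nf w(1) by (simp add: c(3) class_scale_class rb_class_eq_iff)
  then have "act t k w I = act t k (t ^ e \<odot>\<^sub>t normal_form c) I" by (rule act_cong)
  also have "\<dots> = class_scale t (t ^ e) (act t k (normal_form c) I)"
    by (rule act_scale_term[OF I]) (use nf in auto)
  finally have "rb_class t f = act t 0 (caps k) (class_scale t (t ^ e) (act t k (normal_form c) I))"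
    using f_eq by simp
  also have "\<dots> = class_scale t (t ^ e) (act t 0 (caps k) (act t k (normal_form c) I))"
  proof (rule act_class_scale)
    show "act t k (normal_form c) I \<in> states t k (k + (k + l))"
      using act_states[OF I nf(1), of k] nf c(2) by simp
  qed auto
  also have "act t 0 (caps k) (act t k (normal_form c) I) = rb_class t (unbend k (normal_form c))"
    unfolding unbend_def using nf c(2)
    by (subst rb_class_act_term, simp_all add: act_term_typed)+ (simp add: I_def)
  also have "class_scale t (t ^ e) \<dots> = rb_class t (t ^ e \<odot>\<^sub>t unbend k (normal_form c))"
    by (rule class_scale_class) (use unbend_typed[OF nf(1,2) _ nf(4), of k l] nf c(2) in simp)
  finally have "rb_eq t f (t ^ e \<odot>\<^sub>t unbend k (normal_form c))"
    using f(1) by (simp add: rb_class_eq_iff)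
  then show ?thesis using c by blast
qed

section \<open>Diagrams as 0-1 matrices\<close>

definition vertices :: "nat \<Rightarrow> nat \<Rightarrow> vertex set" where
  "vertices k l = Bot ` {1..k} \<union> Top ` {1..l}"

text \<open>Vertices are numbered from 1 and list entries from 0, hence the shift.\<close>

primrec label :: "bool list \<Rightarrow> bool list \<Rightarrow> vertex \<Rightarrow> bool" where
  "label x y (Bot i) = x ! (i - 1)"
| "label x y (Top j) = y ! (j - 1)"

definition compatible :: "diagram \<Rightarrow> bool list \<Rightarrow> bool list \<Rightarrow> bool" where
  "compatible D x y \<longleftrightarrow> (\<forall>B\<in>D. \<forall>u\<in>B. \<forall>v\<in>B. label x y u = label x y v)"

text \<open>The standard action of the partition category with parameter 2 on tensor powers of a
  space with a two-element basis. Entries are natural numbers whatever the ring of scalars.\<close>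

definition diagram_matrix :: "diagram \<Rightarrow> bool list \<Rightarrow> bool list \<Rightarrow> nat" where
  "diagram_matrix D x y = of_bool (compatible D x y)"

lemma partition_on_unique_block:
  "partition_on A P \<Longrightarrow> B \<in> P \<Longrightarrow> C \<in> P \<Longrightarrow> u \<in> B \<Longrightarrow> u \<in> C \<Longrightarrow> B = C"
  by (metis disjointD disjoint_iff partition_onD2)

lemma partitions_iff: "D \<in> partitions k l \<longleftrightarrow> partition_on (vertices k l) D"
  by (simp add: partitions_def vertices_def)

lemma exists_label:
  fixes P :: "vertex \<Rightarrow> bool"
  obtains x y where "length x = k" "length y = l" "\<And>v. v \<in> vertices k l \<Longrightarrow> label x y v = P v"
proof
  let ?x = "map (\<lambda>i. P (Bot (Suc i))) [0..<k]" and ?y = "map (\<lambda>i. P (Top (Suc i))) [0..<l]"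
  show "length ?x = k" "length ?y = l" by auto
  show "label ?x ?y v = P v" if "v \<in> vertices k l" for v
    using that by (auto simp: vertices_def)
qed

text \<open>Two labels suffice: the indicator of \<open>B\<close> is constant on the blocks of
  \<open>D\<close>, hence on \<open>C\<close>.\<close>

lemma compatible_block_subset:
  assumes D: "D \<in> partitions k l" and E: "E \<in> partitions k l"
    and DE: "\<And>x y. length x = k \<Longrightarrow> length y = l \<Longrightarrow> compatible D x y \<Longrightarrow> compatible E x y"
    and "B \<in> D" "C \<in> E" "u \<in> B" "u \<in> C"
  shows "C \<subseteq> B"
proof
  fix v assume "v \<in> C"
  obtain x y where xy: "length x = k" "length y = l"
    and lab: "\<And>v. v \<in> vertices k l \<Longrightarrow> label x y v = (v \<in> B)"
    using exists_label[of k l "\<lambda>v. v \<in> B"] by metis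
  have sub: "B' \<subseteq> vertices k l" if "B' \<in> D \<or> B' \<in> E" for B'
    using that D E by (auto simp: partitions_iff partition_on_def)
  have "v' \<in> B \<longleftrightarrow> w \<in> B" if "B' \<in> D" "v' \<in> B'" "w \<in> B'" for B' v' w
    using partition_on_unique_block[OF D[unfolded partitions_iff] that(1) assms(4)] that by blast
  then have "compatible D x y"
    unfolding compatible_def using lab sub by blast
  then have "compatible E x y" using DE xy by blast
  then have "label x y u = label x y v"
    using assms(5,7) \<open>v \<in> C\<close> unfolding compatible_def by blast
  moreover have "C \<subseteq> vertices k l" by (rule sub) (rule disjI2[OF assms(5)])
  then have "u \<in> vertices k l" "v \<in> vertices k l"
    using assms(7) \<open>v \<in> C\<close> by (blast dest: subsetD)+
  ultimately show "v \<in> B" using lab[of u] lab[of v] assms(6) by simp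
qed

lemma partitions_eqI:
  assumes "D \<in> partitions k l" "E \<in> partitions k l"
    and "\<And>x y. length x = k \<Longrightarrow> length y = l \<Longrightarrow> compatible D x y \<longleftrightarrow> compatible E x y"
  shows "D = E"
proof -
  have sub: "D \<subseteq> E" if D: "D \<in> partitions k l" and E: "E \<in> partitions k l"
    and DE: "\<And>x y. length x = k \<Longrightarrow> length y = l \<Longrightarrow> compatible D x y \<longleftrightarrow> compatible E x y" for D E
  proof
    fix B assume "B \<in> D"
    obtain u where "u \<in> B" "u \<in> vertices k l"
      using D \<open>B \<in> D\<close> unfolding partitions_iff partition_on_def by (metis UnionI ex_in_conv)
    moreover obtain C where "C \<in> E" "u \<in> C"
      using \<open>u \<in> vertices k l\<close> E by (auto simp: partitions_iff partition_on_def)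
    ultimately have "C = B"
      using compatible_block_subset[OF D E, of B C u] compatible_block_subset[OF E D, of C B u]
        DE \<open>B \<in> D\<close> by blast
    with \<open>C \<in> E\<close> show "B \<in> E" by simp
  qed
  from sub[OF assms] sub[OF assms(2,1)] assms(3) show ?thesis by blast
qed

lemma compatible_const: "compatible D (replicate k False) (replicate l False)"
  if "D \<in> partitions k l"
proof -
  have "label (replicate k False) (replicate l False) v = False" if "v \<in> vertices k l" for v
    using that by (auto simp: vertices_def)
  moreover have "B \<subseteq> vertices k l" if "B \<in> D" for B
    using that \<open>D \<in> partitions k l\<close> by (auto simp: partitions_iff partition_on_def)
  ultimately show ?thesis unfolding compatible_def by blast
qed

text \<open>The constant labelling is compatible with every diagram, so its entry reads off the
  exponent; the remaining entries determine the blocks.\<close>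

lemma scaled_diagram_matrix_eqD:
  assumes D: "D \<in> partitions k l" and E: "E \<in> partitions k l"
    and eq: "\<And>x y. length x = k \<Longrightarrow> length y = l \<Longrightarrow>
      2 ^ a * diagram_matrix D x y = 2 ^ b * diagram_matrix E x y"
  shows "D = E" "a = b"
proof -
  show "a = b"
    using eq[of "replicate k False" "replicate l False"] compatible_const[OF D] compatible_const[OF E]
    by (simp add: diagram_matrix_def)
  with eq have "diagram_matrix D x y = diagram_matrix E x y"
    if "length x = k" "length y = l" for x y
    using that by simp
  then show "D = E"
    by (intro partitions_eqI[OF D E]) (metis diagram_matrix_def of_bool_eq_iff)
qed

subsection \<open>Composition\<close>

primrec stacked_label :: "bool list \<Rightarrow> bool list \<Rightarrow> bool list \<Rightarrow> stacked_vertex \<Rightarrow> bool" where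
  "stacked_label x z y (Low i) = x ! (i - 1)"
| "stacked_label x z y (Mid i) = z ! (i - 1)"
| "stacked_label x z y (High i) = y ! (i - 1)"

lemma stacked_label_in:
  "stacked_label x z y (in_upper v) = label z y v"
  "stacked_label x z y (in_lower v) = label x z v"
  "stacked_label x z y (in_outer v) = label x y v"
  by (cases v; simp)+

lemma range_in_outer: "range in_outer = - range Mid"
proof (intro Set.set_eqI iffI)
  fix v assume "v \<in> range in_outer"
  then obtain u where "v = in_outer u" by auto
  then show "v \<in> - range Mid" by (cases u) auto
next
  fix v assume "v \<in> - range Mid"
  then show "v \<in> range in_outer"
    by (cases v) (auto intro: range_eqI[of _ _ "Bot _"] range_eqI[of _ _ "Top _"])
qed

lemma finite_length_eq: "finite {z :: bool list. length z = n}"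
  using finite_lists_length_eq[of "UNIV :: bool set" n] by simp

context
  fixes k l m :: nat and D D' :: diagram
  assumes D: "D \<in> partitions k l" and D': "D' \<in> partitions m k"
begin

lemma Union_stack: "\<Union>(stack D D') = Low ` {1..m} \<union> Mid ` {1..k} \<union> High ` {1..l}"
proof -
  have "\<Union>D = vertices k l" "\<Union>D' = vertices m k"
    using D D' by (auto simp: partitions_iff partition_on_def)
  then have "\<Union>(stack D D') = in_upper ` vertices k l \<union> in_lower ` vertices m k"
    unfolding stack_def Union_Un_distrib image_Union[symmetric] by simp
  then show ?thesis by (auto simp: vertices_def image_Un image_image)
qed

lemma stack_equiv:
  "equiv (\<Union>(stack D D')) ({(x, y). \<exists>B\<in>stack D D'. x \<in> B \<and> y \<in> B}\<^sup>+)" (is "equiv ?V (?R\<^sup>+)")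
proof (rule equivI)
  have "?R \<subseteq> ?V \<times> ?V" by auto
  then show "?R\<^sup>+ \<subseteq> ?V \<times> ?V" by (rule trancl_subset_Sigma)
  show "refl_on ?V (?R\<^sup>+)" by (auto simp: refl_on_def)
  have "sym ?R" by (auto simp: sym_def)
  then show "sym (?R\<^sup>+)" by (rule sym_trancl)
  show "trans (?R\<^sup>+)" by (rule trans_trancl)
qed

lemma partition_on_stack_components:
  "partition_on (Low ` {1..m} \<union> Mid ` {1..k} \<union> High ` {1..l}) (stack_components D D')"
  unfolding stack_components_def Union_stack[symmetric]
  by (rule partition_on_quotient) (rule stack_equiv)

lemma diagram_star_partitions: "diagram_star D D' \<in> partitions m l"
proof -
  have "in_outer -` (Low ` {1..m} \<union> Mid ` {1..k} \<union> High ` {1..l}) = vertices m l"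
  proof (rule Set.set_eqI)
    fix v show "v \<in> in_outer -` (Low ` {1..m} \<union> Mid ` {1..k} \<union> High ` {1..l}) \<longleftrightarrow> v \<in> vertices m l"
      by (cases v) (auto simp: vertices_def)
  qed
  then show ?thesis
    using partition_on_vimage[OF partition_on_stack_components, of in_outer]
    by (simp add: partitions_iff diagram_star_def)
qed

text \<open>Equality of labels within blocks propagates along chains of blocks, which is what the
  transitive closure expresses.\<close>

lemma compatible_stack:
  "compatible D z y \<and> compatible D' x z \<longleftrightarrow>
    (\<forall>C\<in>stack_components D D'. \<forall>u\<in>C. \<forall>v\<in>C. stacked_label x z y u = stacked_label x z y v)"
    (is "?L \<longleftrightarrow> ?R")
proof -
  let ?rel = "{(x, y). \<exists>B\<in>stack D D'. x \<in> B \<and> y \<in> B}"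
  have "?L \<longleftrightarrow> (\<forall>B\<in>stack D D'. \<forall>u\<in>B. \<forall>v\<in>B. stacked_label x z y u = stacked_label x z y v)"
    by (simp only: compatible_def stack_def ball_Un ball_simps stacked_label_in)
  also have "\<dots> \<longleftrightarrow> (\<forall>(u, v)\<in>?rel. stacked_label x z y u = stacked_label x z y v)" by blast
  finally have L: "?L \<longleftrightarrow> (\<forall>(u, v)\<in>?rel. stacked_label x z y u = stacked_label x z y v)" .
  have "(\<forall>(u, v)\<in>?rel. stacked_label x z y u = stacked_label x z y v) \<longleftrightarrow>
      (\<forall>(u, v)\<in>?rel\<^sup>+. stacked_label x z y u = stacked_label x z y v)" (is "?A \<longleftrightarrow> ?B")
  proof
    assume A: ?A
    have "stacked_label x z y u = stacked_label x z y v" if "(u, v) \<in> ?rel\<^sup>+" for u v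
      using that by induction (use A in auto)
    then show ?B by blast
  next
    assume ?B
    then show ?A by blast
  qed
  also have "\<dots> \<longleftrightarrow> ?R"
  proof
    assume B: ?B
    show ?R
      unfolding stack_components_def
    proof (intro ballI)
      fix C u v assume "C \<in> \<Union>(stack D D') // ?rel\<^sup>+" "u \<in> C" "v \<in> C"
      then have "(u, v) \<in> ?rel\<^sup>+"
        using quotient_eq_iff[OF stack_equiv] by blast
      with B show "stacked_label x z y u = stacked_label x z y v" by blast
    qed
  next
    assume R: ?R
    show ?B
    proof clarify
      fix u v assume uv: "(u, v) \<in> ?rel\<^sup>+"
      then have "u \<in> \<Union>(stack D D')" using equivE[OF stack_equiv] by blast
      then have "?rel\<^sup>+ `` {u} \<in> stack_components D D'" "u \<in> ?rel\<^sup>+ `` {u}"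
        unfolding stack_components_def
        using equiv_class_self[OF stack_equiv] by (auto intro: quotientI)
      moreover have "v \<in> ?rel\<^sup>+ `` {u}" using uv by auto
      ultimately show "stacked_label x z y u = stacked_label x z y v" using R by blast
    qed
  qed
  finally show ?thesis by (rule HOL.trans[OF L])
qed

text \<open>The middle row \<open>z\<close> is arbitrary, since only vertices outside it are
  compared.\<close>

lemma compatible_diagram_star:
  "compatible (diagram_star D D') x y \<longleftrightarrow>
    (\<forall>C\<in>stack_components D D'. \<forall>u\<in>C - range Mid. \<forall>v\<in>C - range Mid.
      stacked_label x z y u = stacked_label x z y v)"
proof -
  have "(\<forall>u\<in>C - range Mid. Q u) \<longleftrightarrow> (\<forall>u\<in>in_outer -` C. Q (in_outer u))" for C Q
  proof -
    have "C - range Mid = C \<inter> range in_outer"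
      unfolding range_in_outer by blast
    then show ?thesis by auto
  qed
  moreover have "compatible (diagram_star D D') x y \<longleftrightarrow>
      (\<forall>C\<in>stack_components D D'. \<forall>u\<in>in_outer -` C. \<forall>v\<in>in_outer -` C. label x y u = label x y v)"
    unfolding compatible_def diagram_star_def by blast
  ultimately show ?thesis by (simp add: stacked_label_in)
qed

text \<open>An extension of a labelling of the outer rows to the middle row is determined by the
  inner components that it labels \<open>True\<close>, which can be prescribed arbitrarily.\<close>

lemma card_middle_labels:
  assumes "compatible (diagram_star D D') x y"
  shows "card {z. length z = k \<and> compatible D z y \<and> compatible D' x z} = 2 ^ inner_components D D'"
proof -
  define cs where "cs = stack_components D D'"
  define inner where "inner = {C \<in> cs. C \<subseteq> range Mid}"
  \<comment> \<open>The empty list stands in for the middle row: only vertices outside that row are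
    evaluated. For these components the outer rows dictate the label True.\<close>
  define outer where "outer = {C \<in> cs. \<exists>u\<in>C - range Mid. stacked_label x [] y u}"
  define good where "good = {z. length z = k \<and> compatible D z y \<and> compatible D' x z}"
  define f where "f z = {C \<in> inner. \<exists>i. Mid i \<in> C \<and> z ! (i - 1)}" for z :: "bool list"
  define g where "g T = map (\<lambda>i. \<exists>C\<in>T \<union> outer. Mid (Suc i) \<in> C) [0..<k]" for T
  have P: "partition_on (Low ` {1..m} \<union> Mid ` {1..k} \<union> High ` {1..l}) cs"
    unfolding cs_def by (rule partition_on_stack_components)
  have disj: "C = C'" if "C \<in> cs" "C' \<in> cs" "u \<in> C" "u \<in> C'" for C C' u
    using partition_on_unique_block[OF P that] .
  have cover: "\<exists>C\<in>cs. v \<in> C" if "v \<in> Low ` {1..m} \<union> Mid ` {1..k} \<union> High ` {1..l}" for v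
    using that unfolding partition_onD1[OF P] by blast
  have sub: "v \<in> Low ` {1..m} \<union> Mid ` {1..k} \<union> High ` {1..l}" if "C \<in> cs" "v \<in> C" for C v
    using that unfolding partition_onD1[OF P] by blast
  have nonempty: "C \<noteq> {}" if "C \<in> cs" for C
    using partition_onD3[OF P] that by blast
  have outer_label: "stacked_label x z y u = stacked_label x z' y u" if "u \<notin> range Mid" for z z' u
    using that by (cases u) auto
  have good_iff: "z \<in> good \<longleftrightarrow> length z = k \<and>
      (\<forall>C\<in>cs. \<forall>u\<in>C. \<forall>v\<in>C. stacked_label x z y u = stacked_label x z y v)" for z
    using compatible_stack unfolding good_def cs_def by blast
  have outer_const: "stacked_label x [] y u = stacked_label x [] y v"
    if "C \<in> cs" "u \<in> C - range Mid" "v \<in> C - range Mid" for C u v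
    using assms that compatible_diagram_star unfolding cs_def by blast
  have outer_iff: "stacked_label x [] y u \<longleftrightarrow> C \<in> outer" if "C \<in> cs" "u \<in> C" "u \<notin> range Mid" for C u
  proof
    assume "stacked_label x [] y u"
    then show "C \<in> outer" unfolding outer_def using that by blast
  next
    assume "C \<in> outer"
    then obtain v where "v \<in> C - range Mid" "stacked_label x [] y v" unfolding outer_def by blast
    then show "stacked_label x [] y u" using outer_const[of C u v] that by blast
  qed
  have inner_outer: "inner \<inter> outer = {}" by (auto simp: inner_def outer_def)
  have g_label: "stacked_label x (g T) y v \<longleftrightarrow> (\<exists>C\<in>T \<union> outer. v \<in> C)"
    if T: "T \<subseteq> inner" and v: "v \<in> Low ` {1..m} \<union> Mid ` {1..k} \<union> High ` {1..l}" for T v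
  proof (cases "v \<in> range Mid")
    case True
    then obtain j where j: "v = Mid j" "j \<in> {1..k}" using v by auto
    then obtain i where "v = Mid (Suc i)" "i < k" by (cases j) auto
    then show ?thesis by (simp add: g_def)
  next
    case False
    obtain C where C: "C \<in> cs" "v \<in> C" using cover[OF v] by blast
    have "stacked_label x [] y v \<longleftrightarrow> C \<in> outer"
      using outer_iff[OF C(1) _ False] C(2) by simp
    moreover have "C' = C" if "C' \<in> T \<union> outer" "v \<in> C'" for C'
    proof -
      have "C' \<in> cs" using that(1) T unfolding inner_def outer_def by blast
      then show ?thesis using disj[OF _ C(1) that(2) C(2)] by simp
    qed
    then have "(\<exists>C'\<in>T \<union> outer. v \<in> C') \<longleftrightarrow> C \<in> T \<union> outer" using C(2) by blast
    moreover have "C \<notin> T" using False C T by (auto simp: inner_def)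
    ultimately show ?thesis using outer_label[OF False, of "g T" "[]"] by simp
  qed
  have "bij_betw f good (Pow inner)"
  proof (rule bij_betwI[where g = g])
    show "f \<in> good \<rightarrow> Pow inner" by (auto simp: f_def)
    show "g \<in> Pow inner \<rightarrow> good"
    proof
      fix T assume "T \<in> Pow inner"
      then have T: "T \<subseteq> inner" by simp
      have "stacked_label x (g T) y u = stacked_label x (g T) y v" if "C \<in> cs" "u \<in> C" "v \<in> C" for C u v
      proof -
        have "T \<union> outer \<subseteq> cs" using T by (auto simp: inner_def outer_def)
        then have "C' \<in> T \<union> outer \<Longrightarrow> u \<in> C' \<longleftrightarrow> v \<in> C'" for C'
          using disj[of C' C u] disj[of C' C v] that by blast
        then have "(\<exists>C'\<in>T \<union> outer. u \<in> C') \<longleftrightarrow> (\<exists>C'\<in>T \<union> outer. v \<in> C')" by blast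
        then show ?thesis
          using g_label[OF T sub[OF that(1,2)]] g_label[OF T sub[OF that(1,3)]] by simp
      qed
      moreover have "length (g T) = k" by (simp add: g_def)
      ultimately show "g T \<in> good" unfolding good_iff by blast
    qed
    show "g (f z) = z" if "z \<in> good" for z
    proof (rule nth_equalityI)
      show "length (g (f z)) = length z" using that by (simp add: good_def g_def)
      fix i assume "i < length (g (f z))"
      then have i: "i < k" by (simp add: g_def)
      obtain C where C: "C \<in> cs" "Mid (Suc i) \<in> C" using cover[of "Mid (Suc i)"] i by auto
      have const: "stacked_label x z y u = stacked_label x z y v" if "u \<in> C" "v \<in> C" for u v
        using \<open>z \<in> good\<close> that C unfolding good_iff by blast
      have "g (f z) ! i \<longleftrightarrow> (\<exists>C\<in>f z \<union> outer. Mid (Suc i) \<in> C)" using i by (simp add: g_def)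
      also have "\<dots> \<longleftrightarrow> C \<in> f z \<union> outer"
      proof -
        have "f z \<union> outer \<subseteq> cs" by (auto simp: f_def inner_def outer_def)
        then show ?thesis using disj[OF _ C(1) _ C(2)] C(2) by blast
      qed
      also have "\<dots> \<longleftrightarrow> z ! i"
      proof (cases "C \<in> inner")
        case True
        then have "C \<notin> outer" using inner_outer by blast
        have "C \<in> f z \<longleftrightarrow> z ! i"
        proof
          assume "C \<in> f z"
          then obtain j where "Mid j \<in> C" "z ! (j - 1)" by (auto simp: f_def)
          with const[OF _ C(2), of "Mid j"] show "z ! i" by simp
        qed (use True C in \<open>auto simp: f_def\<close>)
        with \<open>C \<notin> outer\<close> show ?thesis by simp
      next
        case False
        then obtain u where u: "u \<in> C" "u \<notin> range Mid" using C by (auto simp: inner_def)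
        have "C \<in> outer \<longleftrightarrow> stacked_label x [] y u"
          using outer_iff[OF C(1) u] by simp
        also have "\<dots> \<longleftrightarrow> z ! i"
          using const[OF u(1) C(2)] outer_label[OF u(2), of "[]" z] by simp
        finally show ?thesis using False by (auto simp: f_def)
      qed
      finally show "g (f z) ! i = z ! i" .
    qed
    show "f (g T) = T" if "T \<in> Pow inner" for T
    proof -
      have T: "T \<subseteq> inner" using that by simp
      have "C \<in> f (g T) \<longleftrightarrow> C \<in> T" if "C \<in> inner" for C
      proof -
        have C: "C \<in> cs" using that by (auto simp: inner_def)
        have "(\<exists>i. Mid i \<in> C \<and> g T ! (i - 1)) \<longleftrightarrow> C \<in> T \<union> outer"
        proof
          assume "\<exists>i. Mid i \<in> C \<and> g T ! (i - 1)"
          then obtain i where i: "Mid i \<in> C" "g T ! (i - 1)" by blast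
          obtain C' where "C' \<in> T \<union> outer" "Mid i \<in> C'"
            using g_label[OF T sub[OF C i(1)]] i(2) by auto
          moreover have "T \<union> outer \<subseteq> cs" using T by (auto simp: inner_def outer_def)
          ultimately show "C \<in> T \<union> outer"
            using disj[OF C _ i(1)] by blast
        next
          assume CT: "C \<in> T \<union> outer"
          obtain i where i: "Mid i \<in> C" using nonempty[OF C] \<open>C \<in> inner\<close> by (auto simp: inner_def)
          then have "g T ! (i - 1)" using g_label[OF T sub[OF C i]] CT by auto
          with i show "\<exists>i. Mid i \<in> C \<and> g T ! (i - 1)" by blast
        qed
        moreover have "C \<notin> outer" using that inner_outer by blast
        ultimately show ?thesis using that by (auto simp: f_def)
      qed
      with T show ?thesis by (auto simp: f_def)
    qed
  qed
  then have "card good = card (Pow inner)" by (rule bij_betw_same_card)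
  also have "finite cs" by (rule finite_elements[OF _ P]) simp
  then have "card (Pow inner) = 2 ^ card inner" by (intro card_Pow) (auto simp: inner_def)
  finally show ?thesis by (simp add: good_def inner_def inner_components_def cs_def)
qed

lemma diagram_matrix_star:
  "(\<Sum>z | length z = k. diagram_matrix D z y * diagram_matrix D' x z) =
    2 ^ inner_components D D' * diagram_matrix (diagram_star D D') x y"
proof -
  have "(\<Sum>z | length z = k. diagram_matrix D z y * diagram_matrix D' x z) =
      (\<Sum>z | length z = k. of_bool (compatible D z y \<and> compatible D' x z))"
    by (simp add: diagram_matrix_def of_bool_conj)
  also have "\<dots> = card {z. length z = k \<and> compatible D z y \<and> compatible D' x z}"
    by (rule HOL.trans[OF sum_of_bool_eq[OF finite_length_eq finite_length_eq]])
      (simp only: of_nat_id Collect_conj_eq)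
  also have "\<dots> = 2 ^ inner_components D D' * diagram_matrix (diagram_star D D') x y"
  proof (cases "compatible (diagram_star D D') x y")
    case True
    then show ?thesis using card_middle_labels by (simp add: diagram_matrix_def)
  next
    case False
    have "compatible (diagram_star D D') x y" if "compatible D z y" "compatible D' x z" for z
    proof -
      have "\<forall>C\<in>stack_components D D'. \<forall>u\<in>C. \<forall>v\<in>C. stacked_label x z y u = stacked_label x z y v"
        by (rule iffD1[OF compatible_stack conjI[OF that]])
      then show ?thesis unfolding compatible_diagram_star[where z = z] by (meson DiffD1)
    qed
    with False have empty: "{z. length z = k \<and> compatible D z y \<and> compatible D' x z} = {}" by blast
    show ?thesis unfolding empty using False by (simp add: diagram_matrix_def)
  qed
  finally show ?thesis .
qed

end

subsection \<open>Juxtaposition\<close>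

lemma compatible_diagram_tensor:
  assumes "D \<in> partitions k l" "D' \<in> partitions k' l'"
    and "length x = k + k'" "length y = l + l'"
  shows "compatible (diagram_tensor k l D D') x y \<longleftrightarrow>
    compatible D (take k x) (take l y) \<and> compatible D' (drop k x) (drop l y)"
proof -
  have 1: "label (take k x) (take l y) v = label x y v" if "B \<in> D" "v \<in> B" for B v
  proof -
    have "v \<in> vertices k l" using that assms(1) by (auto simp: partitions_iff partition_on_def)
    then show ?thesis by (auto simp: vertices_def)
  qed
  have 2: "label (drop k x) (drop l y) v = label x y (shift_vertex k l v)" if "B \<in> D'" "v \<in> B" for B v
  proof -
    have "v \<in> vertices k' l'" using that assms(2) by (auto simp: partitions_iff partition_on_def)
    then show ?thesis using assms(3,4) by (auto simp: vertices_def)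
  qed
  have "compatible D (take k x) (take l y) \<longleftrightarrow> compatible D x y"
    unfolding compatible_def by (intro ball_cong HOL.refl) (simp add: 1)
  moreover have "compatible D' (drop k x) (drop l y) \<longleftrightarrow>
      compatible (image (shift_vertex k l) ` D') x y"
    unfolding compatible_def by (simp add: 2)
  ultimately show ?thesis
    by (simp add: compatible_def diagram_tensor_def ball_Un)
qed

lemma diagram_tensor_partitions:
  assumes "D \<in> partitions k l" "D' \<in> partitions k' l'"
  shows "diagram_tensor k l D D' \<in> partitions (k + k') (l + l')"
proof -
  let ?s = "shift_vertex k l"
  have inj: "inj ?s"
  proof (rule injI)
    fix u v assume "?s u = ?s v"
    then show "u = v" by (cases u; cases v) auto
  qed
  have P: "partition_on (vertices k l) D" "partition_on (vertices k' l') D'"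
    using assms by (auto simp: partitions_iff)
  have "{} \<notin> image ?s ` D'" using partition_onD3[OF P(2)] by auto
  then have P': "partition_on (?s ` vertices k' l') (image ?s ` D')"
    using partition_on_inj_image[OF P(2) inj_on_subset[OF inj]] by simp
  have "disjnt (vertices k l) (?s ` vertices k' l')"
    by (auto simp: vertices_def disjnt_def)
  moreover from this have "disjoint (D \<union> image ?s ` D')"
    using disjoint_union[OF partition_onD2[OF P(1)] partition_onD2[OF P']]
    unfolding partition_onD1[OF P(1)] partition_onD1[OF P'] disjnt_def by blast
  ultimately have "partition_on (vertices k l \<union> ?s ` vertices k' l') (D \<union> image ?s ` D')"
    using P(1) P' unfolding partition_on_def by blast
  also have "vertices k l \<union> ?s ` vertices k' l' = vertices (k + k') (l + l')"
  proof -
    have split: "{1..a + b} = {1..a} \<union> (+) a ` {1..b}" for a b :: nat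
      unfolding image_add_atLeastAtMost by auto
    have s: "?s ` vertices k' l' = Bot ` (+) k ` {1..k'} \<union> Top ` (+) l ` {1..l'}"
      by (simp only: vertices_def image_Un image_image shift_vertex.simps)
    show ?thesis unfolding s unfolding vertices_def split image_Un by (simp only: Un_ac)
  qed
  finally show ?thesis by (simp add: partitions_iff diagram_tensor_def)
qed

lemma diagram_matrix_tensor:
  assumes "D \<in> partitions k l" "D' \<in> partitions k' l'"
    and "length x = k + k'" "length y = l + l'"
  shows "diagram_matrix (diagram_tensor k l D D') x y =
    diagram_matrix D (take k x) (take l y) * diagram_matrix D' (drop k x) (drop l y)"
  by (simp only: diagram_matrix_def compatible_diagram_tensor[OF assms] of_bool_conj)

section \<open>Composition and tensor product in the partition category\<close>

abbreviation (input) keys where "keys \<equiv> Poly_Mapping.keys"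
abbreviation (input) coeff where "coeff \<equiv> Poly_Mapping.lookup"
abbreviation (input) single where "single \<equiv> Poly_Mapping.single"

abbreviation pm_scale :: "'a::{comm_ring,comm_monoid_mult} \<Rightarrow> 'a par_morphism \<Rightarrow> 'a par_morphism" where
  "pm_scale a f \<equiv> Poly_Mapping.map ((*) a) f"

lemma lookup_pm_scale: "coeff (pm_scale a f) D = a * coeff f D"
  by (simp add: Poly_Mapping.map.rep_eq when_def)

lemma pm_scale_single: "pm_scale a (single D b) = single D (a * b)"
  by (rule poly_mapping_eqI) (simp add: lookup_pm_scale lookup_single when_def)

lemma pm_scale_add: "pm_scale a (f + g) = pm_scale a f + pm_scale a g"
  by (rule poly_mapping_eqI) (simp add: lookup_pm_scale lookup_add distrib_left)

lemma pm_scale_0: "pm_scale a 0 = 0"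
  by (rule poly_mapping_eqI) (simp add: lookup_pm_scale)

lemma keys_pm_scale: "keys (pm_scale a f) \<subseteq> keys f"
  by (auto simp: in_keys_iff lookup_pm_scale)

lemma sum_pm_scale: "pm_scale a (sum f A) = (\<Sum>x\<in>A. pm_scale a (f x))"
  by (induction A rule: infinite_finite_induct) (simp_all add: pm_scale_add pm_scale_0)

lemma sum_single_keys:
  fixes f :: "'a \<Rightarrow>\<^sub>0 'b::comm_monoid_add"
  shows "(\<Sum>D\<in>keys f. single D (coeff f D)) = f"
proof (rule poly_mapping_eqI)
  fix D
  show "coeff (\<Sum>D\<in>keys f. single D (coeff f D)) D =
      coeff f D"
    by (simp add: lookup_sum lookup_single when_def sum.delta in_keys_iff)
qed

text \<open>Reduces multilinear identities to single diagrams; \<open>S\<close> records the type of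
  the diagrams that may occur.\<close>

lemma linear_induct [consumes 1, case_names zero single add]:
  fixes f :: "'a \<Rightarrow>\<^sub>0 'b::comm_monoid_add"
  assumes "keys f \<subseteq> S" "P 0" "\<And>D a. D \<in> S \<Longrightarrow> P (single D a)"
    "\<And>f g. keys f \<subseteq> S \<Longrightarrow> keys g \<subseteq> S \<Longrightarrow> P f \<Longrightarrow> P g \<Longrightarrow> P (f + g)"
  shows "P f"
proof -
  have "keys (\<Sum>D\<in>A. single D (coeff f D)) \<subseteq> S \<and>
      P (\<Sum>D\<in>A. single D (coeff f D))"
    if "finite A" "A \<subseteq> S" for A
    using that
  proof (induction A)
    case (insert D A)
    let ?s = "single D (coeff f D)"
    let ?r = "\<Sum>D\<in>A. single D (coeff f D)"
    have "keys ?s \<subseteq> S" using insert.prems by simp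
    then have "P (?s + ?r)" "keys (?s + ?r) \<subseteq> S"
      using insert assms(3)[of D] assms(4)[of ?s ?r] Poly_Mapping.keys_add[of ?s ?r] by auto
    with insert show ?case by simp
  qed (use assms in auto)
  from this[OF finite_keys assms(1)] show ?thesis by (simp add: sum_single_keys)
qed

text \<open>The common shape of \<open>par_comp\<close> and \<open>par_tensor\<close>, so that
  bilinearity is proved once.\<close>

definition bilinear_ext ::
    "('d \<Rightarrow> 'd \<Rightarrow> 'd) \<Rightarrow> ('d \<Rightarrow> 'd \<Rightarrow> 'a) \<Rightarrow> ('d \<Rightarrow>\<^sub>0 'a) \<Rightarrow> ('d \<Rightarrow>\<^sub>0 'a) \<Rightarrow> ('d \<Rightarrow>\<^sub>0 'a::{comm_ring,comm_monoid_mult})" where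
  "bilinear_ext m e f g =
     (\<Sum>D\<in>keys f. \<Sum>D'\<in>keys g. single (m D D') (coeff f D * coeff g D' * e D D'))"

text \<open>Coefficients may cancel in a sum, so supports are not additive; comparing sums needs a
  common finite superset.\<close>

lemma bilinear_ext_eq_sum:
  assumes "finite A" "keys f \<subseteq> A" "finite B" "keys g \<subseteq> B"
  shows "bilinear_ext m e f g = (\<Sum>D\<in>A. \<Sum>D'\<in>B. single (m D D') (coeff f D * coeff g D' * e D D'))"
proof -
  have "bilinear_ext m e f g =
      (\<Sum>D\<in>keys f. \<Sum>D'\<in>B. single (m D D') (coeff f D * coeff g D' * e D D'))"
    unfolding bilinear_ext_def
    by (intro sum.cong sum.mono_neutral_left HOL.refl) (use assms in \<open>auto simp: in_keys_iff\<close>)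
  also have "\<dots> = (\<Sum>D\<in>A. \<Sum>D'\<in>B. single (m D D') (coeff f D * coeff g D' * e D D'))"
    by (intro sum.mono_neutral_left) (use assms in \<open>auto simp: in_keys_iff\<close>)
  finally show ?thesis .
qed

lemma bilinear_ext_single:
  "bilinear_ext m e (single D a) (single D' b) = single (m D D') (a * b * e D D')"
  by (subst bilinear_ext_eq_sum[of "{D}" _ "{D'}"]) auto

lemma bilinear_ext_add:
  "bilinear_ext m e (f + g) h = bilinear_ext m e f h + bilinear_ext m e g h"
  "bilinear_ext m e h (f + g) = bilinear_ext m e h f + bilinear_ext m e h g"
proof -
  let ?A = "keys f \<union> keys g"
  have "bilinear_ext m e x h =
      (\<Sum>D\<in>?A. \<Sum>D'\<in>keys h. single (m D D') (coeff x D * coeff h D' * e D D'))"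
    and "bilinear_ext m e h x =
      (\<Sum>D\<in>keys h. \<Sum>D'\<in>?A. single (m D D') (coeff h D * coeff x D' * e D D'))"
    if "keys x \<subseteq> ?A" for x
    by (rule bilinear_ext_eq_sum; use that in simp)+
  then show "bilinear_ext m e (f + g) h = bilinear_ext m e f h + bilinear_ext m e g h"
    "bilinear_ext m e h (f + g) = bilinear_ext m e h f + bilinear_ext m e h g"
    using Poly_Mapping.keys_add[of f g]
    by (simp_all add: lookup_add distrib_left distrib_right single_add sum.distrib)
qed

lemma bilinear_ext_zero: "bilinear_ext m e 0 g = 0" "bilinear_ext m e f 0 = 0"
  by (simp_all add: bilinear_ext_def)

lemma bilinear_ext_scale:
  "bilinear_ext m e (pm_scale a f) g = pm_scale a (bilinear_ext m e f g)"
  "bilinear_ext m e f (pm_scale a g) = pm_scale a (bilinear_ext m e f g)"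
proof -
  have "bilinear_ext m e (pm_scale a f) g = (\<Sum>D\<in>keys f. \<Sum>D'\<in>keys g.
      single (m D D') (coeff (pm_scale a f) D * coeff g D' * e D D'))"
    and "bilinear_ext m e f (pm_scale a g) = (\<Sum>D\<in>keys f. \<Sum>D'\<in>keys g.
      single (m D D') (coeff f D * coeff (pm_scale a g) D' * e D D'))"
    by (rule bilinear_ext_eq_sum; simp add: keys_pm_scale)+
  then show "bilinear_ext m e (pm_scale a f) g = pm_scale a (bilinear_ext m e f g)"
    "bilinear_ext m e f (pm_scale a g) = pm_scale a (bilinear_ext m e f g)"
    by (simp_all add: bilinear_ext_def sum_pm_scale pm_scale_single lookup_pm_scale ac_simps)
qed

lemma par_comp_eq: "par_comp t = bilinear_ext diagram_star (\<lambda>D D'. t ^ inner_components D D')"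
  by (intro ext) (simp add: par_comp_def bilinear_ext_def)

lemma par_tensor_eq: "par_tensor k l = bilinear_ext (diagram_tensor k l) (\<lambda>_ _. 1)"
  by (intro ext) (simp add: par_tensor_def bilinear_ext_def)

lemmas par_comp_single =
  bilinear_ext_single[of diagram_star "\<lambda>D D'. t ^ inner_components D D'" for t, folded par_comp_eq]
lemmas par_comp_add =
  bilinear_ext_add[of diagram_star "\<lambda>D D'. t ^ inner_components D D'" for t, folded par_comp_eq]
lemmas par_comp_zero =
  bilinear_ext_zero[of diagram_star "\<lambda>D D'. t ^ inner_components D D'" for t, folded par_comp_eq]
lemmas par_comp_scale =
  bilinear_ext_scale[of diagram_star "\<lambda>D D'. t ^ inner_components D D'" for t, folded par_comp_eq]

lemma par_tensor_single: "par_tensor k l (single D a) (single D' b) = single (diagram_tensor k l D D') (a * b)"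
  by (simp add: par_tensor_eq bilinear_ext_single)

lemmas par_tensor_add =
  bilinear_ext_add[of "diagram_tensor k l" "\<lambda>_ _. 1" for k l, folded par_tensor_eq]
lemmas par_tensor_zero =
  bilinear_ext_zero[of "diagram_tensor k l" "\<lambda>_ _. 1" for k l, folded par_tensor_eq]
lemmas par_tensor_scale =
  bilinear_ext_scale[of "diagram_tensor k l" "\<lambda>_ _. 1" for k l, folded par_tensor_eq]

lemma keys_par_comp:
  assumes "keys f \<subseteq> partitions k l" "keys g \<subseteq> partitions m k"
  shows "keys (par_comp t f g) \<subseteq> partitions m l"
  unfolding par_comp_def
  using assms diagram_star_partitions
  by (fastforce dest!: subsetD[OF Poly_Mapping.keys_sum] split: if_splits)

lemma keys_par_tensor:
  assumes "keys f \<subseteq> partitions k l" "keys g \<subseteq> partitions k' l'"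
  shows "keys (par_tensor k l f g) \<subseteq> partitions (k + k') (l + l')"
  unfolding par_tensor_def
  using assms diagram_tensor_partitions
  by (fastforce dest!: subsetD[OF Poly_Mapping.keys_sum] split: if_splits)

text \<open>Associativity of the matrix product; the powers of 2 in front account for the inner
  components.\<close>

lemma diagram_star_assoc:
  assumes D: "D \<in> partitions k l" and D': "D' \<in> partitions m k" and D'': "D'' \<in> partitions p m"
  shows "diagram_star (diagram_star D D') D'' = diagram_star D (diagram_star D' D'')"
    "inner_components D D' + inner_components (diagram_star D D') D'' =
      inner_components D' D'' + inner_components D (diagram_star D' D'')"
proof -
  note P = diagram_star_partitions[OF D D'] diagram_star_partitions[OF D' D'']
  note Q = diagram_star_partitions[OF P(1) D''] diagram_star_partitions[OF D P(2)]
  have "2 ^ (inner_components D D' + inner_components (diagram_star D D') D'') *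
        diagram_matrix (diagram_star (diagram_star D D') D'') x y =
      2 ^ (inner_components D' D'' + inner_components D (diagram_star D' D'')) *
        diagram_matrix (diagram_star D (diagram_star D' D'')) x y" for x y
  proof -
    have "2 ^ (inner_components D D' + inner_components (diagram_star D D') D'') *
        diagram_matrix (diagram_star (diagram_star D D') D'') x y =
        (\<Sum>z | length z = m. 2 ^ inner_components D D' * diagram_matrix (diagram_star D D') z y *
          diagram_matrix D'' x z)"
      using diagram_matrix_star[OF P(1) D'', of y x] by (simp add: power_add mult.assoc flip: sum_distrib_left)
    also have "\<dots> = (\<Sum>z | length z = m. \<Sum>w | length w = k.
        diagram_matrix D w y * diagram_matrix D' z w * diagram_matrix D'' x z)"
      by (simp only: diagram_matrix_star[OF D D', symmetric] sum_distrib_right)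
    also have "\<dots> = (\<Sum>w | length w = k. \<Sum>z | length z = m.
        diagram_matrix D w y * diagram_matrix D' z w * diagram_matrix D'' x z)"
      by (rule sum.swap)
    also have "\<dots> = (\<Sum>w | length w = k. diagram_matrix D w y *
        (2 ^ inner_components D' D'' * diagram_matrix (diagram_star D' D'') x w))"
      by (simp only: diagram_matrix_star[OF D' D'', symmetric] sum_distrib_left mult.assoc)
    also have "\<dots> = 2 ^ inner_components D' D'' *
        (\<Sum>w | length w = k. diagram_matrix D w y * diagram_matrix (diagram_star D' D'') x w)"
      by (simp only: sum_distrib_left mult.left_commute)
    also have "\<dots> = 2 ^ (inner_components D' D'' + inner_components D (diagram_star D' D'')) *
        diagram_matrix (diagram_star D (diagram_star D' D'')) x y"
      by (simp only: diagram_matrix_star[OF D P(2)] power_add mult.assoc)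
    finally show ?thesis .
  qed
  then show "diagram_star (diagram_star D D') D'' = diagram_star D (diagram_star D' D'')"
    "inner_components D D' + inner_components (diagram_star D D') D'' =
      inner_components D' D'' + inner_components D (diagram_star D' D'')"
    using scaled_diagram_matrix_eqD[OF Q] by blast+
qed

lemma sum_length_append:
  fixes F :: "bool list \<Rightarrow> bool list \<Rightarrow> nat"
  shows "(\<Sum>z | length z = k + k'. F (take k z) (drop k z)) =
    (\<Sum>u | length u = k. \<Sum>v | length v = k'. F u v)"
proof -
  have "(\<Sum>z | length z = k + k'. F (take k z) (drop k z)) =
      (\<Sum>(u, v)\<in>{u. length u = k} \<times> {v. length v = k'}. F u v)"
    by (rule sum.reindex_bij_witness[of _ "\<lambda>(u, v). u @ v" "\<lambda>z. (take k z, drop k z)"]) auto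
  also have "\<dots> = (\<Sum>u | length u = k. \<Sum>v | length v = k'. F u v)"
    by (simp add: sum.cartesian_product)
  finally show ?thesis .
qed

text \<open>Juxtaposition corresponds to the Kronecker product of matrices, and this is its
  mixed-product rule: a sum over rows of length \<open>k + k'\<close> is a double sum.\<close>

lemma diagram_interchange:
  assumes D1: "D1 \<in> partitions k l" and D2: "D2 \<in> partitions m k"
    and D3: "D3 \<in> partitions k' l'" and D4: "D4 \<in> partitions m' k'"
  shows "diagram_tensor m l (diagram_star D1 D2) (diagram_star D3 D4) =
      diagram_star (diagram_tensor k l D1 D3) (diagram_tensor m k D2 D4)"
    "inner_components D1 D2 + inner_components D3 D4 =
      inner_components (diagram_tensor k l D1 D3) (diagram_tensor m k D2 D4)"
proof -
  note P = diagram_star_partitions[OF D1 D2] diagram_star_partitions[OF D3 D4]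
  note Q = diagram_tensor_partitions[OF D1 D3] diagram_tensor_partitions[OF D2 D4]
  note R = diagram_tensor_partitions[OF P] diagram_star_partitions[OF Q]
  have "2 ^ (inner_components D1 D2 + inner_components D3 D4) *
        diagram_matrix (diagram_tensor m l (diagram_star D1 D2) (diagram_star D3 D4)) x y =
      2 ^ inner_components (diagram_tensor k l D1 D3) (diagram_tensor m k D2 D4) *
        diagram_matrix (diagram_star (diagram_tensor k l D1 D3) (diagram_tensor m k D2 D4)) x y"
    if x: "length x = m + m'" and y: "length y = l + l'" for x y
  proof -
    have "2 ^ (inner_components D1 D2 + inner_components D3 D4) *
        diagram_matrix (diagram_tensor m l (diagram_star D1 D2) (diagram_star D3 D4)) x y =
      (2 ^ inner_components D1 D2 * diagram_matrix (diagram_star D1 D2) (take m x) (take l y)) *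
      (2 ^ inner_components D3 D4 * diagram_matrix (diagram_star D3 D4) (drop m x) (drop l y))"
      by (simp add: diagram_matrix_tensor[OF P x y] power_add)
    also have "\<dots> = (\<Sum>u | length u = k. \<Sum>v | length v = k'.
        (diagram_matrix D1 u (take l y) * diagram_matrix D2 (take m x) u) *
        (diagram_matrix D3 v (drop l y) * diagram_matrix D4 (drop m x) v))"
      unfolding diagram_matrix_star[OF D1 D2, symmetric] diagram_matrix_star[OF D3 D4, symmetric]
      by (rule sum_product)
    also have "\<dots> = (\<Sum>z | length z = k + k'.
        (diagram_matrix D1 (take k z) (take l y) * diagram_matrix D2 (take m x) (take k z)) *
        (diagram_matrix D3 (drop k z) (drop l y) * diagram_matrix D4 (drop m x) (drop k z)))"
      by (rule sum_length_append[symmetric])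
    also have "\<dots> = (\<Sum>z | length z = k + k'.
        diagram_matrix (diagram_tensor k l D1 D3) z y * diagram_matrix (diagram_tensor m k D2 D4) x z)"
      by (rule sum.cong)
        (auto simp: diagram_matrix_tensor[OF D1 D3 _ y] diagram_matrix_tensor[OF D2 D4 x])
    also have "\<dots> = 2 ^ inner_components (diagram_tensor k l D1 D3) (diagram_tensor m k D2 D4) *
        diagram_matrix (diagram_star (diagram_tensor k l D1 D3) (diagram_tensor m k D2 D4)) x y"
      by (rule diagram_matrix_star[OF Q])
    finally show ?thesis .
  qed
  then show "diagram_tensor m l (diagram_star D1 D2) (diagram_star D3 D4) =
      diagram_star (diagram_tensor k l D1 D3) (diagram_tensor m k D2 D4)"
    "inner_components D1 D2 + inner_components D3 D4 =
      inner_components (diagram_tensor k l D1 D3) (diagram_tensor m k D2 D4)"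
    using scaled_diagram_matrix_eqD[OF R] by blast+
qed

lemma diagram_tensor_assoc:
  "diagram_tensor (k + k') (l + l') (diagram_tensor k l D D') D'' =
    diagram_tensor k l D (diagram_tensor k' l' D' D'')"
proof -
  have "shift_vertex (k + k') (l + l') v = shift_vertex k l (shift_vertex k' l' v)" for v
    by (cases v) auto
  then show ?thesis by (simp add: diagram_tensor_def image_Un image_image Un_assoc)
qed

lemma diagram_tensor_empty: "diagram_tensor 0 0 {} D = D" "diagram_tensor k l D {} = D"
proof -
  have "shift_vertex 0 0 v = v" for v by (cases v) auto
  then show "diagram_tensor 0 0 {} D = D" by (simp add: diagram_tensor_def)
qed (simp add: diagram_tensor_def)

definition id_diagram :: "nat \<Rightarrow> diagram" where
  "id_diagram k = (\<lambda>i. {Bot i, Top i}) ` {1..k}"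

lemma id_diagram_partitions: "id_diagram k \<in> partitions k k"
  by (auto simp: id_diagram_def partitions_def partition_on_def disjoint_def)

lemma diagram_matrix_id:
  assumes "length x = k" "length y = k"
  shows "diagram_matrix (id_diagram k) x y = of_bool (x = y)"
proof -
  have "compatible (id_diagram k) x y \<longleftrightarrow> (\<forall>i\<in>{1..k}. x ! (i - 1) = y ! (i - 1))"
    by (auto simp: compatible_def id_diagram_def)
  also have "\<dots> \<longleftrightarrow> (\<forall>i<k. x ! i = y ! i)"
    unfolding image_Suc_lessThan[symmetric] by simp (simp add: Ball_def)
  also have "\<dots> \<longleftrightarrow> x = y" using assms by (auto simp: list_eq_iff_nth_eq)
  finally show ?thesis by (simp add: diagram_matrix_def)
qed

lemma diagram_star_id:
  assumes D: "D \<in> partitions k l"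
  shows "diagram_star (id_diagram l) D = D" "inner_components (id_diagram l) D = 0"
    "diagram_star D (id_diagram k) = D" "inner_components D (id_diagram k) = 0"
proof -
  note P = diagram_star_partitions[OF id_diagram_partitions D]
    diagram_star_partitions[OF D id_diagram_partitions]
  have "2 ^ inner_components (id_diagram l) D * diagram_matrix (diagram_star (id_diagram l) D) x y =
      2 ^ 0 * diagram_matrix D x y" if "length x = k" "length y = l" for x y
  proof -
    have "(\<Sum>z | length z = l. diagram_matrix (id_diagram l) z y * diagram_matrix D x z) =
        (\<Sum>z | length z = l. if z = y then diagram_matrix D x z else 0)"
      by (rule sum.cong) (auto simp: diagram_matrix_id that)
    also have "\<dots> = diagram_matrix D x y" using that by (simp add: finite_length_eq)
    finally show ?thesis by (simp add: diagram_matrix_star[OF id_diagram_partitions D])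
  qed
  from scaled_diagram_matrix_eqD[OF P(1) D this]
  show "diagram_star (id_diagram l) D = D" "inner_components (id_diagram l) D = 0" by auto
  have "2 ^ inner_components D (id_diagram k) * diagram_matrix (diagram_star D (id_diagram k)) x y =
      2 ^ 0 * diagram_matrix D x y" if "length x = k" "length y = l" for x y
  proof -
    have "(\<Sum>z | length z = k. diagram_matrix D z y * diagram_matrix (id_diagram k) x z) =
        (\<Sum>z | length z = k. if x = z then diagram_matrix D z y else 0)"
      by (rule sum.cong) (auto simp: diagram_matrix_id that)
    also have "\<dots> = diagram_matrix D x y" using that by (simp add: finite_length_eq)
    finally show ?thesis by (simp add: diagram_matrix_star[OF D id_diagram_partitions])
  qed
  from scaled_diagram_matrix_eqD[OF P(2) D this]
  show "diagram_star D (id_diagram k) = D" "inner_components D (id_diagram k) = 0" by auto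
qed

section \<open>The laws of a strict monoidal category for linear combinations of diagrams\<close>

lemma par_comp_assoc:
  assumes "keys f \<subseteq> partitions k l" "keys g \<subseteq> partitions m k"
    "keys h \<subseteq> partitions p m"
  shows "par_comp t (par_comp t f g) h = par_comp t f (par_comp t g h)"
  using assms(1)
proof (induction rule: linear_induct)
  case (single D a)
  note D = single
  show ?case using assms(2)
  proof (induction rule: linear_induct)
    case (single D' b)
    note D' = single
    show ?case using assms(3)
    proof (induction rule: linear_induct)
      case (single D'' c)
      note * = diagram_star_assoc[OF D D' single]
      have "a * b * t ^ inner_components D D' * c * t ^ inner_components (diagram_star D D') D'' =
          a * (b * c * t ^ inner_components D' D'') * t ^ inner_components D (diagram_star D' D'')"
        using arg_cong[OF *(2), of "\<lambda>e. t ^ e"] by (simp add: power_add ac_simps)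
      then show ?case by (simp add: par_comp_single *(1))
    qed (simp_all add: par_comp_zero par_comp_add)
  qed (simp_all add: par_comp_zero par_comp_add)
qed (simp_all add: par_comp_zero par_comp_add)

lemma par_interchange:
  assumes "keys f \<subseteq> partitions k l" "keys g \<subseteq> partitions m k"
    "keys f' \<subseteq> partitions k' l'" "keys g' \<subseteq> partitions m' k'"
  shows "par_tensor m l (par_comp t f g) (par_comp t f' g') =
    par_comp t (par_tensor k l f f') (par_tensor m k g g')"
  using assms(1)
proof (induction rule: linear_induct)
  case (single D1 a)
  note D1 = single
  show ?case using assms(2)
  proof (induction rule: linear_induct)
    case (single D2 b)
    note D2 = single
    show ?case using assms(3)
    proof (induction rule: linear_induct)
      case (single D3 c)
      note D3 = single
      show ?case using assms(4)
      proof (induction rule: linear_induct)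
        case (single D4 d)
        note * = diagram_interchange[OF D1 D2 D3 single]
        show ?case
          by (simp add: par_comp_single par_tensor_single *(1) *(2)[symmetric] power_add ac_simps)
      qed (simp_all add: par_comp_zero par_tensor_zero par_comp_add par_tensor_add)
    qed (simp_all add: par_comp_zero par_tensor_zero par_comp_add
        par_tensor_add)
  qed (simp_all add: par_comp_zero par_tensor_zero par_comp_add
      par_tensor_add)
qed (simp_all add: par_comp_zero par_tensor_zero par_comp_add par_tensor_add)

lemma par_tensor_assoc:
  "par_tensor (k + k') (l + l') (par_tensor k l f g) h = par_tensor k l f (par_tensor k' l' g h)"
  using subset_UNIV[of "keys f"]
proof (induction rule: linear_induct)
  case (single D a)
  show ?case using subset_UNIV[of "keys g"]
  proof (induction rule: linear_induct)
    case (single D' b)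
    show ?case using subset_UNIV[of "keys h"]
    proof (induction rule: linear_induct)
      case (single D'' c)
      show ?case by (simp add: par_tensor_single diagram_tensor_assoc mult.assoc)
    qed (simp_all add: par_tensor_zero par_tensor_add)
  qed (simp_all add: par_tensor_zero par_tensor_add)
qed (simp_all add: par_tensor_zero par_tensor_add)

lemma par_tensor_unit:
  "par_tensor 0 0 (single {} 1) f = f"
  "par_tensor k l f (single {} 1) = f"
proof -
  have 1: "par_tensor 0 0 (single {} 1) f = f \<and> par_tensor k l f (single {} 1) = f"
    using subset_UNIV[of "keys f"]
    by (induction rule: linear_induct)
      (simp_all add: par_tensor_zero par_tensor_single diagram_tensor_empty par_tensor_add)
  then show "par_tensor 0 0 (single {} 1) f = f"
    "par_tensor k l f (single {} 1) = f" by auto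
qed

lemma par_comp_id:
  assumes "keys f \<subseteq> partitions k l"
  shows "par_comp t (single (id_diagram l) 1) f = f"
    "par_comp t f (single (id_diagram k) 1) = f"
proof -
  have "par_comp t (single (id_diagram l) 1) f = f \<and>
      par_comp t f (single (id_diagram k) 1) = f"
    using assms
    by (induction rule: linear_induct)
      (simp_all add: par_comp_zero par_comp_single diagram_star_id par_comp_add)
  then show "par_comp t (single (id_diagram l) 1) f = f"
    "par_comp t f (single (id_diagram k) 1) = f" by auto
qed

section \<open>The functor to the partition category is well defined\<close>

lemma list2: "length xs = 2 \<Longrightarrow> \<exists>a b. xs = [a, b]"
  by (auto simp: numeral_2_eq_2 length_Suc_conv)

lemma generator_partitions:
  "{{Bot 1, Top 2}, {Bot 2, Top 1}} \<in> partitions 2 2"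
  "{{Bot 1, Bot 2}} \<in> partitions 2 0"
  "{{Top 1, Top 2}} \<in> partitions 0 2"
  "{{Top 1}} \<in> partitions 0 1"
  "{{Bot 1}} \<in> partitions 1 0"
proof -
  have "{1..2} = {1, 2::nat}" by auto
  then show "{{Bot 1, Top 2}, {Bot 2, Top 1}} \<in> partitions 2 2"
    "{{Bot 1, Bot 2}} \<in> partitions 2 0" "{{Top 1, Top 2}} \<in> partitions 0 2"
    "{{Top 1}} \<in> partitions 0 1" "{{Bot 1}} \<in> partitions 1 0"
    by (auto simp: partitions_def partition_on_def disjoint_def)
qed

lemma keys_par_functor:
  "well_typed f \<Longrightarrow> keys (par_functor t f) \<subseteq> partitions (src f) (tgt f)"
proof (induction f)
  case (Id k)
  show ?case using id_diagram_partitions[of k] by (simp add: id_diagram_def)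
next
  case (Comp f g)
  then show ?case
    using keys_par_comp[of "par_functor t f" "src f" "tgt f" "par_functor t g" "src g" t] by simp
next
  case (Tens f g)
  then show ?case using keys_par_tensor by simp
next
  case (Plus f g)
  then show ?case using Poly_Mapping.keys_add by fastforce
next
  case (Scale a f)
  then show ?case using keys_pm_scale by fastforce
qed (use generator_partitions in auto)

text \<open>Natural numbers cannot carry the scalars of a linear combination, so this is meant for
  monomials. \<open>Eta\<close> and \<open>Eps\<close> give 1 because a singleton block imposes no
  condition.\<close>

primrec term_matrix :: "'a rb_term \<Rightarrow> bool list \<Rightarrow> bool list \<Rightarrow> nat" where
  "term_matrix (Id k) x y = of_bool (x = y)"
| "term_matrix Swap x y = of_bool (y = rev x)"
| "term_matrix Cap x y = of_bool (x ! 0 = x ! 1)"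
| "term_matrix Cup x y = of_bool (y ! 0 = y ! 1)"
| "term_matrix Eta x y = 1"
| "term_matrix Eps x y = 1"
| "term_matrix (f \<bullet> g) x y = (\<Sum>z | length z = src f. term_matrix f z y * term_matrix g x z)"
| "term_matrix (f \<otimes>\<^sub>t g) x y =
    term_matrix f (take (src f) x) (take (tgt f) y) * term_matrix g (drop (src f) x) (drop (tgt f) y)"
| "term_matrix (Zero k l) x y = 0"
| "term_matrix (f \<oplus>\<^sub>t g) x y = 0"
| "term_matrix (a \<odot>\<^sub>t f) x y = 0"

text \<open>The matrix of a monomial, which records the diagram and the exponent of \<open>t\<close>, does not
  mention connected components, so that relations can be checked by finite sums.\<close>

lemma par_functor_monomial:
  assumes "monomial w" "well_typed w"
  obtains D a where "D \<in> partitions (src w) (tgt w)" "par_functor t w = single D (t ^ a)"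
    "\<And>x y. length x = src w \<Longrightarrow> length y = tgt w \<Longrightarrow> term_matrix w x y = 2 ^ a * diagram_matrix D x y"
proof -
  have "\<exists>D a. D \<in> partitions (src w) (tgt w) \<and> par_functor t w = single D (t ^ a) \<and>
    (\<forall>x y. length x = src w \<longrightarrow> length y = tgt w \<longrightarrow> term_matrix w x y = 2 ^ a * diagram_matrix D x y)"
    using assms
  proof (induction w)
    case (Id k)
    show ?case
      using id_diagram_partitions[of k] diagram_matrix_id[of _ k]
      by (intro exI[of _ "id_diagram k"] exI[of _ 0]) (simp add: id_diagram_def)
  next
    case Swap
    have "term_matrix Swap x y = diagram_matrix {{Bot 1, Top 2}, {Bot 2, Top 1}} x y"
      if x: "length x = 2" and y: "length y = 2" for x y
    proof -
      obtain a b c d where "x = [a, b]" "y = [c, d]"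
        using list2[OF x] list2[OF y] by blast
      then show ?thesis by (cases a; cases b; cases c; cases d) (auto simp: diagram_matrix_def compatible_def)
    qed
    then show ?case
      using generator_partitions(1)
      by (intro exI[of _ "{{Bot 1, Top 2}, {Bot 2, Top 1}}"] exI[of _ 0]) simp
  next
    case Cap
    have "term_matrix Cap x y = diagram_matrix {{Bot 1, Bot 2}} x y"
      if x: "length x = 2" for x y
    proof -
      obtain a b where "x = [a, b]" using list2[OF x] by blast
      then show ?thesis by (cases a; cases b) (auto simp: diagram_matrix_def compatible_def)
    qed
    then show ?case
      using generator_partitions(2)
      by (intro exI[of _ "{{Bot 1, Bot 2}}"] exI[of _ 0]) simp
  next
    case Cup
    have "term_matrix Cup x y = diagram_matrix {{Top 1, Top 2}} x y"
      if y: "length y = 2" for x y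
    proof -
      obtain a b where "y = [a, b]" using list2[OF y] by blast
      then show ?thesis by (cases a; cases b) (auto simp: diagram_matrix_def compatible_def)
    qed
    then show ?case
      using generator_partitions(3)
      by (intro exI[of _ "{{Top 1, Top 2}}"] exI[of _ 0]) simp
  next
    case Eta
    show ?case
      using generator_partitions(4)
      by (intro exI[of _ "{{Top 1}}"] exI[of _ 0]) (simp add: diagram_matrix_def compatible_def)
  next
    case Eps
    show ?case
      using generator_partitions(5)
      by (intro exI[of _ "{{Bot 1}}"] exI[of _ 0]) (simp add: diagram_matrix_def compatible_def)
  next
    case (Comp f g)
    obtain D a where D: "D \<in> partitions (src f) (tgt f)" "par_functor t f = single D (t ^ a)"
      "\<forall>x y. length x = src f \<longrightarrow> length y = tgt f \<longrightarrow> term_matrix f x y = 2 ^ a * diagram_matrix D x y"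
      using Comp.IH(1) Comp.prems by fastforce
    obtain E b where E: "E \<in> partitions (src g) (src f)" "par_functor t g = single E (t ^ b)"
      "\<forall>x y. length x = src g \<longrightarrow> length y = src f \<longrightarrow> term_matrix g x y = 2 ^ b * diagram_matrix E x y"
      using Comp.IH(2) Comp.prems by fastforce
    have "term_matrix (f \<bullet> g) x y =
        2 ^ (a + b + inner_components D E) * diagram_matrix (diagram_star D E) x y"
      if "length x = src g" "length y = tgt f" for x y
    proof -
      have "term_matrix (f \<bullet> g) x y = (\<Sum>z | length z = src f.
          2 ^ (a + b) * (diagram_matrix D z y * diagram_matrix E x z))"
        using D(3) E(3) that by (simp add: power_add ac_simps)
      also have "\<dots> = 2 ^ (a + b) * (2 ^ inner_components D E * diagram_matrix (diagram_star D E) x y)"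
        unfolding sum_distrib_left[symmetric] diagram_matrix_star[OF D(1) E(1)] ..
      finally show ?thesis by (simp add: power_add)
    qed
    then show ?case
      using diagram_star_partitions[OF D(1) E(1)]
      by (intro exI[of _ "diagram_star D E"] exI[of _ "a + b + inner_components D E"])
        (simp add: D(2) E(2) par_comp_single power_add)
  next
    case (Tens f g)
    obtain D a where D: "D \<in> partitions (src f) (tgt f)" "par_functor t f = single D (t ^ a)"
      "\<forall>x y. length x = src f \<longrightarrow> length y = tgt f \<longrightarrow> term_matrix f x y = 2 ^ a * diagram_matrix D x y"
      using Tens.IH(1) Tens.prems by fastforce
    obtain E b where E: "E \<in> partitions (src g) (tgt g)" "par_functor t g = single E (t ^ b)"
      "\<forall>x y. length x = src g \<longrightarrow> length y = tgt g \<longrightarrow> term_matrix g x y = 2 ^ b * diagram_matrix E x y"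
      using Tens.IH(2) Tens.prems by fastforce
    have "term_matrix (f \<otimes>\<^sub>t g) x y =
        2 ^ (a + b) * diagram_matrix (diagram_tensor (src f) (tgt f) D E) x y"
      if "length x = src f + src g" "length y = tgt f + tgt g" for x y
      using D(3) E(3) that by (simp add: diagram_matrix_tensor[OF D(1) E(1) that] power_add)
    then show ?case
      using diagram_tensor_partitions[OF D(1) E(1)]
      by (intro exI[of _ "diagram_tensor (src f) (tgt f) D E"] exI[of _ "a + b"])
        (simp add: D(2) E(2) par_tensor_single power_add)
  qed auto
  then show thesis using that by blast
qed

text \<open>The exponent \<open>e\<close> serves the relations with a factor \<open>t\<close>: 2 on
  the matrix side stands for \<open>t\<close> on the side of morphisms.\<close>

lemma par_functor_eqI:
  assumes "monomial f" "well_typed f" "monomial g" "well_typed g" "src f = src g" "tgt f = tgt g"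
    and eq: "\<And>x y. length x = src f \<Longrightarrow> length y = tgt f \<Longrightarrow> term_matrix f x y = 2 ^ e * term_matrix g x y"
  shows "par_functor t f = pm_scale (t ^ e) (par_functor t g)"
proof -
  obtain D a where D: "D \<in> partitions (src f) (tgt f)" "par_functor t f = single D (t ^ a)"
    "\<And>x y. length x = src f \<Longrightarrow> length y = tgt f \<Longrightarrow> term_matrix f x y = 2 ^ a * diagram_matrix D x y"
    using par_functor_monomial[OF assms(1,2), of t] by metis
  obtain E b where E: "E \<in> partitions (src f) (tgt f)" "par_functor t g = single E (t ^ b)"
    "\<And>x y. length x = src f \<Longrightarrow> length y = tgt f \<Longrightarrow> term_matrix g x y = 2 ^ b * diagram_matrix E x y"
    using par_functor_monomial[OF assms(3,4), of t] assms(5,6) by metis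
  have "2 ^ a * diagram_matrix D x y = 2 ^ (e + b) * diagram_matrix E x y"
    if "length x = src f" "length y = tgt f" for x y
    using eq[OF that] D(3)[OF that] E(3)[OF that] by (simp add: power_add)
  from scaled_diagram_matrix_eqD[OF D(1) E(1) this] show ?thesis
    by (simp add: D(2) E(2) pm_scale_single power_add)
qed

lemma pm_scale_1: "pm_scale 1 f = f"
  by (rule poly_mapping_eqI) (simp add: lookup_pm_scale)

lemma par_functor_eqI':
  assumes "monomial f" "well_typed f" "monomial g" "well_typed g" "src f = src g" "tgt f = tgt g"
    and "\<And>x y. length x = src f \<Longrightarrow> length y = tgt f \<Longrightarrow> term_matrix f x y = term_matrix g x y"
  shows "par_functor t f = par_functor t g"
  using par_functor_eqI[OF assms(1-6), of 0 t] assms(7) by (simp add: pm_scale_1)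

section \<open>Checking relations by enumerating labels\<close>

lemma sum_length_Suc:
  fixes F :: "bool list \<Rightarrow> nat"
  shows "(\<Sum>z | length z = Suc n. F z) = (\<Sum>z | length z = n. F (True # z) + F (False # z))"
proof -
  have "(\<Sum>z | length z = Suc n. F z) = (\<Sum>(b, z)\<in>UNIV \<times> {z. length z = n}. F (b # z))"
    by (rule sum.reindex_bij_witness[of _ "\<lambda>(b, z). b # z" "\<lambda>z. (hd z, tl z)"])
      (auto simp: length_Suc_conv)
  also have "\<dots> = (\<Sum>b\<in>UNIV. \<Sum>z | length z = n. F (b # z))"
    by (simp add: sum.cartesian_product)
  finally show ?thesis by (simp add: UNIV_bool sum.distrib)
qed

lemma sum_length_1: "(\<Sum>z | length z = Suc 0. F z) = F [True] + F [False]" for F :: "bool list \<Rightarrow> nat"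
  unfolding sum_length_Suc by simp

lemma sum_length_2:
  fixes F :: "bool list \<Rightarrow> nat"
  shows "(\<Sum>z | length z = 2. F z) = F [True, True] + F [False, True] + (F [True, False] + F [False, False])"
    and "(\<Sum>z | length z = Suc (Suc 0). F z) =
      F [True, True] + F [False, True] + (F [True, False] + F [False, False])"
  unfolding numeral_2_eq_2 sum_length_Suc by simp_all

lemma sum_length_3:
  fixes F :: "bool list \<Rightarrow> nat"
  shows "(\<Sum>z | length z = 3. F z) =
    F [True, True, True] + F [False, True, True] + (F [True, False, True] + F [False, False, True]) +
    (F [True, True, False] + F [False, True, False] + (F [True, False, False] + F [False, False, False]))"
    and "(\<Sum>z | length z = Suc (Suc (Suc 0)). F z) =
    F [True, True, True] + F [False, True, True] + (F [True, False, True] + F [False, False, True]) +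
    (F [True, True, False] + F [False, True, False] + (F [True, False, False] + F [False, False, False]))"
  unfolding numeral_3_eq_3 sum_length_Suc by simp_all

lemma card_length_1: "card {z :: bool list. length z = Suc 0} = 2"
  using sum_length_1[of "\<lambda>_. 1"] by simp

lemma list_lengthD:
  "length xs = Suc 0 \<Longrightarrow> \<exists>a. xs = [a]"
  "length xs = 1 \<Longrightarrow> \<exists>a. xs = [a]"
  "length xs = 2 \<Longrightarrow> \<exists>a b. xs = [a, b]"
  "length xs = Suc (Suc 0) \<Longrightarrow> \<exists>a b. xs = [a, b]"
  "length xs = 3 \<Longrightarrow> \<exists>a b c. xs = [a, b, c]"
  "length xs = Suc (Suc (Suc 0)) \<Longrightarrow> \<exists>a b c. xs = [a, b, c]"
  by (auto simp: numeral_2_eq_2 numeral_3_eq_3 length_Suc_conv)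

lemmas matrix_simps = card_length_1 sum_length_1 sum_length_2 sum_length_3

text \<open>Explicit lists of rows let the simplifier verify all matrix entries.\<close>

lemma par_functor_eqI_enum:
  assumes "monomial f" "well_typed f" "monomial g" "well_typed g" "src f = src g" "tgt f = tgt g"
    and "\<forall>x\<in>set (List.n_lists (src f) [True, False]). \<forall>y\<in>set (List.n_lists (tgt f) [True, False]).
      term_matrix f x y = term_matrix g x y"
  shows "par_functor t f = par_functor t g"
proof (rule par_functor_eqI'[OF assms(1-6)])
  have UNIV: "set [True, False] = UNIV" by auto
  show "term_matrix f x y = term_matrix g x y" if "length x = src f" "length y = tgt f" for x y
    using assms(7) that unfolding set_n_lists UNIV by blast
qed

lemma n_lists_small:
  "List.n_lists (Suc 0) [True, False] = [[True], [False]]"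
  "List.n_lists 2 [True, False] = [[True, True], [False, True], [True, False], [False, False]]"
  "List.n_lists 3 [True, False] =
    [[True, True, True], [False, True, True], [True, False, True], [False, False, True],
     [True, True, False], [False, True, False], [True, False, False], [False, False, False]]"
  by (simp_all add: numeral_2_eq_2 numeral_3_eq_3)

lemma term_matrix_comp_delta:
  assumes "\<And>z. length z = src f \<Longrightarrow> term_matrix g x z = of_bool (z = w)" "length w = src f"
  shows "term_matrix (f \<bullet> g) x y = term_matrix f w y"
proof -
  have "term_matrix (f \<bullet> g) x y = (\<Sum>z | length z = src f. if z = w then term_matrix f z y else 0)"
    by (auto simp: assms(1) intro!: sum.cong)
  then show ?thesis using assms(2) by (simp add: finite_length_eq)
qed

text \<open>Rows of permutation matrices are followed through the composite instead of summing over
  two middle rows; both sides reverse three labels.\<close>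

lemma term_matrix_braid:
  fixes x y :: "bool list"
  assumes "length x = 3" "length y = 3"
  defines "L \<equiv> Swap \<otimes>\<^sub>t Id 1 :: 'a rb_term" and "R \<equiv> Id 1 \<otimes>\<^sub>t Swap :: 'a rb_term"
  shows "term_matrix (L \<bullet> R \<bullet> L) x y = of_bool (y = rev x)"
    "term_matrix (R \<bullet> L \<bullet> R) x y = of_bool (y = rev x)"
proof -
  have src: "src L = 3" "src R = 3" "src (L \<bullet> f) = src f" "src (R \<bullet> f) = src f" for f
    by (simp_all add: L_def R_def)
  obtain a b c where x: "x = [a, b, c]" using list_lengthD(5)[OF assms(1)] by blast
  have L: "term_matrix L [a, b, c] z = of_bool (z = [b, a, c])" if "length z = 3" for z a b c
    using list_lengthD(5)[OF that] by (auto simp: L_def)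
  have R: "term_matrix R [a, b, c] z = of_bool (z = [a, c, b])" if "length z = 3" for z a b c
    using list_lengthD(5)[OF that] by (auto simp: R_def)
  have RL: "term_matrix (R \<bullet> L) [a, b, c] z = of_bool (z = [b, c, a])" if "length z = 3" for z
    by (subst term_matrix_comp_delta[where w = "[b, a, c]"]) (use that L R src in auto)
  have LR: "term_matrix (L \<bullet> R) [a, b, c] z = of_bool (z = [c, a, b])" if "length z = 3" for z
    by (subst term_matrix_comp_delta[where w = "[a, c, b]"]) (use that L R src in auto)
  show "term_matrix (L \<bullet> R \<bullet> L) x y = of_bool (y = rev x)"
    unfolding x by (subst term_matrix_comp_delta[where w = "[b, c, a]"]) (use assms(2) RL L src in auto)
  show "term_matrix (R \<bullet> L \<bullet> R) x y = of_bool (y = rev x)"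
    unfolding x by (subst term_matrix_comp_delta[where w = "[c, a, b]"]) (use assms(2) LR R src in auto)
qed

lemma pm_scale_plus: "pm_scale (a + b) f = pm_scale a f + pm_scale b f"
  by (rule poly_mapping_eqI) (simp only: lookup_add lookup_pm_scale distrib_right)

lemma pm_scale_mult: "pm_scale (a * b) f = pm_scale a (pm_scale b f)"
  by (rule poly_mapping_eqI) (simp only: lookup_pm_scale mult.assoc)

lemma pm_scale_uminus: "f + pm_scale (- 1) f = 0"
  by (rule poly_mapping_eqI) (simp only: lookup_add lookup_pm_scale lookup_zero, simp)

theorem rb_eq_par_functor: "rb_eq t f g \<Longrightarrow> par_functor t f = par_functor t g"
proof (induction rule: rb_eq.induct)
  \<comment> \<open>The image of a tensor product depends on the source and target of its left
    factor, so these must be known to agree.\<close>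
  case (tens_cong f f' g g')
  then show ?case using rb_eq_typed by fastforce
next
  case (comp_assoc f g h)
  then show ?case
    using par_comp_assoc[of "par_functor t f" "src f" "tgt f" "par_functor t g" "src g"
        "par_functor t h" "src h" t] keys_par_functor[of f t] keys_par_functor[of g t]
      keys_par_functor[of h t] by simp
next
  case (comp_id_left f)
  then show ?case using par_comp_id(1)[OF keys_par_functor, of f t t] by (simp add: id_diagram_def)
next
  case (comp_id_right f)
  then show ?case using par_comp_id(2)[OF keys_par_functor, of f t t] by (simp add: id_diagram_def)
next
  case (plus_assoc f g h)
  then show ?case by (simp add: add.assoc)
next
  case (plus_commute f g)
  then show ?case by (simp add: add.commute)
next
  case (plus_neg f)
  show ?case by (simp only: par_functor.simps pm_scale_uminus)
next
  case (scale_plus f g a)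
  then show ?case by (simp add: pm_scale_add)
next
  case (scale_add f a b)
  show ?case by (simp only: par_functor.simps pm_scale_plus)
next
  case (scale_scale f a b)
  show ?case by (simp only: par_functor.simps pm_scale_mult)
next
  case (scale_one f)
  show ?case by (simp only: par_functor.simps pm_scale_1)
next
  case (tens_assoc f g h)
  show ?case by (simp add: par_tensor_assoc)
next
  case (tens_unit_left f)
  show ?case by (simp add: par_tensor_unit)
next
  case (tens_unit_right f)
  show ?case by (simp add: par_tensor_unit)
next
  case (tens_id k l)
  show ?case
  proof (rule par_functor_eqI')
    fix x y :: "bool list"
    show "term_matrix (Id k \<otimes>\<^sub>t Id l :: 'a rb_term) x y = term_matrix (Id (k + l) :: 'a rb_term) x y"
      by simp (metis append_take_drop_id)
  qed auto
next
  case (interchange f g f' g')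
  then show ?case
    using par_interchange[of "par_functor t f" "src f" "tgt f" "par_functor t g" "src g"
        "par_functor t f'" "src f'" "tgt f'" "par_functor t g'" "src g'" t]
      keys_par_functor[of f t] keys_par_functor[of g t] keys_par_functor[of f' t]
      keys_par_functor[of g' t] by simp
next
  case braid
  show ?case
  proof (rule par_functor_eqI')
    fix x y :: "bool list"
    assume "length x = src ((Swap \<otimes>\<^sub>t Id 1) \<bullet> (Id 1 \<otimes>\<^sub>t Swap) \<bullet> (Swap \<otimes>\<^sub>t Id 1) :: 'a rb_term)"
      "length y = tgt ((Swap \<otimes>\<^sub>t Id 1) \<bullet> (Id 1 \<otimes>\<^sub>t Swap) \<bullet> (Swap \<otimes>\<^sub>t Id 1) :: 'a rb_term)"
    then have "length x = 3" "length y = 3" by auto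
    from term_matrix_braid[OF this, where 'a = 'a]
    show "term_matrix ((Swap \<otimes>\<^sub>t Id 1) \<bullet> (Id 1 \<otimes>\<^sub>t Swap) \<bullet> (Swap \<otimes>\<^sub>t Id 1) :: 'a rb_term) x y =
        term_matrix ((Id 1 \<otimes>\<^sub>t Swap) \<bullet> (Swap \<otimes>\<^sub>t Id 1) \<bullet> (Id 1 \<otimes>\<^sub>t Swap) :: 'a rb_term) x y"
      by simp
  qed auto
next
  case cap_cup
  have "par_functor t (Cap \<bullet> Cup) = pm_scale (t ^ 1) (par_functor t (Id 0))"
    by (rule par_functor_eqI) (auto simp: matrix_simps)
  then show ?case by simp
next
  case cap_eta_eta
  have "par_functor t (Cap \<bullet> (Eta \<otimes>\<^sub>t Eta)) = pm_scale (t ^ 1) (par_functor t (Id 0))"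
    by (rule par_functor_eqI) (auto simp: matrix_simps)
  then show ?case by simp
next
  case eps_eps_cup
  have "par_functor t ((Eps \<otimes>\<^sub>t Eps) \<bullet> Cup) = pm_scale (t ^ 1) (par_functor t (Id 0))"
    by (rule par_functor_eqI) (auto simp: matrix_simps)
  then show ?case by simp
next
  case eps_eta
  have "par_functor t (Eps \<bullet> Eta) = pm_scale (t ^ 1) (par_functor t (Id 0))"
    by (rule par_functor_eqI) (auto simp: matrix_simps)
  then show ?case by simp
\<comment> \<open>What remains are the defining relations without a factor \<open>t\<close>, by
  enumeration, and the congruence and linearity rules.\<close>
qed ((rule par_functor_eqI_enum; simp add: n_lists_small matrix_simps; fail) |
    (auto simp: par_comp_add par_comp_scale par_tensor_add par_tensor_scale)[1])+

section \<open>Matrices of normal forms\<close>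

text \<open>The labellings that are constant on the pairs which the code joins. Deleting the
  partner's label keeps later indices relative to the remaining positions.\<close>

fun code_compatible :: "code \<Rightarrow> bool list \<Rightarrow> bool" where
  "code_compatible [] y \<longleftrightarrow> True"
| "code_compatible (None # c) y \<longleftrightarrow> code_compatible c (tl y)"
| "code_compatible (Some j # c) y \<longleftrightarrow>
    hd y = tl y ! j \<and> code_compatible c (take j (tl y) @ drop (Suc j) (tl y))"

lemma sum_length_append':
  fixes F :: "bool list \<Rightarrow> nat"
  shows "(\<Sum>z | length z = k + k'. F z) = (\<Sum>u | length u = k. \<Sum>v | length v = k'. F (u @ v))"
  using sum_length_append[of "\<lambda>u v. F (u @ v)" k k'] by simp

lemma sum_length_delta:
  fixes F :: "bool list \<Rightarrow> nat"
  assumes "length w = n"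
  shows "(\<Sum>z | length z = n. of_bool (z = w) * F z) = F w"
proof -
  have "(\<Sum>z | length z = n. of_bool (z = w) * F z) = (\<Sum>z | length z = n. if z = w then F z else 0)"
    by (rule sum.cong) auto
  then show ?thesis using assms by (simp add: finite_length_eq)
qed

text \<open>The idle strands contribute identity matrices, which collapse the sum over the middle
  row to the part under \<open>f\<close>.\<close>

lemma term_matrix_act_term:
  assumes "a + src f \<le> tgt w" "length y = tgt (act_term a f w)"
  shows "term_matrix (act_term a f w) x y = (\<Sum>v | length v = src f.
    term_matrix f v (take (tgt f) (drop a y)) * term_matrix w x (take a y @ v @ drop (a + tgt f) y))"
proof -
  define b where "b = tgt w - (a + src f)"
  have y: "length y = a + (tgt f + b)"
    using assms(2) by (simp add: act_term_def b_def)
  have "term_matrix (act_term a f w) x y =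
      (\<Sum>z | length z = a + (src f + b). term_matrix (slice a f b) z y * term_matrix w x z)"
    by (simp add: act_term_def b_def)
  also have "\<dots> = (\<Sum>u | length u = a. \<Sum>v | length v = src f. \<Sum>q | length q = b.
      term_matrix (slice a f b) (u @ v @ q) y * term_matrix w x (u @ v @ q))"
    by (simp add: sum_length_append')
  also have "\<dots> = (\<Sum>u | length u = a. \<Sum>v | length v = src f. \<Sum>q | length q = b.
      of_bool (u = take a y) * (of_bool (q = drop (a + tgt f) y) *
        (term_matrix f v (take (tgt f) (drop a y)) * term_matrix w x (u @ v @ q))))"
    by (intro sum.cong HOL.refl) (auto simp: slice_def add.commute)
  also have "\<dots> = (\<Sum>u | length u = a. of_bool (u = take a y) * (\<Sum>v | length v = src f.
      \<Sum>q | length q = b. of_bool (q = drop (a + tgt f) y) *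
        (term_matrix f v (take (tgt f) (drop a y)) * term_matrix w x (u @ v @ q))))"
    by (simp only: sum_distrib_left)
  also have "\<dots> = (\<Sum>v | length v = src f. \<Sum>q | length q = b. of_bool (q = drop (a + tgt f) y) *
        (term_matrix f v (take (tgt f) (drop a y)) * term_matrix w x (take a y @ v @ q)))"
    by (rule sum_length_delta) (simp add: y)
  also have "\<dots> = (\<Sum>v | length v = src f.
      term_matrix f v (take (tgt f) (drop a y)) * term_matrix w x (take a y @ v @ drop (a + tgt f) y))"
    by (intro sum.cong HOL.refl sum_length_delta) (simp add: y)
  finally show ?thesis .
qed

lemma term_matrix_act_Swap:
  assumes "i + 2 \<le> tgt w" "length y = tgt w"
  shows "term_matrix (act_term i Swap w) x y =
    term_matrix w x (take i y @ rev (take 2 (drop i y)) @ drop (i + 2) y)"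
proof -
  have "term_matrix (act_term i Swap w) x y = (\<Sum>v | length v = 2. of_bool (v = rev (take 2 (drop i y))) *
      term_matrix w x (take i y @ v @ drop (i + 2) y))"
    using assms by (subst term_matrix_act_term) (auto simp: act_term_typed rev_swap intro!: sum.cong)
  also have "\<dots> = term_matrix w x (take i y @ rev (take 2 (drop i y)) @ drop (i + 2) y)"
    by (rule sum_length_delta) (use assms in simp)
  finally show ?thesis .
qed

text \<open>Going back through the push, the label \<open>b\<close> returns across \<open>us\<close>
  to the right leg of the leftmost cup.\<close>

lemma term_matrix_push_term:
  assumes "well_typed w" "monomial w" "length us = j" "tgt w = Suc (Suc (j + length vs))"
  shows "term_matrix (push_term j w) x (h # us @ b # vs) = term_matrix w x (h # b # us @ vs)"
  using assms(3,4)
proof (induction j arbitrary: us vs)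
  case (Suc j)
  obtain us' c where us: "us = us' @ [c]" "length us' = j"
    using Suc.prems(1) by (cases us rule: rev_cases) auto
  have "term_matrix (push_term (Suc j) w) x (h # us @ b # vs) =
      term_matrix (push_term j w) x (take (Suc j) (h # us @ b # vs) @
        rev (take 2 (drop (Suc j) (h # us @ b # vs))) @ drop (Suc j + 2) (h # us @ b # vs))"
    unfolding push_term.simps
    by (rule term_matrix_act_Swap) (use Suc.prems assms us in \<open>simp_all add: push_term_typed\<close>)
  also have "take (Suc j) (h # us @ b # vs) = h # us'" using us by simp
  also have "take 2 (drop (Suc j) (h # us @ b # vs)) = [c, b]" using us by (simp add: numeral_2_eq_2)
  also have "drop (Suc j + 2) (h # us @ b # vs) = vs" using us by simp
  also have "term_matrix (push_term j w) x ((h # us') @ rev [c, b] @ vs) =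
      term_matrix (push_term j w) x (h # us' @ b # c # vs)" by simp
  also have "\<dots> = term_matrix w x (h # b # us' @ c # vs)"
    by (rule Suc.IH) (use Suc.prems us in auto)
  finally show ?case using us by simp
qed simp

lemma term_matrix_normal_form:
  "code_valid c \<Longrightarrow> length y = code_size c \<Longrightarrow>
    term_matrix (normal_form c :: 'a rb_term) [] y = of_bool (code_compatible c y)"
proof (induction c arbitrary: y rule: code_size.induct)
  case (2 c)
  have "term_matrix (normal_form (None # c) :: 'a rb_term) [] y =
      term_matrix (normal_form c :: 'a rb_term) [] (tl y)"
    using 2 normal_form_typed[of c, where 'a = 'a]
    by (simp add: term_matrix_act_term act_term_typed drop_Suc)
  also have "\<dots> = of_bool (code_compatible c (tl y))" by (rule 2) (use 2 in auto)
  finally show ?case by simp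
next
  case (3 j c)
  note typed = normal_form_typed[of c, where 'a = 'a]
  obtain h r where y: "y = h # r" "length r = Suc (code_size c)" using 3 by (cases y) auto
  have r: "r = take j r @ r ! j # drop (Suc j) r" using 3 y by (simp add: id_take_nth_drop)
  have "term_matrix (normal_form (Some j # c) :: 'a rb_term) [] y =
      term_matrix (act_term 0 Cup (normal_form c :: 'a rb_term)) [] (h # r ! j # take j r @ drop (Suc j) r)"
    unfolding y(1) normal_form.simps
    by (subst r, rule term_matrix_push_term) (use 3 y typed in \<open>auto simp: act_term_typed\<close>)
  also have "\<dots> = of_bool (h = r ! j) * term_matrix (normal_form c :: 'a rb_term) [] (take j r @ drop (Suc j) r)"
    using 3 y typed by (simp add: term_matrix_act_term act_term_typed numeral_2_eq_2)
  also have "term_matrix (normal_form c :: 'a rb_term) [] (take j r @ drop (Suc j) r) =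
      of_bool (code_compatible c (take j r @ drop (Suc j) r))"
    by (rule 3) (use 3 y in auto)
  finally show ?case by (simp add: y)
qed simp

text \<open>Nested caps join the i-th position from the left to the i-th from the right, hence the
  reversal.\<close>

lemma term_matrix_caps:
  "length z = k + k \<Longrightarrow> term_matrix (caps k :: 'a rb_term) z [] = of_bool (drop k z = rev (take k z))"
proof (induction k arbitrary: z)
  case (Suc k)
  obtain h m e where z: "z = h # m @ [e]" "length m = k + k"
  proof -
    obtain h z' where "z = h # z'" "length z' = Suc (k + k)" using Suc.prems by (cases z) auto
    then show thesis using that by (cases z' rule: rev_cases) auto
  qed
  have "term_matrix (caps (Suc k) :: 'a rb_term) z [] = (\<Sum>v | length v = 2.
      of_bool (v ! 0 = v ! 1) * term_matrix (slice 1 (caps k :: 'a rb_term) 1) z v)"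
    by (simp add: caps_typed)
  also have "\<dots> = (\<Sum>v | length v = 2. of_bool (v = [h, e]) *
      (of_bool (v ! 0 = v ! 1) * term_matrix (caps k :: 'a rb_term) m []))"
    by (rule sum.cong) (use z in \<open>auto simp: slice_def dest!: list_lengthD\<close>)
  also have "\<dots> = of_bool (h = e) * term_matrix (caps k :: 'a rb_term) m []"
    by (subst sum_length_delta) auto
  finally show ?case using z Suc.IH[of m] by auto
qed auto

text \<open>The incoming strands carry \<open>x\<close>, and the nested caps pass it on reversed:
  only the middle row \<open>x @ rev x\<close> under the caps contributes.\<close>

lemma term_matrix_unbend:
  fixes w :: "'a rb_term"
  assumes "well_typed w" "src w = 0" "tgt w = k + l" "monomial w" "length x = k" "length y = l"
  shows "term_matrix (unbend k w) x y = term_matrix w [] (rev x @ y)"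
proof -
  have inner: "term_matrix (act_term k w (Id k)) x z = term_matrix w [] (drop k z) * of_bool (take k z = x)"
    if "length z = k + (k + l)" for z
    using assms that by (subst term_matrix_act_term) (auto simp: act_term_typed)
  have "term_matrix (unbend k w) x y = (\<Sum>v | length v = k + k.
      term_matrix (caps k :: 'a rb_term) v [] * term_matrix (act_term k w (Id k)) x (v @ y))"
    unfolding unbend_def using assms
    by (subst term_matrix_act_term) (auto simp: act_term_typed)
  also have "\<dots> = (\<Sum>v | length v = k + k. of_bool (v = x @ rev x) * term_matrix w [] (drop k v @ y))"
  proof (rule sum.cong)
    fix v :: "bool list" assume "v \<in> {v. length v = k + k}"
    then have v: "length v = k + k" by simp
    have "v = x @ rev x \<longleftrightarrow> take k v = x \<and> drop k v = rev (take k v)"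
      using assms(5) by (metis append_eq_conv_conj append_take_drop_id)
    then show "term_matrix (caps k :: 'a rb_term) v [] * term_matrix (act_term k w (Id k)) x (v @ y) =
        of_bool (v = x @ rev x) * term_matrix w [] (drop k v @ y)"
      using v assms(6) by (cases "take k v = x") (simp_all add: term_matrix_caps inner)
  qed simp
  also have "\<dots> = term_matrix w [] (rev x @ y)"
    by (subst sum_length_delta) (use assms in auto)
  finally show ?thesis .
qed

section \<open>Codes and rook-Brauer diagrams\<close>

lemma nth_Cons_replicate: "j \<le> n \<Longrightarrow> (False # replicate n False) ! j \<longleftrightarrow> False"
  by (cases j) auto

lemma code_compatible_False: "code_valid c \<Longrightarrow> code_compatible c (replicate (code_size c) False)"
proof (induction c rule: code_size.induct)
  case (3 j c)
  have tl: "tl (replicate (code_size (Some j # c)) False) = replicate (Suc (code_size c)) False" by simp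
  have "take j (replicate (Suc (code_size c)) False) @ drop (Suc j) (replicate (Suc (code_size c)) False) =
      replicate (code_size c) False"
    unfolding take_replicate drop_replicate replicate_add[symmetric] using 3 by simp
  moreover have "replicate (Suc (code_size c)) False ! j = False"
    using 3 by (simp add: nth_Cons_replicate)
  ultimately show ?case
    unfolding code_compatible.simps tl using 3 by (simp del: replicate_Suc)
qed auto

text \<open>Sparse test rows tell codes apart: a single True at the far left separates
  \<open>None\<close> from \<open>Some\<close>, and a second True locates the partner.\<close>

lemma code_compatible_inject:
  assumes "code_valid c" "code_valid c'" "code_size c = code_size c'"
    and "\<And>y. length y = code_size c \<Longrightarrow> code_compatible c y \<longleftrightarrow> code_compatible c' y"
  shows "c = c'"
  using assms
proof (induction c arbitrary: c' rule: code_size.induct)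
  case 1
  then show ?case by (cases c' rule: code_size.cases) auto
next
  case (2 c)
  show ?case
  proof (cases c' rule: code_size.cases)
    case 1
    then show ?thesis using 2 by simp
  next
    case (2 d)
    have "c = d"
      using "2.prems" 2 "2.prems"(4)[of "False # _"] by (intro "2.IH") auto
    then show ?thesis using 2 by simp
  next
    case (3 j d)
    \<comment> \<open>A lone True is allowed at an isolated position but not at a joined
      one.\<close>
    have "code_compatible (None # c) (True # replicate (code_size c) False)"
      using code_compatible_False "2.prems" by simp
    then have "code_compatible c' (True # replicate (code_size c) False)"
      using "2.prems"(4)[of "True # replicate (code_size c) False"] by simp
    then show ?thesis using 3 "2.prems"(1-3) by (simp add: nth_Cons_replicate)
  qed
next
  case (3 j c)
  show ?case
  proof (cases c' rule: code_size.cases)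
    case 1
    then show ?thesis using 3 by simp
  next
    case (2 d)
    have "code_compatible c' (True # replicate (code_size d) False)"
      using code_compatible_False[of d] 2 "3.prems"(2) by simp
    then have "code_compatible (Some j # c) (True # replicate (code_size d) False)"
      using "3.prems"(3) "3.prems"(4)[of "True # replicate (code_size d) False"] 2 by simp
    then show ?thesis using 2 "3.prems"(1-3) by (simp add: nth_Cons_replicate)
  next
    case (3 i d)
    have size: "code_size d = code_size c" using "3.prems"(3) 3 by simp
    \<comment> \<open>True exactly at the leftmost position and at its partner under
      \<open>Some j\<close>; compatibility with \<open>Some i\<close> then forces
      \<open>i = j\<close>.\<close>
    let ?y = "True # replicate j False @ True # replicate (code_size c - j) False"
    have "code_compatible (Some j # c) ?y"
      using code_compatible_False[of c] "3.prems" by (simp add: nth_append flip: replicate_add)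
    then have "code_compatible c' ?y" using "3.prems"(1) "3.prems"(4)[of ?y] by simp
    then have "i = j"
      using 3 "3.prems"(1,2) size by (auto simp: nth_append nth_Cons' split: if_splits)
    \<comment> \<open>The row \<open>y\<close> is completed by False at the leftmost position and at
      its partner.\<close>
    have "code_compatible c y \<longleftrightarrow> code_compatible d y" if "length y = code_size c" for y
      using "3.prems"(1) "3.prems"(4)[of "False # take j y @ False # drop j y"] 3 \<open>i = j\<close> that
      by (simp add: nth_append)
    then have "c = d" using "3.prems" 3 size by (intro "3.IH") auto
    then show ?thesis using 3 \<open>i = j\<close> by simp
  qed
qed

text \<open>The analogue of \<open>compatible\<close> for functions on any set of vertices, needed
  because the inductions below remove vertices one block at a time.\<close>

definition constant_on_blocks :: "'v set set \<Rightarrow> ('v \<Rightarrow> 'b) \<Rightarrow> bool" where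
  "constant_on_blocks P g \<longleftrightarrow> (\<forall>B\<in>P. \<forall>u\<in>B. \<forall>v\<in>B. g u = g v)"

lemma constant_on_blocks_insert:
  "constant_on_blocks (insert B P) g \<longleftrightarrow> (\<forall>u\<in>B. \<forall>v\<in>B. g u = g v) \<and> constant_on_blocks P g"
  unfolding constant_on_blocks_def by blast

lemma partition_on_insert_block:
  assumes "partition_on A P" "B \<noteq> {}" "B \<inter> A = {}"
  shows "partition_on (B \<union> A) (insert B P)"
proof -
  have "disjnt B (\<Union>P)" using assms partition_onD1[OF assms(1)] by (simp add: disjnt_def)
  moreover have "B \<union> A - B = A" using assms by blast
  ultimately show ?thesis using assms partition_on_insert[of B P "B \<union> A"] by auto
qed

text \<open>Each entry of the code contributes one block of one or two elements, and constancy on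
  that block is the test made at this entry.\<close>

lemma code_partition:
  assumes "code_valid c" "distinct xs" "length xs = code_size c"
  shows "\<exists>P. partition_on (set xs) P \<and> (\<forall>B\<in>P. card B \<le> 2) \<and>
    (\<forall>g. code_compatible c (map g xs) \<longleftrightarrow> constant_on_blocks P g)"
  using assms
proof (induction c arbitrary: xs rule: code_size.induct)
  case 1
  then show ?case by (intro exI[of _ "{}"]) (auto simp: partition_on_def constant_on_blocks_def)
next
  case (2 c)
  obtain x ys where xs: "xs = x # ys" using 2 by (cases xs) auto
  obtain P where P: "partition_on (set ys) P" "\<forall>B\<in>P. card B \<le> 2"
    "\<forall>g. code_compatible c (map g ys) \<longleftrightarrow> constant_on_blocks P g"
    using "2.IH"[of ys] "2.prems" xs by auto
  have "partition_on ({x} \<union> set ys) (insert {x} P)"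
    by (rule partition_on_insert_block[OF P(1)]) (use "2.prems" xs in auto)
  with P xs show ?case
    by (intro exI[of _ "insert {x} P"]) (simp add: constant_on_blocks_insert)
next
  case (3 j c)
  obtain x ys where xs: "xs = x # ys" "length ys = Suc (code_size c)" using 3 by (cases xs) auto
  have j: "j < length ys" using 3 xs by simp
  define us vs where "us = take j ys" and "vs = drop (Suc j) ys"
  have ys: "ys = us @ ys ! j # vs" using j by (simp add: id_take_nth_drop us_def vs_def)
  have dist: "distinct (us @ vs)" "ys ! j \<notin> set (us @ vs)" "x \<notin> set (us @ vs)" "x \<noteq> ys ! j"
  proof -
    have "distinct (x # us @ ys ! j # vs)" using "3.prems"(2) xs ys by metis
    then show "distinct (us @ vs)" "ys ! j \<notin> set (us @ vs)" "x \<notin> set (us @ vs)" "x \<noteq> ys ! j" by auto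
  qed
  obtain P where P: "partition_on (set (us @ vs)) P" "\<forall>B\<in>P. card B \<le> 2"
    "\<forall>g. code_compatible c (map g (us @ vs)) \<longleftrightarrow> constant_on_blocks P g"
    using "3.IH"[OF _ dist(1)] "3.prems" xs j us_def vs_def by auto
  have "partition_on ({x, ys ! j} \<union> set (us @ vs)) (insert {x, ys ! j} P)"
    by (rule partition_on_insert_block[OF P(1)]) (use dist in auto)
  moreover have "{x, ys ! j} \<union> set (us @ vs) = set xs"
  proof -
    have "set xs = insert x (set (us @ ys ! j # vs))" using xs ys by simp
    then show ?thesis by auto
  qed
  moreover have "code_compatible (Some j # c) (map g xs) \<longleftrightarrow> constant_on_blocks (insert {x, ys ! j} P) g" for g
  proof -
    have "code_compatible (Some j # c) (map g xs) \<longleftrightarrow> g x = g (ys ! j) \<and> code_compatible c (map g (us @ vs))"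
      using j by (simp add: xs(1) us_def vs_def take_map drop_map)
    then show ?thesis using P(3) by (auto simp: constant_on_blocks_insert)
  qed
  moreover have "card {x, ys ! j} \<le> 2" using card_insert_le_m1[of 2 "{ys ! j}" x] by simp
  ultimately show ?case using P(2) by (intro exI[of _ "insert {x, ys ! j} P"]) auto
qed

text \<open>The block of the first vertex has one or two elements, which decides between
  \<open>None\<close> and \<open>Some\<close>; the number of vertices before its partner is the
  index.\<close>

lemma partition_code:
  assumes "partition_on (set xs) P" "\<forall>B\<in>P. card B \<le> 2" "distinct xs"
  shows "\<exists>c. code_valid c \<and> code_size c = length xs \<and>
    (\<forall>g. code_compatible c (map g xs) \<longleftrightarrow> constant_on_blocks P g)"
  using assms
proof (induction "length xs" arbitrary: xs P rule: less_induct)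
  case less
  show ?case
  proof (cases xs)
    case Nil
    then have "P = {}" using less.prems(1) by (simp add: partition_on_empty)
    then show ?thesis using Nil by (intro exI[of _ "[]"]) (simp add: constant_on_blocks_def)
  next
    case (Cons x ys)
    have "x \<in> \<Union>P" using less.prems(1) Cons by (simp add: partition_on_def)
    then obtain B where B: "B \<in> P" "x \<in> B" by blast
    define Q where "Q = P - {B}"
    have P: "P = insert B Q" "B \<notin> Q" using B by (auto simp: Q_def)
    have Bsub: "B \<subseteq> set xs" using B less.prems(1) by (auto simp: partition_on_def)
    have "disjnt B (\<Union>Q)"
    proof -
      have "B \<inter> C = {}" if "C \<in> Q" for C
        using that B(1) disjointD[OF partition_onD2[OF less.prems(1)], of B C] by (auto simp: Q_def)
      then show ?thesis by (auto simp: disjnt_def)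
    qed
    then have Q: "partition_on (set xs - B) Q" "\<forall>B\<in>Q. card B \<le> 2"
      using partition_on_insert[of B Q "set xs"] less.prems P by auto
    have fin: "finite B" using Bsub finite_subset by blast
    show ?thesis
    proof (cases "B = {x}")
      case True
      have "set xs - B = set ys" using True less.prems(3) Cons by auto
      then obtain c where c: "code_valid c" "code_size c = length ys"
        "\<forall>g. code_compatible c (map g ys) \<longleftrightarrow> constant_on_blocks Q g"
        using less.hyps[of ys Q] Q less.prems(3) Cons by auto
      then show ?thesis
        using Cons True P
        by (intro exI[of _ "None # c"]) (simp add: constant_on_blocks_insert)
    next
      case False
      then obtain y where y: "y \<in> B" "y \<noteq> x" using B by blast
      then have "card {x, y} = 2" "{x, y} \<subseteq> B" using B by auto
      then have Bxy: "B = {x, y}"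
        using card_subset_eq[OF fin, of "{x, y}"] less.prems(2) B(1) card_mono[OF fin, of "{x, y}"]
        by (metis le_antisym)
      obtain us vs where ys: "ys = us @ y # vs"
        using y Bsub Cons split_list[of y ys] by auto
      have dist: "distinct (us @ vs)" using less.prems(3) Cons ys by auto
      have "set xs - B = set (us @ vs)" using Bxy less.prems(3) Cons ys by auto
      then obtain c where c: "code_valid c" "code_size c = length (us @ vs)"
        "\<forall>g. code_compatible c (map g (us @ vs)) \<longleftrightarrow> constant_on_blocks Q g"
        using less.hyps[of "us @ vs" Q] Q dist Cons ys by auto
      have "code_compatible (Some (length us) # c) (map g xs) \<longleftrightarrow> constant_on_blocks P g" for g
      proof -
        have "code_compatible (Some (length us) # c) (map g xs) \<longleftrightarrow>
            g x = g y \<and> code_compatible c (map g (us @ vs))"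
          by (simp add: Cons ys nth_append)
        then show ?thesis using c(3) by (auto simp: P(1) Bxy constant_on_blocks_insert)
      qed
      then show ?thesis
        using c Cons ys by (intro exI[of _ "Some (length us) # c"]) simp
    qed
  qed
qed

text \<open>Vertices in the order of the outputs of the bent diagram: bending turns the bottom row
  around.\<close>

definition vertex_list :: "nat \<Rightarrow> nat \<Rightarrow> vertex list" where
  "vertex_list k l = rev (map Bot [1..<Suc k]) @ map Top [1..<Suc l]"

lemma vertex_list:
  "set (vertex_list k l) = vertices k l" "distinct (vertex_list k l)" "length (vertex_list k l) = k + l"
  by (auto simp: vertex_list_def vertices_def distinct_map inj_on_def)

lemma map_vertex_list:
  assumes "length x = k" "length y = l"
  shows "map (label x y) (vertex_list k l) = rev x @ y"
proof -
  have "map (\<lambda>i. z ! (i - 1)) [1..<Suc (length z)] = z" for z :: "bool list"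
    by (rule nth_equalityI) (auto simp del: upt_Suc)
  from this[of x] this[of y] show ?thesis using assms by (simp add: vertex_list_def rev_map o_def del: upt_Suc) (metis rev_map)
qed

lemma compatible_iff: "compatible D x y \<longleftrightarrow> constant_on_blocks D (label x y)"
  unfolding compatible_def constant_on_blocks_def ..

lemma code_diagram:
  fixes t :: "'a::{comm_ring,comm_monoid_mult}"
  assumes "code_valid c" "code_size c = k + l"
  obtains D where "D \<in> rook_brauer_diagrams k l"
    "par_functor t (unbend k (normal_form c)) = single D 1"
    "\<And>x y. length x = k \<Longrightarrow> length y = l \<Longrightarrow> compatible D x y \<longleftrightarrow> code_compatible c (rev x @ y)"
proof -
  obtain D where D: "partition_on (vertices k l) D" "\<forall>B\<in>D. card B \<le> 2"
    "\<forall>g. code_compatible c (map g (vertex_list k l)) \<longleftrightarrow> constant_on_blocks D g"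
    using code_partition[OF assms(1) vertex_list(2)[of k l]] vertex_list(1,3)[of k l] assms(2) by auto
  have RB: "D \<in> rook_brauer_diagrams k l"
    using D(1,2) by (simp add: rook_brauer_diagrams_def partitions_iff)
  have compat: "compatible D x y \<longleftrightarrow> code_compatible c (rev x @ y)" if "length x = k" "length y = l" for x y
    using D(3) map_vertex_list[OF that] by (metis compatible_iff)
  note nf = normal_form_typed[OF assms(1), where 'a = 'a]
  note u = unbend_typed[OF nf(1,2) _ nf(4), of k l]
  obtain E a where E: "E \<in> partitions k l"
    "par_functor t (unbend k (normal_form c)) = single E (t ^ a)"
    "\<And>x y. length x = k \<Longrightarrow> length y = l \<Longrightarrow>
      term_matrix (unbend k (normal_form c) :: 'a rb_term) x y = 2 ^ a * diagram_matrix E x y"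
    using par_functor_monomial[of "unbend k (normal_form c)" t] u nf(3) assms(2) by metis
  \<comment> \<open>A normal form has only entries 0 and 1, so the exponent \<open>a\<close> is
    0.\<close>
  have "2 ^ a * diagram_matrix E x y = 2 ^ 0 * diagram_matrix D x y" if "length x = k" "length y = l" for x y
    using E(3)[OF that] compat[OF that] term_matrix_unbend[OF nf(1,2) _ nf(4) that]
      term_matrix_normal_form[OF assms(1), of "rev x @ y", where 'a = 'a] nf(3) assms(2) that
    by (simp add: diagram_matrix_def)
  from scaled_diagram_matrix_eqD[OF E(1) _ this] have "E = D" "a = 0"
    using RB by (auto simp: rook_brauer_diagrams_def)
  then show thesis using that[OF RB] E(2) compat by simp
qed

lemma diagram_code:
  fixes t :: "'a::{comm_ring,comm_monoid_mult}"
  assumes "D \<in> rook_brauer_diagrams k l"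
  obtains c where "code_valid c" "code_size c = k + l"
    "par_functor t (unbend k (normal_form c)) = single D 1"
proof -
  have D: "D \<in> partitions k l" "\<forall>B\<in>D. card B \<le> 2" using assms by (auto simp: rook_brauer_diagrams_def)
  obtain c where c: "code_valid c" "code_size c = k + l"
    "\<forall>g. code_compatible c (map g (vertex_list k l)) \<longleftrightarrow> constant_on_blocks D g"
    using partition_code[of "vertex_list k l" D] D vertex_list[of k l] by (auto simp: partitions_iff)
  obtain E where E: "E \<in> rook_brauer_diagrams k l"
    "par_functor t (unbend k (normal_form c)) = single E 1"
    "\<And>x y. length x = k \<Longrightarrow> length y = l \<Longrightarrow> compatible E x y \<longleftrightarrow> code_compatible c (rev x @ y)"
    using code_diagram[OF c(1,2)] by metis
  have "E = D"
  proof (rule partitions_eqI[of _ k l])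
    show "compatible E x y \<longleftrightarrow> compatible D x y" if "length x = k" "length y = l" for x y
      using E(3)[OF that] c(3) map_vertex_list[OF that] by (metis compatible_iff)
  qed (use E D in \<open>auto simp: rook_brauer_diagrams_def\<close>)
  then show thesis using that c E by blast
qed

lemma code_eqI:
  assumes "code_valid c" "code_size c = k + l" "code_valid c'" "code_size c' = k + l"
    and "\<And>x y. length x = k \<Longrightarrow> length y = l \<Longrightarrow>
      code_compatible c (rev x @ y) \<longleftrightarrow> code_compatible c' (rev x @ y)"
  shows "c = c'"
proof (rule code_compatible_inject)
  show "code_compatible c z \<longleftrightarrow> code_compatible c' z" if "length z = code_size c" for z
    using assms(5)[of "rev (take k z)" "drop k z"] that assms(2) by simp
qed (use assms in auto)

section \<open>Diagrams form a basis\<close>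

lemma scaled_single_eqD:
  assumes "(1::'a::{comm_ring,comm_monoid_mult}) \<noteq> 0"
    and "single D (1::'a) = single E a"
  shows "E = D" "a = 1"
proof -
  have "1 = (if E = D then a else 0)"
    using arg_cong[OF assms(2), of "\<lambda>f. coeff f D"]
    by (simp add: lookup_single when_def)
  then show "E = D" "a = 1" using assms(1) by (metis, metis)
qed

lemma monomial_rb_eq_diagram:
  fixes t :: "'a::{comm_ring,comm_monoid_mult}"
  assumes "monomial f" "f \<in> rb_terms k l"
  obtains D e w where "D \<in> rook_brauer_diagrams k l" "w \<in> rb_terms k l" "monomial w"
    "par_functor t w = single D 1" "rb_eq t f (t ^ e \<odot>\<^sub>t w)"
proof -
  obtain e c where c: "code_valid c" "code_size c = k + l"
    "rb_eq t f (t ^ e \<odot>\<^sub>t unbend k (normal_form c))"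
    using monomial_rb_eq_normal_form[OF assms] by blast
  note nf = normal_form_typed[OF c(1), where 'a = 'a]
  have "unbend k (normal_form c :: 'a rb_term) \<in> rb_terms k l" "monomial (unbend k (normal_form c :: 'a rb_term))"
    using unbend_typed[OF nf(1,2) _ nf(4), of k l] nf(3) c(2) by (auto simp: rb_terms_def)
  moreover obtain D where "D \<in> rook_brauer_diagrams k l"
    "par_functor t (unbend k (normal_form c)) = single D 1"
    using code_diagram[OF c(1,2)] by metis
  ultimately show thesis using that c(3) by blast
qed

text \<open>The functor determines the diagram, the diagram determines the code, and both terms
  equal the normal form of that code.\<close>

lemma monomial_rb_eq_unique:
  fixes t :: "'a::{comm_ring,comm_monoid_mult}"
  assumes nz: "(1::'a) \<noteq> 0"
    and f: "monomial f" "f \<in> rb_terms k l" "par_functor t f = single D 1"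
    and g: "monomial g" "g \<in> rb_terms k l" "par_functor t g = single D 1"
  shows "rb_eq t f g"
proof -
  have nf: "\<exists>c. code_valid c \<and> code_size c = k + l \<and> rb_eq t h (unbend k (normal_form c)) \<and>
      (\<forall>x y. length x = k \<longrightarrow> length y = l \<longrightarrow> compatible D x y = code_compatible c (rev x @ y))"
    if h: "monomial h" "h \<in> rb_terms k l" "par_functor t h = single D 1" for h
  proof -
    obtain e c where c: "code_valid c" "code_size c = k + l"
      "rb_eq t h (t ^ e \<odot>\<^sub>t unbend k (normal_form c))"
      using monomial_rb_eq_normal_form[OF h(1,2)] by blast
    obtain E where E: "par_functor t (unbend k (normal_form c)) = single E 1"
      "\<And>x y. length x = k \<Longrightarrow> length y = l \<Longrightarrow> compatible E x y \<longleftrightarrow> code_compatible c (rev x @ y)"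
      using code_diagram[OF c(1,2)] by metis
    have "single D 1 = single E (t ^ e)"
      using rb_eq_par_functor[OF c(3)] h(3) E(1) by (simp add: pm_scale_single)
    \<comment> \<open>\<open>t\<close> may be 1 or another root of unity, so \<open>e = 0\<close>
      does not follow; \<open>t ^ e = 1\<close> is enough.\<close>
    from scaled_single_eqD[OF nz this] have "E = D" "t ^ e = 1" .
    have "rb_eq t h (1 \<odot>\<^sub>t unbend k (normal_form c))" using c(3) \<open>t ^ e = 1\<close> by simp
    also have "rb_eq t \<dots> (unbend k (normal_form c))"
      by (rule rb_eq.scale_one) (use rb_eq_typed[OF c(3)] in auto)
    finally show ?thesis using c E(2) \<open>E = D\<close> by blast
  qed
  obtain c where c: "code_valid c" "code_size c = k + l" "rb_eq t f (unbend k (normal_form c))"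
    "\<forall>x y. length x = k \<longrightarrow> length y = l \<longrightarrow> compatible D x y = code_compatible c (rev x @ y)"
    using nf[OF f] by blast
  obtain d where d: "code_valid d" "code_size d = k + l" "rb_eq t g (unbend k (normal_form d))"
    "\<forall>x y. length x = k \<longrightarrow> length y = l \<longrightarrow> compatible D x y = code_compatible d (rev x @ y)"
    using nf[OF g] by blast
  have "c = d" by (rule code_eqI[OF c(1,2) d(1,2)]) (use c(4) d(4) in blast)
  with d(3) have "rb_eq t (unbend k (normal_form c)) g" by (simp add: rb_eq.sym)
  with c(3) show ?thesis by (rule rb_eq.trans)
qed

text \<open>The span of the monomials, closed under \<open>rb_eq\<close> so that composites and
  tensor products can be expanded by distributivity.\<close>

inductive linear_combination ::
    "'a::{comm_ring,comm_monoid_mult} \<Rightarrow> nat \<Rightarrow> nat \<Rightarrow> 'a rb_term \<Rightarrow> bool" for t where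
  monomial: "f \<in> rb_terms k l \<Longrightarrow> monomial f \<Longrightarrow> linear_combination t k l f"
| plus: "linear_combination t k l f \<Longrightarrow> linear_combination t k l g \<Longrightarrow> linear_combination t k l (f \<oplus>\<^sub>t g)"
| scale: "linear_combination t k l f \<Longrightarrow> linear_combination t k l (a \<odot>\<^sub>t f)"
| cong: "linear_combination t k l f \<Longrightarrow> rb_eq t f g \<Longrightarrow> linear_combination t k l g"

lemma linear_combination_typed:
  "linear_combination t k l f \<Longrightarrow> well_typed f \<and> src f = k \<and> tgt f = l"
  by (induction rule: linear_combination.induct) (auto simp: rb_terms_def dest: rb_eq_typed)

text \<open>Zero arises as \<open>w\<close> minus itself, so some monomial is needed for all
  \<open>k\<close> and \<open>l\<close>; the code that joins nothing supplies one.\<close>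

lemma linear_combination_Zero:
  fixes t :: "'a::{comm_ring,comm_monoid_mult}"
  shows "linear_combination t k l (Zero k l)"
proof -
  have c: "code_valid (replicate n None)" "code_size (replicate n None) = n" for n
    by (induction n) auto
  let ?w = "unbend k (normal_form (replicate (k + l) None)) :: 'a rb_term"
  note nf = normal_form_typed[OF c(1)[of "k + l"], where 'a = 'a]
  note typed = unbend_typed[OF nf(1,2) _ nf(4), of k l]
  have w: "?w \<in> rb_terms k l" "monomial ?w"
    using typed nf(3) c(2)[of "k + l"] by (auto simp: rb_terms_def)
  then have "linear_combination t k l (?w \<oplus>\<^sub>t (- 1) \<odot>\<^sub>t ?w)"
    by (intro linear_combination.plus linear_combination.scale linear_combination.monomial)
  moreover have "rb_eq t (?w \<oplus>\<^sub>t (- 1) \<odot>\<^sub>t ?w) (Zero k l)"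
    using rb_eq.plus_neg[of ?w t] w by (simp add: rb_terms_def)
  ultimately show ?thesis by (rule linear_combination.cong)
qed

text \<open>Bilinearity, by induction on \<open>f\<close> and, once \<open>f\<close> is a monomial,
  on \<open>g\<close>.\<close>

lemma linear_combination_Comp:
  assumes "linear_combination t k l f" "linear_combination t m k g"
  shows "linear_combination t m l (f \<bullet> g)"
  using assms
proof (induction arbitrary: g rule: linear_combination.induct)
  case (monomial f k l)
  then have f: "well_typed f" "src f = k" "tgt f = l" by (auto simp: rb_terms_def)
  from monomial(3,1,2) f show ?case
  proof (induction m k g rule: linear_combination.induct)
    case (monomial g m k)
    then show ?case by (auto intro!: linear_combination.monomial simp: rb_terms_def)
  next
    case (plus m k g h)
    have "linear_combination t m l (f \<bullet> g \<oplus>\<^sub>t f \<bullet> h)" using plus by (intro linear_combination.plus) auto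
    moreover have "rb_eq t (f \<bullet> g \<oplus>\<^sub>t f \<bullet> h) (f \<bullet> (g \<oplus>\<^sub>t h))"
      by (intro rb_eq.sym[OF rb_eq.comp_plus_right])
        (use plus linear_combination_typed in fastforce)
    ultimately show ?case by (rule linear_combination.cong)
  next
    case (scale m k g a)
    have "linear_combination t m l (a \<odot>\<^sub>t (f \<bullet> g))" using scale by (intro linear_combination.scale) auto
    moreover have "rb_eq t (a \<odot>\<^sub>t (f \<bullet> g)) (f \<bullet> (a \<odot>\<^sub>t g))"
      by (intro rb_eq.sym[OF rb_eq.comp_scale_right])
        (use scale linear_combination_typed in fastforce)
    ultimately show ?case by (rule linear_combination.cong)
  next
    case (cong m k g h)
    have "linear_combination t m l (f \<bullet> g)" using cong by auto
    moreover have "rb_eq t (f \<bullet> g) (f \<bullet> h)"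
      by (intro rb_eq.comp_cong rb_eq.refl) (use cong linear_combination_typed in fastforce)+
    ultimately show ?case by (rule linear_combination.cong)
  qed
next
  case (plus k l f h)
  have "linear_combination t m l (f \<bullet> g \<oplus>\<^sub>t h \<bullet> g)" using plus by (intro linear_combination.plus) auto
  moreover have "rb_eq t (f \<bullet> g \<oplus>\<^sub>t h \<bullet> g) ((f \<oplus>\<^sub>t h) \<bullet> g)"
    by (intro rb_eq.sym[OF rb_eq.comp_plus_left])
      (use plus linear_combination_typed in fastforce)
  ultimately show ?case by (rule linear_combination.cong)
next
  case (scale k l f a)
  have "linear_combination t m l (a \<odot>\<^sub>t (f \<bullet> g))" using scale by (intro linear_combination.scale) auto
  moreover have "rb_eq t (a \<odot>\<^sub>t (f \<bullet> g)) ((a \<odot>\<^sub>t f) \<bullet> g)"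
    by (intro rb_eq.sym[OF rb_eq.comp_scale_left])
      (use scale linear_combination_typed in fastforce)
  ultimately show ?case by (rule linear_combination.cong)
next
  case (cong k l f h)
  have "linear_combination t m l (f \<bullet> g)" using cong by auto
  moreover have "rb_eq t (f \<bullet> g) (h \<bullet> g)"
    by (intro rb_eq.comp_cong rb_eq.refl) (use cong linear_combination_typed in fastforce)+
  ultimately show ?case by (rule linear_combination.cong)
qed

lemma linear_combination_Tens:
  assumes "linear_combination t k l f" "linear_combination t k' l' g"
  shows "linear_combination t (k + k') (l + l') (f \<otimes>\<^sub>t g)"
  using assms
proof (induction rule: linear_combination.induct)
  case (monomial f k l)
  then have f: "well_typed f" "src f = k" "tgt f = l" by (auto simp: rb_terms_def)
  from monomial(3,1,2) f show ?case
  proof (induction k' l' g rule: linear_combination.induct)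
    case (monomial g k' l')
    then show ?case by (auto intro!: linear_combination.monomial simp: rb_terms_def)
  next
    case (plus k' l' g h)
    have "linear_combination t (k + k') (l + l') (f \<otimes>\<^sub>t g \<oplus>\<^sub>t f \<otimes>\<^sub>t h)"
      using plus by (intro linear_combination.plus) auto
    moreover have "rb_eq t (f \<otimes>\<^sub>t g \<oplus>\<^sub>t f \<otimes>\<^sub>t h) (f \<otimes>\<^sub>t (g \<oplus>\<^sub>t h))"
      by (intro rb_eq.sym[OF rb_eq.tens_plus_right])
        (use plus linear_combination_typed in fastforce)
    ultimately show ?case by (rule linear_combination.cong)
  next
    case (scale k' l' g a)
    have "linear_combination t (k + k') (l + l') (a \<odot>\<^sub>t (f \<otimes>\<^sub>t g))"
      using scale by (intro linear_combination.scale) auto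
    moreover have "rb_eq t (a \<odot>\<^sub>t (f \<otimes>\<^sub>t g)) (f \<otimes>\<^sub>t (a \<odot>\<^sub>t g))"
      by (intro rb_eq.sym[OF rb_eq.tens_scale_right])
        (use scale linear_combination_typed in fastforce)
    ultimately show ?case by (rule linear_combination.cong)
  next
    case (cong k' l' g h)
    have "linear_combination t (k + k') (l + l') (f \<otimes>\<^sub>t g)" using cong by auto
    moreover have "rb_eq t (f \<otimes>\<^sub>t g) (f \<otimes>\<^sub>t h)"
      by (intro rb_eq.tens_cong rb_eq.refl) (use cong in auto)
    ultimately show ?case by (rule linear_combination.cong)
  qed
next
  case (plus k l f h)
  have "linear_combination t (k + k') (l + l') (f \<otimes>\<^sub>t g \<oplus>\<^sub>t h \<otimes>\<^sub>t g)"
    using plus by (intro linear_combination.plus) auto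
  moreover have "rb_eq t (f \<otimes>\<^sub>t g \<oplus>\<^sub>t h \<otimes>\<^sub>t g) ((f \<oplus>\<^sub>t h) \<otimes>\<^sub>t g)"
    by (intro rb_eq.sym[OF rb_eq.tens_plus_left])
      (use plus linear_combination_typed in fastforce)
  ultimately show ?case by (rule linear_combination.cong)
next
  case (scale k l f a)
  have "linear_combination t (k + k') (l + l') (a \<odot>\<^sub>t (f \<otimes>\<^sub>t g))"
    using scale by (intro linear_combination.scale) auto
  moreover have "rb_eq t (a \<odot>\<^sub>t (f \<otimes>\<^sub>t g)) ((a \<odot>\<^sub>t f) \<otimes>\<^sub>t g)"
    by (intro rb_eq.sym[OF rb_eq.tens_scale_left])
      (use scale linear_combination_typed in fastforce)
  ultimately show ?case by (rule linear_combination.cong)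
next
  case (cong k l f h)
  have "linear_combination t (k + k') (l + l') (f \<otimes>\<^sub>t g)" using cong by auto
  moreover have "rb_eq t (f \<otimes>\<^sub>t g) (h \<otimes>\<^sub>t g)"
    by (intro rb_eq.tens_cong rb_eq.refl) (use cong linear_combination_typed in fastforce)+
  ultimately show ?case by (rule linear_combination.cong)
qed

lemma linear_combination_well_typed:
  "well_typed f \<Longrightarrow> linear_combination t (src f) (tgt f) f"
proof (induction f)
  case (Comp f g)
  then show ?case using linear_combination_Comp[of t "src f" "tgt f" f "src g" g] by simp
next
  case (Tens f g)
  then show ?case
    using linear_combination_Tens[of t "src f" "tgt f" f "src g" "tgt g" g] by simp
next
  case (Zero k l)
  show ?case using linear_combination_Zero by simp
next
  case (Plus f g)
  then show ?case by (auto intro: linear_combination.plus)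
next
  case (Scale a f)
  then show ?case by (auto intro: linear_combination.scale)
qed (auto intro!: linear_combination.monomial simp: rb_terms_def)

section \<open>The module structure on spaces of morphisms\<close>

lemma rb_Hom_simps:
  "carrier (rb_Hom t k l) = states t k l"
  "\<zero>\<^bsub>rb_Hom t k l\<^esub> = rb_class t (Zero k l)"
  "a \<odot>\<^bsub>rb_Hom t k l\<^esub> X = class_scale t a X"
  by (auto simp: rb_Hom_def states_def class_scale_def)

lemma rb_Hom_add:
  assumes "f \<in> rb_terms k l" "g \<in> rb_terms k l"
  shows "rb_class t f \<oplus>\<^bsub>rb_Hom t k l\<^esub> rb_class t g = rb_class t (f \<oplus>\<^sub>t g)"
proof -
  from assms have *: "well_typed f" "well_typed g" "src f = src g" "tgt f = tgt g"
    by (auto simp: rb_terms_def)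
  have "rb_eq t (f \<oplus>\<^sub>t g) h" if "rb_eq t f f'" "rb_eq t g g'" "rb_eq t (f' \<oplus>\<^sub>t g') h" for f' g' h
    using rb_eq.trans[OF rb_eq.plus_cong[OF that(1,2) *(3,4)] that(3)] .
  then show ?thesis
    using rb_eq.refl[OF *(1), of t] rb_eq.refl[OF *(2), of t] by (auto simp: rb_Hom_def rb_class_def)
qed

lemma cring_scalars: "cring (scalars :: 'a::{comm_ring,comm_monoid_mult} ring)"
proof (rule cringI)
  show "abelian_group (scalars :: 'a ring)"
    by (rule abelian_groupI)
      (auto simp: scalars_def add.assoc add.commute intro: exI[of _ "- _"] left_minus)
  show "comm_monoid (scalars :: 'a ring)"
    by (rule comm_monoidI) (auto simp: scalars_def ac_simps)
qed (auto simp: scalars_def distrib_right)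

lemma module_rb_Hom:
  fixes t :: "'a::{comm_ring,comm_monoid_mult}"
  shows "module scalars (rb_Hom t k l)"
proof (rule moduleI)
  let ?M = "rb_Hom t k l"
  have Plus: "f \<oplus>\<^sub>t g \<in> rb_terms k l" if "f \<in> rb_terms k l" "g \<in> rb_terms k l" for f g :: "'a rb_term"
    using that by (auto simp: rb_terms_def)
  have Scale: "a \<odot>\<^sub>t f \<in> rb_terms k l" if "f \<in> rb_terms k l" for a and f :: "'a rb_term"
    using that by (auto simp: rb_terms_def)
  have Zero: "(Zero k l :: 'a rb_term) \<in> rb_terms k l" by (simp add: rb_terms_def)
  have scale: "class_scale t a (rb_class t f) = rb_class t (a \<odot>\<^sub>t f)" if "f \<in> rb_terms k l" for a f
    using that by (simp add: class_scale_class rb_terms_def)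
  have eq: "rb_class t f = rb_class t g" if "rb_eq t f g" for f g
    using that rb_class_eq_iff rb_eq_typed by blast
  show "cring scalars" by (rule cring_scalars)
  show "abelian_group ?M"
  proof (rule abelian_groupI; (unfold rb_Hom_simps states_def)?)
    show "rb_class t (Zero k l) \<in> rb_class t ` rb_terms k l" using Zero by blast
    fix X assume "X \<in> rb_class t ` rb_terms k l"
    then obtain f where f: "X = rb_class t f" "f \<in> rb_terms k l" by blast
    then have tf: "well_typed f" "src f = k" "tgt f = l" by (auto simp: rb_terms_def)
    have "rb_eq t (Zero k l \<oplus>\<^sub>t f) (f \<oplus>\<^sub>t Zero k l)" by (rule rb_eq.plus_commute) (use tf in simp)
    also have "rb_eq t \<dots> f" using rb_eq.plus_zero[OF tf(1)] tf by simp
    finally show "rb_class t (Zero k l) \<oplus>\<^bsub>?M\<^esub> X = X"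
      unfolding f(1) rb_Hom_add[OF Zero f(2)] by (rule eq)
    have "rb_eq t ((- 1) \<odot>\<^sub>t f \<oplus>\<^sub>t f) (f \<oplus>\<^sub>t (- 1) \<odot>\<^sub>t f)" by (rule rb_eq.plus_commute) (use tf in simp)
    also have "rb_eq t \<dots> (Zero k l)" using rb_eq.plus_neg[OF tf(1)] tf by simp
    finally have "rb_class t ((- 1) \<odot>\<^sub>t f) \<oplus>\<^bsub>?M\<^esub> X = rb_class t (Zero k l)"
      unfolding f(1) rb_Hom_add[OF Scale[OF f(2)] f(2)] by (rule eq)
    then show "\<exists>Y\<in>rb_class t ` rb_terms k l. Y \<oplus>\<^bsub>?M\<^esub> X = rb_class t (Zero k l)"
      using Scale[OF f(2)] by blast
    fix Y assume "Y \<in> rb_class t ` rb_terms k l"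
    then obtain g where g: "Y = rb_class t g" "g \<in> rb_terms k l" by blast
    then have tg: "well_typed g" "src g = k" "tgt g = l" by (auto simp: rb_terms_def)
    show "X \<oplus>\<^bsub>?M\<^esub> Y \<in> rb_class t ` rb_terms k l" 
      unfolding f(1) g(1) rb_Hom_add[OF f(2) g(2)] by (rule imageI) (rule Plus[OF f(2) g(2)])
    have "rb_eq t (f \<oplus>\<^sub>t g) (g \<oplus>\<^sub>t f)" by (rule rb_eq.plus_commute) (use tf tg in simp)
    then show "X \<oplus>\<^bsub>?M\<^esub> Y = Y \<oplus>\<^bsub>?M\<^esub> X"
      unfolding f(1) g(1) rb_Hom_add[OF f(2) g(2)] rb_Hom_add[OF g(2) f(2)] by (rule eq)
    fix Z assume "Z \<in> rb_class t ` rb_terms k l"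
    then obtain h where h: "Z = rb_class t h" "h \<in> rb_terms k l" by blast
    then have th: "well_typed h" "src h = k" "tgt h = l" by (auto simp: rb_terms_def)
    have "rb_eq t ((f \<oplus>\<^sub>t g) \<oplus>\<^sub>t h) (f \<oplus>\<^sub>t (g \<oplus>\<^sub>t h))"
      by (rule rb_eq.plus_assoc) (use tf tg th in simp)
    then show "(X \<oplus>\<^bsub>?M\<^esub> Y) \<oplus>\<^bsub>?M\<^esub> Z = X \<oplus>\<^bsub>?M\<^esub> (Y \<oplus>\<^bsub>?M\<^esub> Z)"
      unfolding f(1) g(1) h(1) rb_Hom_add[OF f(2) g(2)] rb_Hom_add[OF g(2) h(2)]
        rb_Hom_add[OF Plus[OF f(2) g(2)] h(2)] rb_Hom_add[OF f(2) Plus[OF g(2) h(2)]]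
      by (rule eq)
  qed
  fix X assume "X \<in> carrier ?M"
  then obtain f where f: "X = rb_class t f" "f \<in> rb_terms k l" by (auto simp: rb_Hom_simps states_def)
  then have tf: "well_typed f" "src f = k" "tgt f = l" by (auto simp: rb_terms_def)
  show "\<one>\<^bsub>scalars\<^esub> \<odot>\<^bsub>?M\<^esub> X = X"
    using eq[OF rb_eq.scale_one[OF tf(1)]] f by (simp add: rb_Hom_simps scale scalars_def)
  fix a :: 'a
  show "a \<odot>\<^bsub>?M\<^esub> X \<in> carrier ?M"
    unfolding rb_Hom_simps states_def f(1) scale[OF f(2)] by (rule imageI) (rule Scale[OF f(2)])
  fix b :: 'a
  show "(a \<oplus>\<^bsub>scalars\<^esub> b) \<odot>\<^bsub>?M\<^esub> X = a \<odot>\<^bsub>?M\<^esub> X \<oplus>\<^bsub>?M\<^esub> b \<odot>\<^bsub>?M\<^esub> X"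
    using eq[OF rb_eq.scale_add[OF tf(1)]] f Scale
    by (simp add: rb_Hom_simps scale scalars_def rb_Hom_add)
  show "(a \<otimes>\<^bsub>scalars\<^esub> b) \<odot>\<^bsub>?M\<^esub> X = a \<odot>\<^bsub>?M\<^esub> (b \<odot>\<^bsub>?M\<^esub> X)"
    using eq[OF rb_eq.scale_scale[OF tf(1)]] f Scale by (simp add: rb_Hom_simps scale scalars_def)
  fix Y assume "Y \<in> carrier ?M"
  then obtain g where g: "Y = rb_class t g" "g \<in> rb_terms k l" by (auto simp: rb_Hom_simps states_def)
  have "rb_eq t (a \<odot>\<^sub>t (f \<oplus>\<^sub>t g)) (a \<odot>\<^sub>t f \<oplus>\<^sub>t a \<odot>\<^sub>t g)"
    by (rule rb_eq.scale_plus) (use f g in \<open>auto simp: rb_terms_def\<close>)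
  from eq[OF this] show "a \<odot>\<^bsub>?M\<^esub> (X \<oplus>\<^bsub>?M\<^esub> Y) = a \<odot>\<^bsub>?M\<^esub> X \<oplus>\<^bsub>?M\<^esub> a \<odot>\<^bsub>?M\<^esub> Y"
    using f g Plus Scale by (simp add: rb_Hom_simps scale rb_Hom_add)
qed

lemma finite_rook_brauer_diagrams: "finite (rook_brauer_diagrams k l)"
proof (rule finite_subset)
  show "rook_brauer_diagrams k l \<subseteq> Pow (Pow (vertices k l))"
    by (auto simp: rook_brauer_diagrams_def partitions_iff partition_on_def)
qed (simp add: vertices_def)

text \<open>Any representative serves, by \<open>rb_eq_par_functor\<close>.\<close>

definition class_functor ::
    "'a::{comm_ring,comm_monoid_mult} \<Rightarrow> 'a rb_term set \<Rightarrow> 'a par_morphism" where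
  "class_functor t X = par_functor t (SOME f. f \<in> X)"

lemma class_functor_class:
  assumes "well_typed f"
  shows "class_functor t (rb_class t f) = par_functor t f"
proof -
  have "f \<in> rb_class t f" using rb_eq.refl[OF assms] by (simp add: rb_class_def)
  then have "(SOME g. g \<in> rb_class t f) \<in> rb_class t f" by (rule someI)
  then show ?thesis
    using rb_eq_par_functor by (fastforce simp: class_functor_def rb_class_def)
qed

text \<open>An arbitrary choice of a way to build each diagram; the basis property is proved for
  every such choice.\<close>

locale diagram_family =
  fixes t :: "'a::{comm_ring,comm_monoid_mult}" and k l :: nat and b :: "diagram \<Rightarrow> 'a rb_term set"
  assumes diagram_morphism: "D \<in> rook_brauer_diagrams k l \<Longrightarrow> diagram_morphism t k l D (b D)"
begin

abbreviation H where "H \<equiv> rb_Hom t k l"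

abbreviation RB where "RB \<equiv> rook_brauer_diagrams k l"

sublocale module scalars H
  by (rule module_rb_Hom)

lemma b_carrier: "b \<in> RB \<rightarrow> carrier H"
  using diagram_morphism by (fastforce simp: diagram_morphism_def rb_Hom_simps states_def)

definition combination :: "(diagram \<Rightarrow> 'a) \<Rightarrow> 'a rb_term set" where
  "combination c = (\<Oplus>\<^bsub>H\<^esub>D\<in>RB. c D \<odot>\<^bsub>H\<^esub> b D)"

lemma scaled_b_carrier: "(\<lambda>D. c D \<odot>\<^bsub>H\<^esub> b D) \<in> RB \<rightarrow> carrier H"
  using b_carrier smult_closed by (auto simp: scalars_def)

lemma combination_add: "combination c \<oplus>\<^bsub>H\<^esub> combination d = combination (\<lambda>D. c D + d D)"
proof -
  have "combination c \<oplus>\<^bsub>H\<^esub> combination d = (\<Oplus>\<^bsub>H\<^esub>D\<in>RB.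
      c D \<odot>\<^bsub>H\<^esub> b D \<oplus>\<^bsub>H\<^esub> d D \<odot>\<^bsub>H\<^esub> b D)"
    unfolding combination_def by (rule M.finsum_addf[OF scaled_b_carrier scaled_b_carrier, symmetric])
  also have "\<dots> = combination (\<lambda>D. c D + d D)"
    unfolding combination_def
  proof (rule M.finsum_cong')
    fix D assume "D \<in> RB"
    then have "b D \<in> carrier H" using b_carrier by auto
    then show "c D \<odot>\<^bsub>H\<^esub> b D \<oplus>\<^bsub>H\<^esub> d D \<odot>\<^bsub>H\<^esub> b D =
        (c D + d D) \<odot>\<^bsub>H\<^esub> b D"
      using smult_l_distr[of "c D" "d D" "b D"] by (simp add: scalars_def)
  qed (use scaled_b_carrier in auto)
  finally show ?thesis .
qed

lemma combination_scale: "a \<odot>\<^bsub>H\<^esub> combination c = combination (\<lambda>D. a * c D)"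
proof -
  have "a \<odot>\<^bsub>H\<^esub> combination c = (\<Oplus>\<^bsub>H\<^esub>D\<in>RB.
      a \<odot>\<^bsub>H\<^esub> (c D \<odot>\<^bsub>H\<^esub> b D))"
    unfolding combination_def
    by (rule finsum_smult_ldistr[OF finite_rook_brauer_diagrams _ scaled_b_carrier]) (simp add: scalars_def)
  also have "\<dots> = combination (\<lambda>D. a * c D)"
    unfolding combination_def
  proof (rule M.finsum_cong')
    fix D assume "D \<in> RB"
    then have "b D \<in> carrier H" using b_carrier by auto
    then show "a \<odot>\<^bsub>H\<^esub> (c D \<odot>\<^bsub>H\<^esub> b D) = (a * c D) \<odot>\<^bsub>H\<^esub> b D"
      using smult_assoc1[of a "c D" "b D"] by (simp add: scalars_def)
  qed (use scaled_b_carrier in auto)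
  finally show ?thesis .
qed

lemma combination_single:
  assumes D: "D \<in> RB"
  shows "combination (\<lambda>E. if E = D then 1 else 0) = b D"
proof -
  have "combination (\<lambda>E. if E = D then 1 else 0) =
      (\<Oplus>\<^bsub>H\<^esub>E\<in>RB. if D = E then b E else \<zero>\<^bsub>H\<^esub>)"
    unfolding combination_def
  proof (rule M.finsum_cong')
    fix E assume "E \<in> RB"
    then have "b E \<in> carrier H" using b_carrier by auto
    then show "(if E = D then 1 else 0) \<odot>\<^bsub>H\<^esub> b E = (if D = E then b E else \<zero>\<^bsub>H\<^esub>)"
      using smult_one[of "b E"] smult_l_null[of "b E"] by (auto simp: scalars_def)
  qed (use b_carrier in auto)
  also have "\<dots> = b D"
    by (rule M.finsum_singleton[OF D finite_rook_brauer_diagrams b_carrier])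
  finally show ?thesis .
qed

text \<open>The chosen morphisms are sent to the diagrams themselves, so coefficients can be read
  off in the partition category; this is the source of linear independence.\<close>

lemma class_functor_combination:
  "class_functor t (combination c) = (\<Sum>D\<in>RB. single D (c D))"
proof -
  have "class_functor t (\<Oplus>\<^bsub>H\<^esub>D\<in>A. c D \<odot>\<^bsub>H\<^esub> b D) =
      (\<Sum>D\<in>A. single D (c D))" if "finite A" "A \<subseteq> RB" for A
    using that
  proof (induction A)
    case empty
    show ?case by (simp add: rb_Hom_simps class_functor_class)
  next
    case (insert D A)
    let ?s = "\<Oplus>\<^bsub>H\<^esub>D\<in>A. c D \<odot>\<^bsub>H\<^esub> b D"
    have mem: "(\<lambda>D. c D \<odot>\<^bsub>H\<^esub> b D) \<in> A \<rightarrow> carrier H"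
      using scaled_b_carrier insert.prems by blast
    obtain w where w: "w \<in> rb_terms k l" "par_functor t w = single D 1" "b D = rb_class t w"
      using diagram_morphism[of D] insert.prems by (auto simp: diagram_morphism_def)
    have "?s \<in> carrier H" by (rule M.finsum_closed[OF mem])
    then obtain f where f: "f \<in> rb_terms k l" "?s = rb_class t f" by (auto simp: rb_Hom_simps states_def)
    have cw: "c D \<odot>\<^bsub>H\<^esub> b D = rb_class t (c D \<odot>\<^sub>t w)" "c D \<odot>\<^sub>t w \<in> rb_terms k l"
      using w by (auto simp: rb_Hom_simps class_scale_class rb_terms_def)
    have "(\<Oplus>\<^bsub>H\<^esub>D\<in>insert D A. c D \<odot>\<^bsub>H\<^esub> b D) = rb_class t (c D \<odot>\<^sub>t w) \<oplus>\<^bsub>H\<^esub> ?s"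
      unfolding cw(1)[symmetric]
      by (rule M.finsum_insert) (use insert mem scaled_b_carrier in auto)
    also have "\<dots> = rb_class t (c D \<odot>\<^sub>t w \<oplus>\<^sub>t f)" unfolding f(2) by (rule rb_Hom_add[OF cw(2) f(1)])
    finally have "class_functor t (\<Oplus>\<^bsub>H\<^esub>D\<in>insert D A. c D \<odot>\<^bsub>H\<^esub> b D) =
        par_functor t (c D \<odot>\<^sub>t w) + par_functor t f"
      using cw(2) f(1) by (simp add: class_functor_class rb_terms_def)
    also have "par_functor t f = (\<Sum>D\<in>A. single D (c D))"
      using insert f by (simp add: class_functor_class rb_terms_def)
    finally show ?case using insert w(2) by (simp add: pm_scale_single)
  qed
  then show ?thesis using finite_rook_brauer_diagrams by (simp add: combination_def)
qed

lemma combination_eq_zeroD: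
  assumes "combination c = \<zero>\<^bsub>H\<^esub>" "D \<in> RB"
  shows "c D = 0"
proof -
  have "(\<Sum>E\<in>RB. single E (c E)) = 0"
    using class_functor_combination[of c] assms(1) by (simp add: rb_Hom_simps class_functor_class)
  then have "coeff (\<Sum>E\<in>RB. single E (c E)) D = 0"
    by simp
  then show ?thesis
    using assms(2) finite_rook_brauer_diagrams by (simp add: lookup_sum lookup_single when_def)
qed

lemma combination_carrier: "combination c \<in> carrier H"
  unfolding combination_def by (rule M.finsum_closed[OF scaled_b_carrier])

text \<open>The heart is the monomial case: a monomial is a power of \<open>t\<close> times a word
  for some rook-Brauer diagram, and that word equals the chosen one by
  \<open>monomial_rb_eq_unique\<close>, which requires \<open>1 \<noteq> 0\<close>.\<close>

lemma linear_combination_combination: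
  assumes nz: "(1::'a) \<noteq> 0" and "linear_combination t k' l' f" "k' = k" "l' = l"
  shows "\<exists>c. rb_class t f = combination c"
  using assms(2-)
proof (induction rule: linear_combination.induct)
  case (monomial f k' l')
  then have f: "monomial f" "f \<in> rb_terms k l" by auto
  obtain D e w where w: "D \<in> RB" "w \<in> rb_terms k l" "monomial w"
    "par_functor t w = single D 1" "rb_eq t f (t ^ e \<odot>\<^sub>t w)"
    using monomial_rb_eq_diagram[OF f] by metis
  obtain w' where w': "w' \<in> rb_terms k l" "monomial w'" "par_functor t w' = single D 1"
    "b D = rb_class t w'"
    using diagram_morphism[OF w(1)] by (auto simp: diagram_morphism_def)
  have "rb_eq t w w'" by (rule monomial_rb_eq_unique[OF nz w(3,2,4) w'(2,1,3)])
  then have "rb_eq t f (t ^ e \<odot>\<^sub>t w')" using rb_eq.trans[OF w(5) rb_eq.scale_cong] by blast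
  then have "rb_class t f = t ^ e \<odot>\<^bsub>H\<^esub> b D"
    using w'(1,4) f(2) by (simp add: rb_Hom_simps class_scale_class rb_terms_def rb_class_eq_iff)
  also have "\<dots> = combination (\<lambda>E. t ^ e * (if E = D then 1 else 0))"
    by (simp only: combination_single[OF w(1), symmetric] combination_scale)
  finally show ?case by blast
next
  case (plus k' l' f g)
  then obtain c d where "rb_class t f = combination c" "rb_class t g = combination d" by auto
  moreover have "f \<in> rb_terms k l" "g \<in> rb_terms k l"
    using plus linear_combination_typed by (auto simp: rb_terms_def)
  ultimately have "rb_class t (f \<oplus>\<^sub>t g) = combination c \<oplus>\<^bsub>H\<^esub> combination d"
    using rb_Hom_add by metis
  then show ?case using combination_add by metis
next
  case (scale k' l' f a)
  then obtain c where "rb_class t f = combination c" by auto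
  then have "rb_class t (a \<odot>\<^sub>t f) = a \<odot>\<^bsub>H\<^esub> combination c"
    using class_scale_class[of f t a] linear_combination_typed[OF scale(1)] by (simp add: rb_Hom_simps)
  then show ?case using combination_scale by metis
next
  case (cong k' l' f g)
  then show ?case using rb_class_eq_iff[of f t g] linear_combination_typed[OF cong(1)] by metis
qed

text \<open>Over the zero ring a monomial does not determine its diagram, but all Hom modules vanish.\<close>

lemma exists_combination:
  assumes X: "X \<in> carrier H"
  shows "\<exists>c. X = combination c"
proof (cases "(1::'a) = 0")
  case True
  have "Y = \<zero>\<^bsub>H\<^esub>" if "Y \<in> carrier H" for Y
    using smult_one[OF that] smult_l_null[OF that] True by (simp add: scalars_def)
  then show ?thesis using X combination_carrier by metis
next
  case False
  obtain f where f: "X = rb_class t f" "well_typed f" "src f = k" "tgt f = l"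
    using X by (auto simp: rb_Hom_simps states_def rb_terms_def)
  then show ?thesis
    using linear_combination_combination[OF False linear_combination_well_typed[OF f(2)]] by simp
qed

lemma finite_basis: "finite_basis scalars H RB b"
  unfolding finite_basis_def
proof (intro conjI ballI impI)
  show "module scalars H" by (rule module_rb_Hom)
  show "finite RB" by (rule finite_rook_brauer_diagrams)
  show "b \<in> RB \<rightarrow> carrier H" by (rule b_carrier)
  show "\<exists>c\<in>RB \<rightarrow> carrier scalars.
      X = (\<Oplus>\<^bsub>H\<^esub>D\<in>RB. c D \<odot>\<^bsub>H\<^esub> b D)"
    if "X \<in> carrier H" for X
    using exists_combination[OF that] by (auto simp: combination_def scalars_def)
  show "c D = \<zero>\<^bsub>scalars\<^esub>"
    if "(\<Oplus>\<^bsub>H\<^esub>D\<in>RB. c D \<odot>\<^bsub>H\<^esub> b D) = \<zero>\<^bsub>H\<^esub>"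
      "D \<in> RB" for c D
    using combination_eq_zeroD[of c D] that by (simp add: combination_def scalars_def)
qed

end

lemma exists_diagram_morphism:
  fixes t :: "'a::{comm_ring,comm_monoid_mult}"
  assumes "D \<in> rook_brauer_diagrams k l"
  shows "\<exists>X. diagram_morphism t k l D X"
proof -
  obtain c where c: "code_valid c" "code_size c = k + l"
    "par_functor t (unbend k (normal_form c)) = single D 1"
    using diagram_code[OF assms, of t] by metis
  note nf = normal_form_typed[OF c(1), where 'a = 'a]
  have "unbend k (normal_form c :: 'a rb_term) \<in> rb_terms k l" "monomial (unbend k (normal_form c :: 'a rb_term))"
    using unbend_typed[OF nf(1,2) _ nf(4), of k l] nf(3) c(2) by (auto simp: rb_terms_def)
  with c(3) show ?thesis unfolding diagram_morphism_def by blast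
qed

theorem theorem6p10:
  fixes t :: "'a::{comm_ring,comm_monoid_mult}" and k l :: nat
  shows "(\<forall>D\<in>rook_brauer_diagrams k l. \<exists>X. diagram_morphism t k l D X) \<and>
    (\<forall>b. (\<forall>D\<in>rook_brauer_diagrams k l. diagram_morphism t k l D (b D)) \<longrightarrow>
       finite_basis scalars (rb_Hom t k l) (rook_brauer_diagrams k l) b)"
  using exists_diagram_morphism diagram_family.finite_basis[of t k l]
  by (auto simp: diagram_family_def)

end
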